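(* Let $H=(H,m,\Delta,\varepsilon)$ be a bialgebra over a field $\Bbbk$ and let $\mathscr C$ be a full abelian subcategory of the category of left $H$-modules which is closed under submodules and is a tensor subcategory, equipped with a finite duality functor ${}^\star$ for which there is a natural isomorphism $(V\otimes V')^\star\cong V'{}^\star\otimes V^\star$ of right $H$-modules for all $V,V'\in\mathscr C$. Then: (a) $H^*_V\cdot H^*_{V'}=H^*_{V\otimes V'}$ for all $V,V'\in\mathscr C$ (the left-hand side being the span of all products). In particular, $H^*_{\mathscr C}$ is a subalgebra of $H^*$. (b) $z_V\cdot z_{V'}=z_{V\otimes V'}$ for all finite dimensional $V,V'\in\mathscr C$. In particular, if all objects of $\mathscr C$ are finite dimensional, then $\mathcal Z_{\mathscr C}$ is a subring of $(H^*_{\mathscr C})^H$ and the map $K_0(\mathscr C)\to\mathcal Z_{\mathscr C}$, $|V|\mapsto z_V$, is an isomorphism of rings.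
   Context: The left (resp. right) action of $H$ is denoted $\triangleright$ (resp. $\triangleleft$). For a left $H$-module $V$, $V^*=\mathrm{Hom}_\Bbbk(V,\Bbbk)$ is a right $H$-module via $\langle v,f\triangleleft h\rangle_V=\langle h\triangleright v,f\rangle_V$, where $\langle\cdot,\cdot\rangle_V$ is the evaluation pairing. A finite duality functor is a (contravariant, additive) functor ${}^\star$ from $\mathscr C$ to right $H$-modules, acting on morphisms by transposition, such that $V^\star\subseteq V^*$ is an $H$-submodule, with equality if and only if $V$ is finite dimensional, and such that the evaluation pairing restricted to $V\otimes V^\star$ is non-degenerate; here $D(V):=\mathrm{End}_HV^\star=(\mathrm{End}_HV)^{op}$. The natural isomorphism $V'{}^\star\otimes V^\star\cong(V\otimes V')^\star$ is the one for which $f'\otimes f$ corresponds to the functional $v\otimes v'\mapsto\langle v,f\rangle_V\langle v',f'\rangle_{V'}$. $H^*=\mathrm{Hom}_\Bbbk(H,\Bbbk)$ is an $H$-bimodule via $(h\triangleright\xi\triangleleft h')(x)=\xi(h'xh)$ and a unital algebra via $(\phi\cdot\xi)(h)=\phi(h_{(1)})\xi(h_{(2)})$, where $\Delta(h)=h_{(1)}\otimes h_{(2)}$ (Sweedler notation), with unity $\varepsilon$. For $V\in\mathscr C$, $\beta_V:V\otimes_{D(V)}V^\star\to H^*$ is given by $\beta_V(v\otimes f)(h)=\langle h\triangleright v,f\rangle_V$; $H^*_V=\mathrm{Im}\,\beta_V$ and $H^*_{\mathscr C}=\sum_{V\in\mathscr C}H^*_V$. For $V$ finite dimensional, $z_V=\beta_V(1_V)\in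 H^*_V$, where $1_V\in V\otimes V^*$ is the canonical element corresponding to $\mathrm{id}_V$; thus $z_V(h)$ is the trace of $h$ on $V$. For an $H$-bimodule $B$, $B^H=\{b\in B: h\triangleright b=b\triangleleft h\ \forall h\in H\}$. Set $\mathcal Z_{\mathscr C}=\sum_V\mathbb Zz_V$ (sum over isomorphism classes of objects, when all objects are finite dimensional). $K_0(\mathscr C)$ is the Grothendieck group of $\mathscr C$ with multiplication induced by the tensor product, and $|V|$ is the class of $V$.
   Formalization: Injectivity of K_0(C) → Z_C is stated only in characteristic 0: in characteristic p it always fails, since p·z_1 = pε = 0 while p|1| ≠ 0 for the trivial module 1. Over any field the map is stated to be a surjective ring homomorphism. *)

theory Defs
  imports "HOL-Algebra.Algebra"
begin

section \<open>Vector spaces and tensor products\<close>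

text \<open>
  Modules are records of the library type \<^typ>\<open>('r, 'v) module\<close>; its fields \<open>mult\<close> and \<open>one\<close> play no
  role.  With scalars from a field \<^typ>\<open>'k\<close> such a record describes a \<open>'k\<close>-vector space, with scalars
  from the bialgebra it describes a left or a right module (in the latter case \<open>h \<odot> f\<close> stands for
  \<open>f \<triangleleft> h\<close>).
\<close>

text \<open>Functionals are extended by zero, so that they are added pointwise and equal iff they agree on
  the carrier.\<close>

definition linear_forms :: "('k::field, 'a) module \<Rightarrow> ('a \<Rightarrow> 'k) set" where
  "linear_forms A = {f.
     (\<forall>x. x \<notin> carrier A \<longrightarrow> f x = 0) \<and>
     (\<forall>x\<in>carrier A. \<forall>y\<in>carrier A. f (x \<oplus>\<^bsub>A\<^esub> y) = f x + f y) \<and>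
     (\<forall>c. \<forall>x\<in>carrier A. f (c \<odot>\<^bsub>A\<^esub> x) = c * f x)}"

definition bilinear_forms ::
  "('k::field, 'a) module \<Rightarrow> ('k, 'b) module \<Rightarrow> ('a \<Rightarrow> 'b \<Rightarrow> 'k) set" where
  "bilinear_forms A B = {\<beta>.
     (\<forall>x\<in>carrier A. \<forall>x'\<in>carrier A. \<forall>y\<in>carrier B. \<beta> (x \<oplus>\<^bsub>A\<^esub> x') y = \<beta> x y + \<beta> x' y) \<and>
     (\<forall>x\<in>carrier A. \<forall>y\<in>carrier B. \<forall>y'\<in>carrier B. \<beta> x (y \<oplus>\<^bsub>B\<^esub> y') = \<beta> x y + \<beta> x y') \<and>
     (\<forall>c. \<forall>x\<in>carrier A. \<forall>y\<in>carrier B. \<beta> (c \<odot>\<^bsub>A\<^esub> x) y = c * \<beta> x y \<and> \<beta> x (c \<odot>\<^bsub>B\<^esub> y) = c * \<beta> x y)}"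

text \<open>
  Tensor products over the field (and, with a smaller set of forms, tensor products over a ring
  acting on both factors) are realised inside the dual of their dual space: the linear dual of
  \<open>A \<otimes> B\<close> is the space \<open>F\<close> of (balanced) bilinear forms, and a vector space embeds into
  its double dual.  Thus \<open>x \<otimes> y\<close> is evaluation at \<open>(x, y)\<close>, and the tensor product is the span of
  these evaluations.  An element \<open>\<tau> = \<Sum> x\<^sub>i \<otimes> y\<^sub>i\<close> is a function on forms, \<open>\<tau> \<beta> = \<Sum> \<beta> x\<^sub>i y\<^sub>i\<close>;
  in other words, \<open>\<tau> \<beta>\<close> is the image of \<open>\<tau>\<close> under the linear map induced by \<open>\<beta>\<close>.
\<close>

type_synonym ('a, 'b, 'k) tensor = "('a \<Rightarrow> 'b \<Rightarrow> 'k) \<Rightarrow> 'k"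

definition pure_tensor :: "('a \<Rightarrow> 'b \<Rightarrow> 'k::field) set \<Rightarrow> 'a \<Rightarrow> 'b \<Rightarrow> ('a, 'b, 'k) tensor" where
  "pure_tensor F x y = (\<lambda>\<beta>. if \<beta> \<in> F then \<beta> x y else 0)"

definition tensor_sum ::
  "('a \<Rightarrow> 'b \<Rightarrow> 'k::field) set \<Rightarrow> nat \<Rightarrow> (nat \<Rightarrow> 'a) \<Rightarrow> (nat \<Rightarrow> 'b) \<Rightarrow> ('a, 'b, 'k) tensor" where
  "tensor_sum F n x y = (\<lambda>\<beta>. \<Sum>i<n. pure_tensor F (x i) (y i) \<beta>)"

definition tensor_span ::
  "('a \<Rightarrow> 'b \<Rightarrow> 'k::field) set \<Rightarrow> 'a set \<Rightarrow> 'b set \<Rightarrow> ('a, 'b, 'k) tensor set" where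
  "tensor_span F A B =
     {tensor_sum F n x y | n x y. \<forall>i<n. x i \<in> A \<and> y i \<in> B}"

definition tensor_space ::
  "('k::field, 'a) module \<Rightarrow> ('k, 'b) module \<Rightarrow> ('k, ('a, 'b, 'k) tensor) module" where
  "tensor_space A B =
     \<lparr>carrier = tensor_span (bilinear_forms A B) (carrier A) (carrier B),
      monoid.mult = undefined, one = undefined,
      ring.zero = (\<lambda>\<beta>. 0), add = (\<lambda>\<sigma> \<tau> \<beta>. \<sigma> \<beta> + \<tau> \<beta>), smult = (\<lambda>c \<tau> \<beta>. c * \<tau> \<beta>)\<rparr>"


section \<open>Bialgebras\<close>

text \<open>The ring structure of the bialgebra is that of the type \<^typ>\<open>'h\<close>.\<close>

record ('k, 'h) bialg =
  scl :: "'k \<Rightarrow> 'h \<Rightarrow> 'h"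
  comult :: "'h \<Rightarrow> ('h, 'h, 'k) tensor"
  counit :: "'h \<Rightarrow> 'k"

definition alg_space :: "('k::field, 'h::ring_1) bialg \<Rightarrow> ('k, 'h) module" where
  "alg_space H =
     \<lparr>carrier = UNIV, monoid.mult = (*), one = 1, ring.zero = 0, add = (+), smult = scl H\<rparr>"

abbreviation H2_forms :: "('k::field, 'h::ring_1) bialg \<Rightarrow> ('h \<Rightarrow> 'h \<Rightarrow> 'k) set" where
  "H2_forms H \<equiv> bilinear_forms (alg_space H) (alg_space H)"

definition H3_forms :: "('k::field, 'h::ring_1) bialg \<Rightarrow> ('h \<Rightarrow> 'h \<Rightarrow> 'h \<Rightarrow> 'k) set" where
  "H3_forms H = {t. (\<forall>z. (\<lambda>x y. t x y z) \<in> H2_forms H) \<and> (\<forall>x. t x \<in> H2_forms H)}"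

text \<open>The product \<open>(a \<otimes> a') (b \<otimes> b') = a b \<otimes> a' b'\<close> of \<open>H \<otimes> H\<close>.\<close>

definition tensor_mult ::
  "('k::field, 'h::ring_1) bialg \<Rightarrow> ('h, 'h, 'k) tensor \<Rightarrow> ('h, 'h, 'k) tensor \<Rightarrow> ('h, 'h, 'k) tensor" where
  "tensor_mult H \<sigma> \<tau> =
     (\<lambda>\<beta>. if \<beta> \<in> H2_forms H then \<sigma> (\<lambda>a a'. \<tau> (\<lambda>b b'. \<beta> (a * b) (a' * b'))) else 0)"

definition unital_algebra :: "('k::field, 'h::ring_1) bialg \<Rightarrow> bool" where
  "unital_algebra H \<longleftrightarrow>
     vector_space (scl H) \<and>
     (\<forall>c x y. scl H c (x * y) = scl H c x * y \<and> scl H c (x * y) = x * scl H c y)"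

text \<open>For a bilinear form \<open>\<beta>\<close>, \<open>comult H h \<beta>\<close> is the Sweedler sum \<open>\<beta> h\<^sub>(\<^sub>1\<^sub>) h\<^sub>(\<^sub>2\<^sub>)\<close>.  Coassociativity is an
  equation in the triple tensor power of \<open>H\<close>, realised as above by evaluation at trilinear forms.\<close>

definition coalgebra :: "('k::field, 'h::ring_1) bialg \<Rightarrow> bool" where
  "coalgebra H \<longleftrightarrow>
     (\<forall>h. comult H h \<in> carrier (tensor_space (alg_space H) (alg_space H))) \<and>
     (\<forall>g h \<beta>. comult H (g + h) \<beta> = comult H g \<beta> + comult H h \<beta>) \<and>
     (\<forall>c h \<beta>. comult H (scl H c h) \<beta> = c * comult H h \<beta>) \<and>
     counit H \<in> linear_forms (alg_space H) \<and>
     (\<forall>h. \<forall>t\<in>H3_forms H.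
        comult H h (\<lambda>x z. comult H x (\<lambda>a b. t a b z)) =
        comult H h (\<lambda>x y. comult H y (\<lambda>b c. t x b c))) \<and>
     (\<forall>h n x y. comult H h = tensor_sum (H2_forms H) n x y \<longrightarrow>
        (\<Sum>i<n. scl H (counit H (x i)) (y i)) = h \<and>
        (\<Sum>i<n. scl H (counit H (y i)) (x i)) = h)"

definition bialgebra :: "('k::field, 'h::ring_1) bialg \<Rightarrow> bool" where
  "bialgebra H \<longleftrightarrow>
     unital_algebra H \<and> coalgebra H \<and>
     comult H 1 = pure_tensor (H2_forms H) 1 1 \<and>
     (\<forall>x y. comult H (x * y) = tensor_mult H (comult H x) (comult H y)) \<and>
     counit H 1 = 1 \<and>
     (\<forall>x y. counit H (x * y) = counit H x * counit H y)"


section \<open>Modules over the bialgebra\<close>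

text \<open>The library's locale \<^locale>\<open>module\<close> requires commutative scalars.\<close>

locale left_module = abelian_group V for V :: "('h::ring_1, 'v) module" (structure) +
  assumes act_closed: "x \<in> carrier V \<Longrightarrow> a \<odot> x \<in> carrier V"
    and act_l_distr: "x \<in> carrier V \<Longrightarrow> (a + b) \<odot> x = a \<odot> x \<oplus> b \<odot> x"
    and act_r_distr: "\<lbrakk>x \<in> carrier V; y \<in> carrier V\<rbrakk> \<Longrightarrow> a \<odot> (x \<oplus> y) = a \<odot> x \<oplus> a \<odot> y"
    and act_assoc: "x \<in> carrier V \<Longrightarrow> (a * b) \<odot> x = a \<odot> (b \<odot> x)"
    and act_one: "x \<in> carrier V \<Longrightarrow> 1 \<odot> x = x"

text \<open>The underlying vector space of a module: \<open>'k\<close> acts through \<open>c \<mapsto> c 1\<close>.\<close>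

definition vec :: "('k::field, 'h::ring_1) bialg \<Rightarrow> ('h, 'v) module \<Rightarrow> ('k, 'v) module" where
  "vec H V =
     \<lparr>carrier = carrier V, monoid.mult = monoid.mult V, one = one V, ring.zero = ring.zero V, add = add V,
      smult = (\<lambda>c x. scl H c 1 \<odot>\<^bsub>V\<^esub> x)\<rparr>"

definition fin_dim :: "('k::field, 'h::ring_1) bialg \<Rightarrow> ('h, 'v) module \<Rightarrow> bool" where
  "fin_dim H V \<longleftrightarrow>
     (\<exists>(n::nat) b. (\<forall>i<n. b i \<in> carrier V) \<and>
        (\<forall>x\<in>carrier V. \<exists>c. x = (\<Oplus>\<^bsub>V\<^esub>i\<in>{..<n}. c i \<odot>\<^bsub>vec H V\<^esub> b i)))"

definition mod_homs :: "('h, 'v) module \<Rightarrow> ('h, 'w) module \<Rightarrow> ('v \<Rightarrow> 'w) set" where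
  "mod_homs V W = {g \<in> carrier V \<rightarrow> carrier W.
     (\<forall>x\<in>carrier V. \<forall>y\<in>carrier V. g (x \<oplus>\<^bsub>V\<^esub> y) = g x \<oplus>\<^bsub>W\<^esub> g y) \<and>
     (\<forall>h. \<forall>x\<in>carrier V. g (h \<odot>\<^bsub>V\<^esub> x) = h \<odot>\<^bsub>W\<^esub> g x)}"

definition mod_isos :: "('h, 'v) module \<Rightarrow> ('h, 'w) module \<Rightarrow> ('v \<Rightarrow> 'w) set" where
  "mod_isos V W = {g \<in> mod_homs V W. bij_betw g (carrier V) (carrier W)}"

definition mod_isomorphic :: "('h, 'v) module \<Rightarrow> ('h, 'w) module \<Rightarrow> bool" where
  "mod_isomorphic V W \<longleftrightarrow> mod_isos V W \<noteq> {}"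

definition mod_ker :: "('h, 'v) module \<Rightarrow> ('h, 'w) module \<Rightarrow> ('v \<Rightarrow> 'w) \<Rightarrow> 'v set" where
  "mod_ker V W g = {x \<in> carrier V. g x = \<zero>\<^bsub>W\<^esub>}"

definition is_submodule :: "'v set \<Rightarrow> ('h, 'v) module \<Rightarrow> bool" where
  "is_submodule N V \<longleftrightarrow> subgroup N (add_monoid V) \<and> (\<forall>h. \<forall>x\<in>N. h \<odot>\<^bsub>V\<^esub> x \<in> N)"

definition direct_sum :: "('h, 'v) module \<Rightarrow> ('h, 'w) module \<Rightarrow> ('h, 'v \<times> 'w) module" where
  "direct_sum V W =
     \<lparr>carrier = carrier V \<times> carrier W, monoid.mult = undefined, one = undefined,
      ring.zero = (\<zero>\<^bsub>V\<^esub>, \<zero>\<^bsub>W\<^esub>),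
      add = (\<lambda>(x, y) (x', y'). (x \<oplus>\<^bsub>V\<^esub> x', y \<oplus>\<^bsub>W\<^esub> y')),
      smult = (\<lambda>h (x, y). (h \<odot>\<^bsub>V\<^esub> x, h \<odot>\<^bsub>W\<^esub> y))\<rparr>"

definition short_exact ::
  "('h, 'v) module \<Rightarrow> ('h, 'v) module \<Rightarrow> ('h, 'v) module \<Rightarrow> bool" where
  "short_exact V' V V'' \<longleftrightarrow>
     (\<exists>i\<in>mod_homs V' V. \<exists>p\<in>mod_homs V V''.
        inj_on i (carrier V') \<and> i ` carrier V' = mod_ker V V'' p \<and> p ` carrier V = carrier V'')"

definition trivial_module :: "('k::field, 'h::ring_1) bialg \<Rightarrow> ('h, 'k) module" where
  "trivial_module H =
     \<lparr>carrier = UNIV, monoid.mult = (*), one = 1, ring.zero = 0, add = (+), smult = (\<lambda>h c. counit H h * c)\<rparr>"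

text \<open>\<open>h \<triangleright> (v \<otimes> w) = (h\<^sub>(\<^sub>1\<^sub>) \<triangleright> v) \<otimes> (h\<^sub>(\<^sub>2\<^sub>) \<triangleright> w)\<close>\<close>

definition tensor_module ::
  "('k::field, 'h::ring_1) bialg \<Rightarrow> ('h, 'v) module \<Rightarrow> ('h, 'w) module \<Rightarrow>
   ('h, ('v, 'w, 'k) tensor) module" where
  "tensor_module H V W = (let T = tensor_space (vec H V) (vec H W) in
     \<lparr>carrier = carrier T, monoid.mult = undefined, one = undefined, ring.zero = ring.zero T, add = add T,
      smult = (\<lambda>h \<tau> \<beta>. if \<beta> \<in> bilinear_forms (vec H V) (vec H W)
         then comult H h (\<lambda>x y. \<tau> (\<lambda>v w. \<beta> (x \<odot>\<^bsub>V\<^esub> v) (y \<odot>\<^bsub>W\<^esub> w))) else 0)\<rparr>)"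


section \<open>Subcategories of modules\<close>

text \<open>
  A full subcategory is given by its set \<open>C\<close> of objects, whose carriers are subsets of the universe
  \<^typ>\<open>'v\<close>.  Constructions leading to another type have to be replaced by isomorphic copies, so
  closure properties are always meant up to isomorphism; \<open>C\<close> need not be closed under isomorphism.
\<close>

definition ess_mem :: "('h, 'w) module \<Rightarrow> ('h, 'v) module set \<Rightarrow> bool" where
  "ess_mem M C \<longleftrightarrow> (\<exists>V\<in>C. mod_isomorphic M V)"

text \<open>In the last clause \<open>p\<close> is a cokernel of \<open>g\<close>.\<close>

definition full_abelian_subcategory :: "('h::ring_1, 'v) module set \<Rightarrow> bool" where
  "full_abelian_subcategory C \<longleftrightarrow>
     (\<forall>V\<in>C. left_module V) \<and>
     (\<exists>Z\<in>C. carrier Z = {\<zero>\<^bsub>Z\<^esub>}) \<and>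
     (\<forall>V\<in>C. \<forall>W\<in>C. ess_mem (direct_sum V W) C) \<and>
     (\<forall>V\<in>C. \<forall>W\<in>C. \<forall>g\<in>mod_homs V W.
        ess_mem (V\<lparr>carrier := mod_ker V W g\<rparr>) C \<and>
        (\<exists>Q\<in>C. \<exists>p\<in>mod_homs W Q. p ` carrier W = carrier Q \<and> mod_ker W Q p = g ` carrier V))"

definition closed_under_submodules :: "('h, 'v) module set \<Rightarrow> bool" where
  "closed_under_submodules C \<longleftrightarrow>
     (\<forall>V\<in>C. \<forall>N. is_submodule N V \<longrightarrow> ess_mem (V\<lparr>carrier := N\<rparr>) C)"

definition tensor_subcategory ::
  "('k::field, 'h::ring_1) bialg \<Rightarrow> ('h, 'v) module set \<Rightarrow> bool" where
  "tensor_subcategory H C \<longleftrightarrow>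
     ess_mem (trivial_module H) C \<and> (\<forall>V\<in>C. \<forall>W\<in>C. ess_mem (tensor_module H V W) C)"


section \<open>Duality\<close>

abbreviation full_dual :: "('k::field, 'h::ring_1) bialg \<Rightarrow> ('h, 'v) module \<Rightarrow> ('v \<Rightarrow> 'k) set" where
  "full_dual H V \<equiv> linear_forms (vec H V)"

text \<open>The transpose of a map \<open>g\<close> from \<open>V\<close> to some module.\<close>

definition transp :: "('h, 'v) module \<Rightarrow> ('v \<Rightarrow> 'w) \<Rightarrow> ('w \<Rightarrow> 'k::field) \<Rightarrow> ('v \<Rightarrow> 'k)" where
  "transp V g f = (\<lambda>x. if x \<in> carrier V then f (g x) else 0)"

text \<open>A subspace \<open>S\<close> of the dual as a vector space and as a right module, with
  \<open>(f \<triangleleft> h) x = f (h \<triangleright> x)\<close>.\<close>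

definition dual_vec :: "('v \<Rightarrow> 'k::field) set \<Rightarrow> ('k, 'v \<Rightarrow> 'k) module" where
  "dual_vec S =
     \<lparr>carrier = S, monoid.mult = undefined, one = undefined, ring.zero = (\<lambda>x. 0),
      add = (\<lambda>f g x. f x + g x), smult = (\<lambda>c f x. c * f x)\<rparr>"

definition dual_module ::
  "('h, 'v) module \<Rightarrow> ('v \<Rightarrow> 'k::field) set \<Rightarrow> ('h, 'v \<Rightarrow> 'k) module" where
  "dual_module V S =
     \<lparr>carrier = S, monoid.mult = undefined, one = undefined, ring.zero = (\<lambda>x. 0),
      add = (\<lambda>f g x. f x + g x), smult = (\<lambda>h f. transp V (\<lambda>x. h \<odot>\<^bsub>V\<^esub> x) f)\<rparr>"

text \<open>As the functor acts on morphisms by transposition, it is determined by the subspaces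
  \<open>star V\<close> of the dual spaces, and it is automatically additive.\<close>

definition finite_duality ::
  "('k::field, 'h::ring_1) bialg \<Rightarrow> ('h, 'v) module set \<Rightarrow> (('h, 'v) module \<Rightarrow> ('v \<Rightarrow> 'k) set) \<Rightarrow> bool"
  where
  "finite_duality H C star \<longleftrightarrow>
     (\<forall>V\<in>C. is_submodule (star V) (dual_module V (full_dual H V))) \<and>
     (\<forall>V\<in>C. \<forall>W\<in>C. \<forall>g\<in>mod_homs V W. transp V g \<in> star W \<rightarrow> star V) \<and>
     (\<forall>V\<in>C. star V = full_dual H V \<longleftrightarrow> fin_dim H V) \<and>
     (\<forall>V\<in>C. (\<forall>x\<in>carrier V. (\<forall>f\<in>star V. f x = 0) \<longrightarrow> x = \<zero>\<^bsub>V\<^esub>) \<and>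
             (\<forall>f\<in>star V. (\<forall>x\<in>carrier V. f x = 0) \<longrightarrow> f = (\<lambda>x. 0)))"

text \<open>
  The right module \<open>S' \<otimes> S\<close> for \<open>S \<subseteq> V\<^sup>*\<close>, \<open>S' \<subseteq> V'\<^sup>*\<close>.  The action is the one for which
  \<open>f' \<otimes> f\<close> acts as the functional \<open>v \<otimes> v' \<mapsto> f v * f' v'\<close> on the left module \<open>V \<otimes> V'\<close>, namely
  \<open>(f' \<otimes> f) \<triangleleft> h = (f' \<triangleleft> h\<^sub>(\<^sub>2\<^sub>)) \<otimes> (f \<triangleleft> h\<^sub>(\<^sub>1\<^sub>))\<close>.
\<close>

definition dual_tensor ::
  "('k::field, 'h::ring_1) bialg \<Rightarrow> ('h, 'v) module \<Rightarrow> ('v \<Rightarrow> 'k) set \<Rightarrow>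
   ('h, 'w) module \<Rightarrow> ('w \<Rightarrow> 'k) set \<Rightarrow> ('h, ('w \<Rightarrow> 'k, 'v \<Rightarrow> 'k, 'k) tensor) module" where
  "dual_tensor H V S V' S' = (let T = tensor_space (dual_vec S') (dual_vec S) in
     \<lparr>carrier = carrier T, monoid.mult = undefined, one = undefined, ring.zero = ring.zero T, add = add T,
      smult = (\<lambda>h \<tau> \<beta>. if \<beta> \<in> bilinear_forms (dual_vec S') (dual_vec S)
         then comult H h (\<lambda>x y. \<tau> (\<lambda>f' f. \<beta> (y \<odot>\<^bsub>dual_module V' S'\<^esub> f') (x \<odot>\<^bsub>dual_module V S\<^esub> f)))
         else 0)\<rparr>)"

text \<open>The canonical map sending \<open>f' \<otimes> f\<close> to the functional \<open>v \<otimes> v' \<mapsto> f v * f' v'\<close>, where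
  \<open>V \<otimes> V'\<close> is identified with an object \<open>T\<close> by an isomorphism \<open>\<phi>\<close>.\<close>

definition dual_tensor_map ::
  "('k::field, 'h::ring_1) bialg \<Rightarrow> ('h, 'v) module \<Rightarrow> ('h, 'w) module \<Rightarrow> ('h, 't) module \<Rightarrow>
   (('v, 'w, 'k) tensor \<Rightarrow> 't) \<Rightarrow> ('w \<Rightarrow> 'k, 'v \<Rightarrow> 'k, 'k) tensor \<Rightarrow> ('t \<Rightarrow> 'k)" where
  "dual_tensor_map H V V' T \<phi> \<tau> = (\<lambda>t. if t \<in> carrier T
     then inv_into (carrier (tensor_module H V V')) \<phi> t (\<lambda>v v'. \<tau> (\<lambda>f' f. f v * f' v')) else 0)"

definition star_tensor_compatible ::
  "('k::field, 'h::ring_1) bialg \<Rightarrow> ('h, 'v) module set \<Rightarrow> (('h, 'v) module \<Rightarrow> ('v \<Rightarrow> 'k) set) \<Rightarrow> bool"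
  where
  "star_tensor_compatible H C star \<longleftrightarrow>
     (\<forall>V\<in>C. \<forall>V'\<in>C. \<forall>T\<in>C. \<forall>\<phi>\<in>mod_isos (tensor_module H V V') T.
        dual_tensor_map H V V' T \<phi> \<in>
          mod_isos (dual_tensor H V (star V) V' (star V')) (dual_module T (star T)))"


section \<open>Matrix coefficients and characters\<close>

text \<open>The algebra \<open>H\<^sup>*\<close>, with \<open>(\<phi> \<cdot> \<xi>)(h) = \<phi> h\<^sub>(\<^sub>1\<^sub>) * \<xi> h\<^sub>(\<^sub>2\<^sub>)\<close>.\<close>

definition dual_algebra :: "('k::field, 'h::ring_1) bialg \<Rightarrow> ('h \<Rightarrow> 'k) ring" where
  "dual_algebra H =
     \<lparr>carrier = linear_forms (alg_space H),
      monoid.mult = (\<lambda>\<phi> \<xi> h. comult H h (\<lambda>x y. \<phi> x * \<xi> y)), one = counit H,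
      ring.zero = (\<lambda>h. 0), add = (\<lambda>\<phi> \<xi> h. \<phi> h + \<xi> h)\<rparr>"

text \<open>
  \<open>V \<otimes>\<^bsub>D(V)\<^esub> S\<close> for \<open>S \<subseteq> V\<^sup>*\<close>, where \<open>D(V)\<close> is the opposite of \<open>End\<^sub>H V\<close> and acts on \<open>S\<close> by
  transposition.
\<close>

definition balanced_forms ::
  "('k::field, 'h::ring_1) bialg \<Rightarrow> ('h, 'v) module \<Rightarrow> ('v \<Rightarrow> 'k) set \<Rightarrow> ('v \<Rightarrow> ('v \<Rightarrow> 'k) \<Rightarrow> 'k) set" where
  "balanced_forms H V S = {\<beta> \<in> bilinear_forms (vec H V) (dual_vec S).
     \<forall>d\<in>mod_homs V V. \<forall>x\<in>carrier V. \<forall>f\<in>S. \<beta> (d x) f = \<beta> x (transp V d f)}"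

definition balanced_tensor ::
  "('k::field, 'h::ring_1) bialg \<Rightarrow> ('h, 'v) module \<Rightarrow> ('v \<Rightarrow> 'k) set \<Rightarrow> ('v, 'v \<Rightarrow> 'k, 'k) tensor set"
  where
  "balanced_tensor H V S = tensor_span (balanced_forms H V S) (carrier V) S"

definition beta ::
  "('h, 'v) module \<Rightarrow> ('v, 'v \<Rightarrow> 'k::field, 'k) tensor \<Rightarrow> ('h \<Rightarrow> 'k)" where
  "beta V \<tau> = (\<lambda>h. \<tau> (\<lambda>x f. f (h \<odot>\<^bsub>V\<^esub> x)))"

definition coeffs ::
  "('k::field, 'h::ring_1) bialg \<Rightarrow> (('h, 'v) module \<Rightarrow> ('v \<Rightarrow> 'k) set) \<Rightarrow> ('h, 'v) module \<Rightarrow> ('h \<Rightarrow> 'k) set"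
  where
  "coeffs H star V = beta V ` balanced_tensor H V (star V)"

definition all_coeffs ::
  "('k::field, 'h::ring_1) bialg \<Rightarrow> ('h, 'v) module set \<Rightarrow> (('h, 'v) module \<Rightarrow> ('v \<Rightarrow> 'k) set) \<Rightarrow>
   ('h \<Rightarrow> 'k) set" where
  "all_coeffs H C star =
     {(\<lambda>h. \<Sum>i<n. \<xi> i h) | (n::nat) \<xi>. \<forall>i<n. \<exists>V\<in>C. \<xi> i \<in> coeffs H star V}"

text \<open>The span of all products; the factors may absorb scalars when they range over subspaces.\<close>

definition products_span ::
  "('k::field, 'h::ring_1) bialg \<Rightarrow> ('h \<Rightarrow> 'k) set \<Rightarrow> ('h \<Rightarrow> 'k) set \<Rightarrow> ('h \<Rightarrow> 'k) set" where
  "products_span H A B =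
     {(\<lambda>h. \<Sum>i<n. c i * (\<phi> i \<otimes>\<^bsub>dual_algebra H\<^esub> \<xi> i) h) | (n::nat) c \<phi> \<xi>. \<forall>i<n. \<phi> i \<in> A \<and> \<xi> i \<in> B}"

text \<open>The canonical element \<open>\<Sum> b\<^sub>i \<otimes> b\<^sub>i\<^sup>*\<close> of \<open>V \<otimes> V\<^sup>*\<close>, i.e. the one corresponding to the identity
  under \<open>x \<otimes> f \<mapsto> (y \<mapsto> f y x)\<close>, taken in the quotient \<open>V \<otimes>\<^bsub>D(V)\<^esub> V\<^sup>*\<close> on which \<open>beta\<close> is defined.\<close>

definition canonical_elt ::
  "('k::field, 'h::ring_1) bialg \<Rightarrow> ('h, 'v) module \<Rightarrow> ('v, 'v \<Rightarrow> 'k, 'k) tensor" where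
  "canonical_elt H V = (THE \<tau>. \<exists>n x f.
     (\<forall>i<n. x i \<in> carrier V \<and> f i \<in> full_dual H V) \<and>
     (\<forall>y\<in>carrier V. (\<Oplus>\<^bsub>V\<^esub>i\<in>{..<n}. f i y \<odot>\<^bsub>vec H V\<^esub> x i) = y) \<and>
     \<tau> = tensor_sum (balanced_forms H V (full_dual H V)) n x f)"

definition char_elt ::
  "('k::field, 'h::ring_1) bialg \<Rightarrow> ('h, 'v) module \<Rightarrow> ('h \<Rightarrow> 'k)" where
  "char_elt H V = beta V (canonical_elt H V)"

definition char_lattice ::
  "('k::field, 'h::ring_1) bialg \<Rightarrow> ('h, 'v) module set \<Rightarrow> ('h \<Rightarrow> 'k) set" where
  "char_lattice H C =
     {(\<lambda>h. \<Sum>i<n. of_int (m i) * char_elt H (V i) h) | (n::nat) (m :: nat \<Rightarrow> int) V. \<forall>i<n. V i \<in> C}"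

text \<open>With \<open>(h \<triangleright> \<xi> \<triangleleft> h')(x) = \<xi> (h' x h)\<close>.\<close>

definition invariant_part :: "('h::ring_1 \<Rightarrow> 'k) set \<Rightarrow> ('h \<Rightarrow> 'k) set" where
  "invariant_part B = {\<xi> \<in> B. \<forall>h. (\<lambda>x. \<xi> (x * h)) = (\<lambda>x. \<xi> (h * x))}"


section \<open>The Grothendieck ring\<close>

text \<open>
  The free abelian group on the objects, with the product induced by the tensor product.  The latter
  involves a choice of representatives, so this structure becomes a ring only modulo the relations
  \<open>[V] = [V'] + [V'']\<close> for short exact sequences \<open>0 \<rightarrow> V' \<rightarrow> V \<rightarrow> V'' \<rightarrow> 0\<close> in \<open>C\<close>.
\<close>

definition tensor_obj ::
  "('k::field, 'h::ring_1) bialg \<Rightarrow> ('h, 'v) module set \<Rightarrow>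
   ('h, 'v) module \<Rightarrow> ('h, 'v) module \<Rightarrow> ('h, 'v) module" where
  "tensor_obj H C V W = (SOME T. T \<in> C \<and> mod_isomorphic (tensor_module H V W) T)"

definition unit_obj ::
  "('k::field, 'h::ring_1) bialg \<Rightarrow> ('h, 'v) module set \<Rightarrow> ('h, 'v) module" where
  "unit_obj H C = (SOME U. U \<in> C \<and> mod_isomorphic (trivial_module H) U)"

definition free_K0 ::
  "('k::field, 'h::ring_1) bialg \<Rightarrow> ('h, 'v) module set \<Rightarrow> (('h, 'v) module \<Rightarrow>\<^sub>0 int) ring" where
  "free_K0 H C =
     \<lparr>carrier = carrier (free_Abelian_group C),
      monoid.mult = (\<lambda>a b. \<Sum>V\<in>Poly_Mapping.keys a. \<Sum>W\<in>Poly_Mapping.keys b.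
        frag_cmul (Poly_Mapping.lookup a V * Poly_Mapping.lookup b W) (frag_of (tensor_obj H C V W))),
      one = frag_of (unit_obj H C), ring.zero = 0, add = (+)\<rparr>"

definition K0_relations :: "('h, 'v) module set \<Rightarrow> (('h, 'v) module \<Rightarrow>\<^sub>0 int) set" where
  "K0_relations C = generate (free_Abelian_group C)
     {frag_of V - (frag_of V' + frag_of V'') | V' V V''.
        V' \<in> C \<and> V \<in> C \<and> V'' \<in> C \<and> short_exact V' V V''}"

definition K0 ::
  "('k::field, 'h::ring_1) bialg \<Rightarrow> ('h, 'v) module set \<Rightarrow> (('h, 'v) module \<Rightarrow>\<^sub>0 int) set ring" where
  "K0 H C = free_K0 H C Quot K0_relations C"

definition K0_class ::
  "('k::field, 'h::ring_1) bialg \<Rightarrow> ('h, 'v) module set \<Rightarrow> ('h, 'v) module \<Rightarrow>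
   (('h, 'v) module \<Rightarrow>\<^sub>0 int) set" where
  "K0_class H C V = K0_relations C +>\<^bsub>free_K0 H C\<^esub> frag_of V"

end

theory Submission
  imports Defs
begin

text \<open>
  All identities between vectors are tested against linear functionals, which separate the points of
  every object of the category, and bilinear forms on \<open>V \<times> W\<close> are the functionals of \<open>V \<otimes> W\<close>.  A
  matrix coefficient of \<open>V \<otimes> W\<close> at \<open>f \<otimes> g\<close> and \<open>v \<otimes> w\<close> is the product of the coefficients of \<open>V\<close>
  and \<open>W\<close>, which gives (a); summing over dual systems of \<open>V\<close> and \<open>W\<close> gives the multiplicativity of
  characters.  A linear splitting of a short exact sequence shows that characters are additive and
  that the tensor product is exact, so that the Grothendieck ring and the map to the characters are
  well defined; associativity of the Grothendieck ring reflects coassociativity.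

  For injectivity in characteristic zero, every class is an integral combination of simple
  classes.  Some element of the bialgebra acts as the identity on one of finitely many pairwise
  non-isomorphic simple modules and as zero on the others, so a vanishing combination of their
  characters has coefficients annihilated by the dimensions, hence zero coefficients.
\<close>

section \<open>The convolution algebra\<close>

text \<open>\<open>tensor_module H V W\<close> lives in another type than the objects of
  \<open>C\<close>, so a tensor product is met only as an isomorphic copy \<open>T\<close> in
  \<open>C\<close>. Points of \<open>T\<close> are separated because the non-degenerate pairing
  places enough functionals in \<open>star T\<close>; no basis of an infinite dimensional space is
  chosen. \<open>comult H h\<close> vanishes off the bilinear forms, so it is additive only on them;
  this is why membership in \<open>H2\<close> is checked before each Sweedler computation.
  Bijectivity is tied to characteristic zero: in characteristic p, the class of the unit object
  times p has character p \<epsilon> = 0, although the Grothendieck group of finite dimensional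
  modules is free on the simple classes. In characteristic zero the trace of 1 recovers the
  dimension as a natural number, and this number drives the induction that breaks a class into
  simple ones. The field need not be algebraically closed, so a simple module may have a division
  algebra of endomorphisms and matrix units may be missing. An element acting as the identity is
  enough: its trace is the dimension, which is nonzero in the field.\<close>

lemma sum_append:
  fixes f g :: "nat \<Rightarrow> 'a::comm_monoid_add"
  shows "(\<Sum>i<n + m. if i < n then f i else g (i - n)) = (\<Sum>i<n. f i) + (\<Sum>i<m. g i)"
    (is "sum ?h _ = _")
proof -
  have "sum ?h {..<n + m} = sum ?h {..<n} + sum ?h {n..<n + m}"
    by (subst sum.union_disjoint[symmetric]) (auto intro!: sum.cong)
  moreover have "sum ?h {n..<n + m} = (\<Sum>i<m. g i)"
    by (rule sum.reindex_bij_witness[of _ "\<lambda>i. i + n" "\<lambda>i. i - n"]) auto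
  ultimately show ?thesis by simp
qed

lemma linear_forms_sum:
  assumes "\<And>i. i \<in> I \<Longrightarrow> f i \<in> linear_forms A"
  shows "(\<lambda>x. \<Sum>i\<in>I. f i x) \<in> linear_forms A"
  using assms by (auto simp: linear_forms_def sum.distrib sum_distrib_left)

lemma linear_forms_cmul: "f \<in> linear_forms A \<Longrightarrow> (\<lambda>x. c * f x) \<in> linear_forms A"
  by (auto simp: linear_forms_def algebra_simps)

lemma linear_forms_add:
  "f \<in> linear_forms A \<Longrightarrow> g \<in> linear_forms A \<Longrightarrow> (\<lambda>x. f x + g x) \<in> linear_forms A"
  by (auto simp: linear_forms_def algebra_simps)

lemma linear_forms_zero: "(\<lambda>x. 0) \<in> linear_forms A"
  by (auto simp: linear_forms_def)

lemma bilinear_forms_sum: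
  assumes "\<And>i. i \<in> I \<Longrightarrow> \<beta> i \<in> bilinear_forms A B"
  shows "(\<lambda>x y. \<Sum>i\<in>I. \<beta> i x y) \<in> bilinear_forms A B"
  using assms by (auto simp: bilinear_forms_def sum.distrib sum_distrib_left)

lemma bilinear_forms_cmul: "\<beta> \<in> bilinear_forms A B \<Longrightarrow> (\<lambda>x y. c * \<beta> x y) \<in> bilinear_forms A B"
  by (auto simp: bilinear_forms_def algebra_simps)

lemma bilinear_forms_prod:
  "f \<in> linear_forms A \<Longrightarrow> g \<in> linear_forms B \<Longrightarrow> (\<lambda>x y. f x * g y) \<in> bilinear_forms A B"
  by (auto simp: bilinear_forms_def linear_forms_def algebra_simps)

lemma bilinear_forms_flip:
  "\<beta> \<in> bilinear_forms A B \<Longrightarrow> (\<lambda>y x. \<beta> x y) \<in> bilinear_forms B A"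
  by (auto simp: bilinear_forms_def)

section \<open>Sweedler calculus in a bialgebra\<close>

locale bialgebra_over =
  fixes H :: "('k::field, 'h::ring_1) bialg"
  assumes bialgebra: "bialgebra H"
begin

abbreviation "\<epsilon> \<equiv> counit H"
abbreviation "Hdual \<equiv> linear_forms (alg_space H)"
abbreviation "H2 \<equiv> H2_forms H"

abbreviation convolution (infixl "\<star>" 70) where
  "\<phi> \<star> \<xi> \<equiv> \<phi> \<otimes>\<^bsub>dual_algebra H\<^esub> \<xi>"

lemma scl_mult_left: "scl H c x * y = scl H c (x * y)"
  and scl_mult_right: "x * scl H c y = scl H c (x * y)"
  using bialgebra unfolding bialgebra_def unital_algebra_def by metis+

lemma scl_1_mult: "scl H c 1 * x = scl H c x"
  and mult_scl_1: "x * scl H c 1 = scl H c x"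
  by (simp_all add: scl_mult_left scl_mult_right)

lemma Hdual_iff:
  "\<phi> \<in> Hdual \<longleftrightarrow> (\<forall>x y. \<phi> (x + y) = \<phi> x + \<phi> y) \<and> (\<forall>c x. \<phi> (scl H c x) = c * \<phi> x)"
  by (simp add: linear_forms_def alg_space_def)

lemma H2_iff:
  "\<beta> \<in> H2 \<longleftrightarrow> (\<forall>y. (\<lambda>x. \<beta> x y) \<in> Hdual) \<and> (\<forall>x. \<beta> x \<in> Hdual)"
  by (auto simp: bilinear_forms_def linear_forms_def alg_space_def)

lemma H3_iff:
  "t \<in> H3_forms H \<longleftrightarrow>
    (\<forall>y z. (\<lambda>x. t x y z) \<in> Hdual) \<and> (\<forall>x z. (\<lambda>y. t x y z) \<in> Hdual) \<and> (\<forall>x y. t x y \<in> Hdual)"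
  by (auto simp: H3_forms_def H2_iff)

lemma comult_add_left: "comult H (g + h) \<beta> = comult H g \<beta> + comult H h \<beta>"
  and comult_scl: "comult H (scl H c h) \<beta> = c * comult H h \<beta>"
  and counit_form: "\<epsilon> \<in> Hdual"
  using bialgebra by (simp_all add: bialgebra_def coalgebra_def)

lemma comult_Hdual: "(\<lambda>h. comult H h \<beta>) \<in> Hdual"
  by (simp add: Hdual_iff comult_add_left comult_scl)

lemma comult_eq_tensor_sum:
  obtains n and a b :: "nat \<Rightarrow> 'h" where "comult H h = tensor_sum H2 n a b"
proof -
  have "comult H h \<in> carrier (tensor_space (alg_space H) (alg_space H))"
    using bialgebra by (simp add: bialgebra_def coalgebra_def)
  then show ?thesis using that by (auto simp: tensor_space_def tensor_span_def)
qed

text \<open>One representation of \<Delta>(h) as a sum of a_k \<otimes> b_k serves all bilinear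
  forms at once. Additivity of \<open>comult H h\<close> in the form is obtained through it.\<close>

lemma comult_expand:
  obtains n and a b :: "nat \<Rightarrow> 'h"
  where "\<And>\<beta>. \<beta> \<in> H2 \<Longrightarrow> comult H h \<beta> = (\<Sum>k<n. \<beta> (a k) (b k))"
proof -
  obtain n a b where "comult H h = tensor_sum H2 n a b" by (rule comult_eq_tensor_sum)
  then show ?thesis by (intro that) (simp add: tensor_sum_def pure_tensor_def)
qed

lemma comult_sum:
  assumes "\<And>i. i \<in> I \<Longrightarrow> \<beta> i \<in> H2"
  shows "comult H h (\<lambda>x y. \<Sum>i\<in>I. \<beta> i x y) = (\<Sum>i\<in>I. comult H h (\<beta> i))"
proof -
  obtain n and a b :: "nat \<Rightarrow> 'h" where ab: "\<And>\<beta>. \<beta> \<in> H2 \<Longrightarrow> comult H h \<beta> = (\<Sum>k<n. \<beta> (a k) (b k))"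
    by (rule comult_expand[of h]) blast
  have "comult H h (\<lambda>x y. \<Sum>i\<in>I. \<beta> i x y) = (\<Sum>k<n. \<Sum>i\<in>I. \<beta> i (a k) (b k))"
    by (rule ab) (rule bilinear_forms_sum, rule assms)
  also have "\<dots> = (\<Sum>i\<in>I. comult H h (\<beta> i))"
    by (subst sum.swap) (simp add: ab assms)
  finally show ?thesis .
qed

lemma comult_add:
  assumes "\<beta> \<in> H2" "\<gamma> \<in> H2"
  shows "comult H h (\<lambda>x y. \<beta> x y + \<gamma> x y) = comult H h \<beta> + comult H h \<gamma>"
  using comult_sum[of "UNIV :: bool set" "\<lambda>i. if i then \<beta> else \<gamma>" h] assms
  by (simp add: UNIV_bool add.commute)

lemma comult_cmul:
  assumes "\<beta> \<in> H2"
  shows "comult H h (\<lambda>x y. c * \<beta> x y) = c * comult H h \<beta>"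
proof -
  obtain n and a b :: "nat \<Rightarrow> 'h" where ab: "\<And>\<beta>. \<beta> \<in> H2 \<Longrightarrow> comult H h \<beta> = (\<Sum>k<n. \<beta> (a k) (b k))"
    by (rule comult_expand[of h]) blast
  show ?thesis using assms by (simp add: ab bilinear_forms_cmul sum_distrib_left)
qed

lemma comult_1: "\<beta> \<in> H2 \<Longrightarrow> comult H 1 \<beta> = \<beta> 1 1"
  using bialgebra by (simp add: bialgebra_def pure_tensor_def)

lemma comult_mult:
  "\<beta> \<in> H2 \<Longrightarrow> comult H (x * y) \<beta> = comult H x (\<lambda>a a'. comult H y (\<lambda>b b'. \<beta> (a * b) (a' * b')))"
  using bialgebra by (simp add: bialgebra_def tensor_mult_def)

text \<open>Fubini for two Sweedler sums: one of them is expanded into a finite sum, and the other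
  is additive on bilinear forms.\<close>

lemma comult_swap:
  assumes "\<And>a a'. \<gamma> a a' \<in> H2" and "\<And>b b'. (\<lambda>a a'. \<gamma> a a' b b') \<in> H2"
  shows "comult H x (\<lambda>a a'. comult H y (\<gamma> a a')) = comult H y (\<lambda>b b'. comult H x (\<lambda>a a'. \<gamma> a a' b b'))"
proof -
  obtain n and a b :: "nat \<Rightarrow> 'h" where ab: "\<And>\<beta>. \<beta> \<in> H2 \<Longrightarrow> comult H y \<beta> = (\<Sum>k<n. \<beta> (a k) (b k))"
    by (rule comult_expand[of y]) blast
  \<comment> \<open>The inner sum over x is a finite sum of bilinear forms in b and b', so the
    expansion of \<Delta>(y) may be applied to it.\<close>
  have *: "(\<lambda>b b'. comult H x (\<lambda>a a'. \<gamma> a a' b b')) \<in> H2"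
  proof -
    obtain m and c d :: "nat \<Rightarrow> 'h" where cd: "\<And>\<beta>. \<beta> \<in> H2 \<Longrightarrow> comult H x \<beta> = (\<Sum>k<m. \<beta> (c k) (d k))"
      by (rule comult_expand[of x]) blast
    show ?thesis by (simp add: cd assms bilinear_forms_sum)
  qed
  show ?thesis by (simp add: ab assms * comult_sum)
qed

lemma Hdual_sum: "\<phi> \<in> Hdual \<Longrightarrow> \<phi> (\<Sum>i\<in>I. x i) = (\<Sum>i\<in>I. \<phi> (x i))"
proof (induction I rule: infinite_finite_induct)
  case empty
  have "\<phi> (0 + 0) = \<phi> 0 + \<phi> 0" using empty by (simp only: Hdual_iff)
  then show ?case by (metis add.right_neutral add_left_cancel sum.empty)
next
  case (infinite I)
  have "\<phi> (0 + 0) = \<phi> 0 + \<phi> 0" using infinite by (simp only: Hdual_iff)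
  with infinite show ?case by (metis add.right_neutral add_left_cancel sum.infinite)
qed (simp add: Hdual_iff)

lemma H2_prod: "\<phi> \<in> Hdual \<Longrightarrow> \<xi> \<in> Hdual \<Longrightarrow> (\<lambda>x y. \<phi> x * \<xi> y) \<in> H2"
  by (rule bilinear_forms_prod)

text \<open>The counit axiom is an equation in H about representations of \<Delta>(h). Applying
  \<xi> to both sides removes the choice of representation.\<close>

lemma comult_counit_left: "\<xi> \<in> Hdual \<Longrightarrow> comult H h (\<lambda>x y. \<epsilon> x * \<xi> y) = \<xi> h"
  and comult_counit_right: "\<xi> \<in> Hdual \<Longrightarrow> comult H h (\<lambda>x y. \<xi> x * \<epsilon> y) = \<xi> h"
proof -
  obtain n a b where ab: "comult H h = tensor_sum H2 n a b" by (rule comult_eq_tensor_sum)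
  have 1: "(\<Sum>i<n. scl H (\<epsilon> (a i)) (b i)) = h" and 2: "(\<Sum>i<n. scl H (\<epsilon> (b i)) (a i)) = h"
    using bialgebra ab unfolding bialgebra_def coalgebra_def by blast+
  { assume xi: "\<xi> \<in> Hdual"
    have "\<xi> (\<Sum>i<n. scl H (\<epsilon> (a i)) (b i)) = (\<Sum>i<n. \<epsilon> (a i) * \<xi> (b i))"
      by (subst Hdual_sum[OF xi]) (use xi in \<open>simp add: Hdual_iff\<close>)
    then show "comult H h (\<lambda>x y. \<epsilon> x * \<xi> y) = \<xi> h"
      unfolding 1 using xi by (simp add: ab tensor_sum_def pure_tensor_def H2_prod counit_form)
    have "\<xi> (\<Sum>i<n. scl H (\<epsilon> (b i)) (a i)) = (\<Sum>i<n. \<xi> (a i) * \<epsilon> (b i))"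
      by (subst Hdual_sum[OF xi]) (use xi in \<open>simp add: Hdual_iff mult.commute\<close>)
    then show "comult H h (\<lambda>x y. \<xi> x * \<epsilon> y) = \<xi> h"
      unfolding 2 using xi by (simp add: ab tensor_sum_def pure_tensor_def H2_prod counit_form) }
qed

lemma comult_coassoc:
  "t \<in> H3_forms H \<Longrightarrow> comult H h (\<lambda>x z. comult H x (\<lambda>a b. t a b z)) =
     comult H h (\<lambda>x y. comult H y (\<lambda>b c. t x b c))"
  using bialgebra by (simp add: bialgebra_def coalgebra_def)

lemma counit_1: "\<epsilon> 1 = 1" and counit_mult: "\<epsilon> (x * y) = \<epsilon> x * \<epsilon> y"
  using bialgebra by (simp_all add: bialgebra_def)

lemma counit_scl: "\<epsilon> (scl H c x) = c * \<epsilon> x"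
  using counit_form by (simp add: Hdual_iff)

section \<open>The convolution ring of linear forms\<close>

lemma dual_algebra_simps [simp]:
  "carrier (dual_algebra H) = Hdual"
  "\<one>\<^bsub>dual_algebra H\<^esub> = \<epsilon>"
  "\<zero>\<^bsub>dual_algebra H\<^esub> = (\<lambda>h. 0)"
  "\<phi> \<oplus>\<^bsub>dual_algebra H\<^esub> \<xi> = (\<lambda>h. \<phi> h + \<xi> h)"
  by (simp_all add: dual_algebra_def)

lemma dual_algebra_mult: "\<phi> \<star> \<xi> = (\<lambda>h. comult H h (\<lambda>x y. \<phi> x * \<xi> y))"
  by (simp add: dual_algebra_def)

text \<open>Coassociativity evaluated at the trilinear form \<phi> \<otimes> \<xi> \<otimes> \<psi>,
  once the outer factor has been moved under the inner Sweedler sum.\<close>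

lemma dual_algebra_assoc:
  assumes "\<phi> \<in> Hdual" "\<xi> \<in> Hdual" "\<psi> \<in> Hdual"
  shows "(\<phi> \<star> \<xi>) \<star> \<psi> = \<phi> \<star> (\<xi> \<star> \<psi>)"
proof
  fix h
  have t: "(\<lambda>a b c. \<phi> a * \<xi> b * \<psi> c) \<in> H3_forms H"
    using assms by (auto simp: H3_iff Hdual_iff algebra_simps)
  have "comult H x (\<lambda>a b. \<phi> a * \<xi> b) * \<psi> z = comult H x (\<lambda>a b. \<phi> a * \<xi> b * \<psi> z)" for x z
    using comult_cmul[OF H2_prod[OF assms(1,2)], of x "\<psi> z"] by (simp add: mult.commute)
  moreover have "\<phi> x * comult H y (\<lambda>b c. \<xi> b * \<psi> c) = comult H y (\<lambda>b c. \<phi> x * \<xi> b * \<psi> c)" for x y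
    using comult_cmul[OF H2_prod[OF assms(2,3)], of y "\<phi> x"] by (simp add: mult.assoc)
  ultimately show "((\<phi> \<star> \<xi>) \<star> \<psi>) h =
      (\<phi> \<star> (\<xi> \<star> \<psi>)) h"
    using comult_coassoc[OF t, of h] by (simp only: dual_algebra_mult)
qed

lemma dual_algebra_mult_closed: "\<phi> \<star> \<xi> \<in> Hdual"
  by (simp add: dual_algebra_mult comult_Hdual)

lemma dual_algebra_l_distr:
  assumes "\<phi> \<in> Hdual" "\<xi> \<in> Hdual" "\<psi> \<in> Hdual"
  shows "(\<lambda>h. \<phi> h + \<xi> h) \<star> \<psi> =
    (\<lambda>h. (\<phi> \<star> \<psi>) h + (\<xi> \<star> \<psi>) h)"
  using assms by (simp add: dual_algebra_mult distrib_right comult_add H2_prod)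

lemma dual_algebra_r_distr:
  assumes "\<phi> \<in> Hdual" "\<xi> \<in> Hdual" "\<psi> \<in> Hdual"
  shows "\<psi> \<star> (\<lambda>h. \<phi> h + \<xi> h) =
    (\<lambda>h. (\<psi> \<star> \<phi>) h + (\<psi> \<star> \<xi>) h)"
  using assms by (simp add: dual_algebra_mult distrib_left comult_add H2_prod)

lemma dual_algebra_sum_sum:
  assumes "\<And>i. i \<in> I \<Longrightarrow> \<phi> i \<in> Hdual" "\<And>j. j \<in> J \<Longrightarrow> \<xi> j \<in> Hdual"
  shows "(\<lambda>h. \<Sum>i\<in>I. \<phi> i h) \<star> (\<lambda>h. \<Sum>j\<in>J. \<xi> j h) =
    (\<lambda>h. \<Sum>i\<in>I. \<Sum>j\<in>J. (\<phi> i \<star> \<xi> j) h)"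
  using assms by (simp add: dual_algebra_mult sum_product comult_sum H2_prod bilinear_forms_sum)

lemma dual_algebra_cmul:
  assumes "\<phi> \<in> Hdual" "\<xi> \<in> Hdual"
  shows "(\<lambda>h. c * \<phi> h) \<star> (\<lambda>h. d * \<xi> h) = (\<lambda>h. c * d * (\<phi> \<star> \<xi>) h)"
proof -
  have "(\<lambda>x y. c * \<phi> x * (d * \<xi> y)) = (\<lambda>x y. (c * d) * (\<phi> x * \<xi> y))" by (simp add: algebra_simps)
  then show ?thesis using comult_cmul[OF H2_prod[OF assms]] by (simp add: dual_algebra_mult)
qed

lemma Hdual_uminus: "\<phi> \<in> Hdual \<Longrightarrow> (\<lambda>h. - \<phi> h) \<in> Hdual"
  by (simp add: Hdual_iff)

lemma ring_dual_algebra: "ring (dual_algebra H)"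
proof (rule ringI)
  show "abelian_group (dual_algebra H)"
  proof (rule abelian_groupI)
    fix \<phi> assume "\<phi> \<in> carrier (dual_algebra H)"
    then show "\<exists>\<xi>\<in>carrier (dual_algebra H). \<xi> \<oplus>\<^bsub>dual_algebra H\<^esub> \<phi> = \<zero>\<^bsub>dual_algebra H\<^esub>"
      by (intro bexI[of _ "\<lambda>h. - \<phi> h"]) (auto simp: Hdual_uminus)
  qed (auto simp: linear_forms_add linear_forms_zero add.assoc add.commute)
  show "monoid (dual_algebra H)"
    by (rule monoidI)
      (auto simp: dual_algebra_mult_closed counit_form dual_algebra_assoc,
        simp_all add: dual_algebra_mult comult_counit_left comult_counit_right)
qed (auto simp: dual_algebra_l_distr dual_algebra_r_distr)

lemma dual_algebra_a_inv:
  assumes "\<phi> \<in> Hdual" shows "\<ominus>\<^bsub>dual_algebra H\<^esub> \<phi> = (\<lambda>h. - \<phi> h)"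
proof -
  interpret ring "dual_algebra H" by (rule ring_dual_algebra)
  show ?thesis by (rule minus_equality) (use assms Hdual_uminus in auto)
qed

lemma subring_dual_algebraI:
  assumes "S \<subseteq> Hdual" "\<epsilon> \<in> S"
    and "\<And>\<phi>. \<phi> \<in> S \<Longrightarrow> (\<lambda>h. - \<phi> h) \<in> S"
    and "\<And>\<phi> \<xi>. \<phi> \<in> S \<Longrightarrow> \<xi> \<in> S \<Longrightarrow> (\<lambda>h. \<phi> h + \<xi> h) \<in> S"
    and "\<And>\<phi> \<xi>. \<phi> \<in> S \<Longrightarrow> \<xi> \<in> S \<Longrightarrow> \<phi> \<star> \<xi> \<in> S"
  shows "subring S (dual_algebra H)"
  using assms by (intro ring.subringI[OF ring_dual_algebra]) (auto simp: dual_algebra_a_inv subset_iff)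

text \<open>Multiplicativity of \<Delta> turns the value at x h into a double Sweedler sum of
  \<phi>(a b) \<xi>(a' b'). Invariance swaps the arguments inside each factor, and the two sums may
  be exchanged.\<close>

lemma invariant_part_mult:
  assumes "\<phi> \<in> Hdual" "\<xi> \<in> Hdual"
    and "\<And>x h. \<phi> (x * h) = \<phi> (h * x)" "\<And>x h. \<xi> (x * h) = \<xi> (h * x)"
  shows "(\<phi> \<star> \<xi>) (x * h) = (\<phi> \<star> \<xi>) (h * x)"
proof -
  have H2: "(\<lambda>a b. \<phi> (c * a) * \<xi> (d * b)) \<in> H2" "(\<lambda>a b. \<phi> (a * c) * \<xi> (b * d)) \<in> H2" for c d
    using assms(1,2)
    by (auto simp: H2_iff Hdual_iff algebra_simps scl_mult_left scl_mult_right)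
  have "(\<phi> \<star> \<xi>) (x * h) =
      comult H x (\<lambda>a a'. comult H h (\<lambda>b b'. \<phi> (a * b) * \<xi> (a' * b')))"
    using assms(1,2) by (simp add: dual_algebra_mult comult_mult H2_prod)
  also have "\<dots> = comult H h (\<lambda>b b'. comult H x (\<lambda>a a'. \<phi> (a * b) * \<xi> (a' * b')))"
    by (rule comult_swap) (rule H2)+
  also have "\<dots> = comult H h (\<lambda>b b'. comult H x (\<lambda>a a'. \<phi> (b * a) * \<xi> (b' * a')))"
    by (intro arg_cong[of _ _ "comult H h"] ext, intro arg_cong[of _ _ "comult H x"] ext)
      (simp only: assms(3)[of _ "_ :: 'h"] assms(4)[of _ "_ :: 'h"])
  also have "\<dots> = (\<phi> \<star> \<xi>) (h * x)"
    using assms(1,2) by (simp add: dual_algebra_mult comult_mult H2_prod)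
  finally show ?thesis .
qed

end

section \<open>Modules, dual systems and characters\<close>

lemma mod_homsD:
  assumes "g \<in> mod_homs V W"
  shows mod_homs_closed: "x \<in> carrier V \<Longrightarrow> g x \<in> carrier W"
    and mod_homs_add: "x \<in> carrier V \<Longrightarrow> y \<in> carrier V \<Longrightarrow> g (x \<oplus>\<^bsub>V\<^esub> y) = g x \<oplus>\<^bsub>W\<^esub> g y"
    and mod_homs_act: "x \<in> carrier V \<Longrightarrow> g (h \<odot>\<^bsub>V\<^esub> x) = h \<odot>\<^bsub>W\<^esub> g x"
  using assms by (auto simp: mod_homs_def)

lemma mod_homs_zero:
  assumes "left_module V" "left_module W" "g \<in> mod_homs V W"
  shows "g \<zero>\<^bsub>V\<^esub> = \<zero>\<^bsub>W\<^esub>"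
proof -
  interpret V: left_module V by fact
  interpret W: left_module W by fact
  have "g \<zero>\<^bsub>V\<^esub> \<oplus>\<^bsub>W\<^esub> g \<zero>\<^bsub>V\<^esub> = g \<zero>\<^bsub>V\<^esub> \<oplus>\<^bsub>W\<^esub> \<zero>\<^bsub>W\<^esub>"
    using mod_homs_add[OF assms(3), of "\<zero>\<^bsub>V\<^esub>" "\<zero>\<^bsub>V\<^esub>"] mod_homs_closed[OF assms(3), of "\<zero>\<^bsub>V\<^esub>"] by simp
  then show ?thesis
    using mod_homs_closed[OF assms(3), of "\<zero>\<^bsub>V\<^esub>"] by (simp del: W.r_zero)
qed

lemma mod_homs_comp: "g \<in> mod_homs V W \<Longrightarrow> g' \<in> mod_homs W U \<Longrightarrow> (\<lambda>x. g' (g x)) \<in> mod_homs V U"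
  by (auto simp: mod_homs_def Pi_iff)

lemma mod_isomorphicI:
  assumes "g \<in> mod_homs V W" "g' \<in> mod_homs W V"
    and "\<And>x. x \<in> carrier V \<Longrightarrow> g' (g x) = x" "\<And>y. y \<in> carrier W \<Longrightarrow> g (g' y) = y"
  shows "mod_isomorphic V W"
proof -
  have "bij_betw g (carrier V) (carrier W)"
    by (rule bij_betw_byWitness[where f' = g']) (use assms in \<open>auto simp: mod_homs_def\<close>)
  then show ?thesis using assms(1) by (auto simp: mod_isomorphic_def mod_isos_def)
qed

lemma mod_isos_inv:
  assumes "left_module V" "left_module W" "g \<in> mod_isos V W"
  shows "inv_into (carrier V) g \<in> mod_isos W V"
proof -
  interpret V: left_module V by fact
  interpret W: left_module W by fact
  let ?k = "inv_into (carrier V) g"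
  have bij: "bij_betw g (carrier V) (carrier W)" and g: "g \<in> mod_homs V W"
    using assms(3) by (auto simp: mod_isos_def)
  have k: "?k y \<in> carrier V" "g (?k y) = y" if "y \<in> carrier W" for y
    using that bij by (auto simp: bij_betw_def inv_into_into f_inv_into_f)
  have kg: "?k (g x) = x" if "x \<in> carrier V" for x
    using that bij by (simp add: bij_betw_def)
  have "?k (x \<oplus>\<^bsub>W\<^esub> y) = ?k x \<oplus>\<^bsub>V\<^esub> ?k y" if "x \<in> carrier W" "y \<in> carrier W" for x y
    using kg[of "?k x \<oplus>\<^bsub>V\<^esub> ?k y"] that by (simp add: mod_homs_add[OF g] k)
  moreover have "?k (h \<odot>\<^bsub>W\<^esub> x) = h \<odot>\<^bsub>V\<^esub> ?k x" if "x \<in> carrier W" for h x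
    using kg[of "h \<odot>\<^bsub>V\<^esub> ?k x"] that by (simp add: mod_homs_act[OF g] k V.act_closed)
  ultimately show ?thesis
    using bij_betw_inv_into[OF bij] k by (auto simp: mod_isos_def mod_homs_def)
qed

lemma (in left_module) act_zero: "a \<odot> \<zero> = \<zero>"
  by (metis act_closed act_r_distr add.l_cancel_one' add.one_closed r_zero)

lemma (in left_module) zero_act: "x \<in> carrier V \<Longrightarrow> 0 \<odot> x = \<zero>"
  by (metis act_closed act_l_distr add.l_cancel_one' add_0)

lemma (in left_module) uminus_act: "x \<in> carrier V \<Longrightarrow> (- 1) \<odot> x = \<ominus> x"
  using act_l_distr[of x "-1" 1] by (simp add: zero_act act_one act_closed minus_equality)

context bialgebra_over
begin

section \<open>Underlying vector spaces and their functionals\<close>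

lemma vec_simps [simp]:
  "carrier (vec H V) = carrier V" "\<zero>\<^bsub>vec H V\<^esub> = \<zero>\<^bsub>V\<^esub>" "x \<oplus>\<^bsub>vec H V\<^esub> y = x \<oplus>\<^bsub>V\<^esub> y"
  "c \<odot>\<^bsub>vec H V\<^esub> x = scl H c 1 \<odot>\<^bsub>V\<^esub> x"
  by (simp_all add: vec_def)

lemma dual_iff:
  "f \<in> full_dual H V \<longleftrightarrow> (\<forall>x. x \<notin> carrier V \<longrightarrow> f x = 0) \<and>
     (\<forall>x\<in>carrier V. \<forall>y\<in>carrier V. f (x \<oplus>\<^bsub>V\<^esub> y) = f x + f y) \<and>
     (\<forall>c. \<forall>x\<in>carrier V. f (scl H c 1 \<odot>\<^bsub>V\<^esub> x) = c * f x)"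
  by (simp add: linear_forms_def)

lemma dual_add: "F \<in> full_dual H V \<Longrightarrow> x \<in> carrier V \<Longrightarrow> y \<in> carrier V \<Longrightarrow> F (x \<oplus>\<^bsub>V\<^esub> y) = F x + F y"
  and dual_smult: "F \<in> full_dual H V \<Longrightarrow> x \<in> carrier V \<Longrightarrow> F (scl H c 1 \<odot>\<^bsub>V\<^esub> x) = c * F x"
  and dual_outside: "F \<in> full_dual H V \<Longrightarrow> x \<notin> carrier V \<Longrightarrow> F x = 0"
  by (simp_all add: dual_iff)

lemma dual_zero: "left_module V \<Longrightarrow> F \<in> full_dual H V \<Longrightarrow> F \<zero>\<^bsub>V\<^esub> = 0"
proof -
  assume "left_module V" and F: "F \<in> full_dual H V"
  then interpret left_module V by simp
  have "F (\<zero>\<^bsub>V\<^esub> \<oplus>\<^bsub>V\<^esub> \<zero>\<^bsub>V\<^esub>) = F \<zero>\<^bsub>V\<^esub> + F \<zero>\<^bsub>V\<^esub>" by (rule dual_add[OF F]) simp_all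
  then show ?thesis by (simp only: zero_closed r_zero add_cancel_right_left)
qed

lemma dual_minus:
  assumes "left_module V" "F \<in> full_dual H V" "x \<in> carrier V" "y \<in> carrier V"
  shows "F (x \<ominus>\<^bsub>V\<^esub> y) = F x - F y"
proof -
  interpret left_module V by fact
  have "F (x \<ominus>\<^bsub>V\<^esub> y) + F y = F (x \<ominus>\<^bsub>V\<^esub> y \<oplus>\<^bsub>V\<^esub> y)"
    using assms by (simp add: dual_add)
  also have "\<dots> = F x" using assms(3,4) by (simp add: minus_eq a_assoc l_neg)
  finally show ?thesis by (simp add: eq_diff_eq)
qed

text \<open>Every vector space has this property by a choice of basis. It is carried as a predicate
  because for objects of \<open>C\<close> the pairing with \<open>star V\<close> supplies it
  directly.\<close>

definition separated :: "('h, 'v) module \<Rightarrow> bool" where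
  "separated V \<longleftrightarrow>
     left_module V \<and> (\<forall>x\<in>carrier V. (\<forall>F\<in>full_dual H V. F x = 0) \<longrightarrow> x = \<zero>\<^bsub>V\<^esub>)"

lemma separated_module: "separated V \<Longrightarrow> left_module V"
  by (simp add: separated_def)

lemma separated_eqI:
  assumes "separated V" "x \<in> carrier V" "y \<in> carrier V" "\<And>F. F \<in> full_dual H V \<Longrightarrow> F x = F y"
  shows "x = y"
proof -
  interpret left_module V using assms(1) by (rule separated_module)
  have "x \<ominus>\<^bsub>V\<^esub> y = \<zero>\<^bsub>V\<^esub>"
    using assms(1) minus_closed[OF assms(2,3)] dual_minus[OF left_module_axioms _ assms(2,3)] assms(4)
    unfolding separated_def by (metis (no_types, lifting) cancel_comm_monoid_add_class.diff_cancel)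
  then show ?thesis
    using assms(2,3) by (metis a_assoc a_inv_closed l_neg l_zero minus_eq r_zero)
qed

lemma dual_hom:
  assumes "left_module V" "g \<in> mod_homs V W" "F \<in> full_dual H W"
  shows "transp V g F \<in> full_dual H V"
proof -
  interpret left_module V by fact
  show ?thesis
    using assms(3) mod_homsD[OF assms(2)] by (auto simp: dual_iff transp_def act_closed)
qed

text \<open>Scalars act through \<open>scl H c 1\<close>, which commutes with every h, so the action
  of h is linear over the field.\<close>

lemma dual_act:
  assumes "left_module V" "F \<in> full_dual H V"
  shows "transp V (\<lambda>x. h \<odot>\<^bsub>V\<^esub> x) F \<in> full_dual H V"
proof -
  interpret left_module V by fact
  show ?thesis
    using assms(2)
    by (auto simp: dual_iff transp_def act_closed act_r_distr mult_scl_1 simp flip: act_assoc)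
      (metis act_assoc act_closed scl_1_mult)
qed

lemma coeff_form:
  assumes "left_module V" "F \<in> full_dual H V" "x \<in> carrier V"
  shows "(\<lambda>h. F (h \<odot>\<^bsub>V\<^esub> x)) \<in> Hdual"
proof -
  interpret left_module V by fact
  have "F (scl H c h \<odot>\<^bsub>V\<^esub> x) = c * F (h \<odot>\<^bsub>V\<^esub> x)" for c h
    using assms dual_smult[OF assms(2), of "h \<odot>\<^bsub>V\<^esub> x" c]
    by (simp add: act_closed scl_1_mult flip: act_assoc)
  then show ?thesis using assms by (simp add: Hdual_iff act_l_distr act_closed dual_add)
qed

text \<open>The cut-off is there because functionals are extended by zero, whereas a bilinear form
  is arbitrary off the carriers.\<close>

lemma bilinear_left:
  assumes "left_module V" "\<beta> \<in> bilinear_forms (vec H V) B" "y \<in> carrier B"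
  shows "(\<lambda>x. if x \<in> carrier V then \<beta> x y else 0) \<in> full_dual H V"
proof -
  interpret left_module V by fact
  show ?thesis using assms by (auto simp: dual_iff bilinear_forms_def act_closed)
qed

text \<open>These are the forms that arise when h acts on v \<otimes> w; lying in \<open>H2\<close>
  is what permits Sweedler sums over them.\<close>

lemma bilinear_act:
  assumes "left_module V" "left_module W" "\<beta> \<in> bilinear_forms (vec H V) (vec H W)"
    "v \<in> carrier V" "w \<in> carrier W"
  shows "(\<lambda>a b. \<beta> (a \<odot>\<^bsub>V\<^esub> v) (b \<odot>\<^bsub>W\<^esub> w)) \<in> H2"
proof -
  interpret V: left_module V by fact
  interpret W: left_module W by fact
  have 1: "(\<lambda>a. \<beta> (a \<odot>\<^bsub>V\<^esub> v) (b \<odot>\<^bsub>W\<^esub> w)) \<in> Hdual" for b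
    using coeff_form[OF assms(1) bilinear_left[OF assms(1,3), of "b \<odot>\<^bsub>W\<^esub> w"] assms(4)] assms(4,5)
    by (simp add: V.act_closed W.act_closed)
  have 2: "(\<lambda>b. \<beta> (a \<odot>\<^bsub>V\<^esub> v) (b \<odot>\<^bsub>W\<^esub> w)) \<in> Hdual" for a
  proof -
    have "(\<lambda>y x. \<beta> x y) \<in> bilinear_forms (vec H W) (vec H V)"
      using assms(3) by (rule bilinear_forms_flip)
    from coeff_form[OF assms(2) bilinear_left[OF assms(2) this, of "a \<odot>\<^bsub>V\<^esub> v"] assms(5)]
    show ?thesis using assms(4,5) by (simp add: V.act_closed W.act_closed)
  qed
  show ?thesis using 1 2 by (simp add: H2_iff)
qed

lemma dual_finsum:
  assumes "left_module V" "F \<in> full_dual H V" "finite I" "\<And>i. i \<in> I \<Longrightarrow> x i \<in> carrier V"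
  shows "F (\<Oplus>\<^bsub>V\<^esub>i\<in>I. c i \<odot>\<^bsub>vec H V\<^esub> x i) = (\<Sum>i\<in>I. c i * F (x i))"
proof -
  interpret left_module V by fact
  show ?thesis using assms(3,4)
  proof (induction I)
    case empty
    then show ?case using dual_zero[OF assms(1,2)] by simp
  next
    case (insert i I)
    have "(\<lambda>i. scl H (c i) 1 \<odot>\<^bsub>V\<^esub> x i) \<in> insert i I \<rightarrow> carrier V"
      using insert by (auto intro: act_closed)
    then have "F (\<Oplus>\<^bsub>V\<^esub>i\<in>insert i I. c i \<odot>\<^bsub>vec H V\<^esub> x i) =
        F ((scl H (c i) 1 \<odot>\<^bsub>V\<^esub> x i) \<oplus>\<^bsub>V\<^esub> (\<Oplus>\<^bsub>V\<^esub>i\<in>I. c i \<odot>\<^bsub>vec H V\<^esub> x i))"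
      using insert by (simp add: Pi_iff)
    also have "\<dots> = F (scl H (c i) 1 \<odot>\<^bsub>V\<^esub> x i) + F (\<Oplus>\<^bsub>V\<^esub>i\<in>I. c i \<odot>\<^bsub>vec H V\<^esub> x i)"
      using insert by (intro dual_add[OF assms(2)]) (auto intro!: act_closed finsum_closed)
    finally show ?case using insert dual_smult[OF assms(2)] by simp
  qed
qed

text \<open>Replaces a linear combination in V by a vector known through its functional values, the
  only information that later arguments use.\<close>

lemma lincomb_exists:
  assumes "left_module V" "finite I" "\<And>i. i \<in> I \<Longrightarrow> x i \<in> carrier V"
  obtains z where "z \<in> carrier V" "\<And>F. F \<in> full_dual H V \<Longrightarrow> F z = (\<Sum>i\<in>I. c i * F (x i))"
proof -
  interpret left_module V by fact
  show ?thesis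
  proof (rule that)
    show "(\<Oplus>\<^bsub>V\<^esub>i\<in>I. c i \<odot>\<^bsub>vec H V\<^esub> x i) \<in> carrier V"
      using assms by (auto intro!: finsum_closed act_closed)
  qed (rule dual_finsum[OF assms(1) _ assms(2) assms(3)])
qed

text \<open>A dual system represents the canonical element \<open>\<Sum> x\<^sub>i \<otimes> f\<^sub>i\<close>; testing the
  identity \<open>\<Sum> f\<^sub>i(y) x\<^sub>i = y\<close> against functionals turns every computation with it into one with
  finite sums in the field.\<close>

definition dual_system :: "('h, 'v) module \<Rightarrow> 'i set \<Rightarrow> ('i \<Rightarrow> 'v) \<Rightarrow> ('i \<Rightarrow> 'v \<Rightarrow> 'k) \<Rightarrow> bool" where
  "dual_system V I x f \<longleftrightarrow>
     finite I \<and> (\<forall>i\<in>I. x i \<in> carrier V \<and> f i \<in> full_dual H V) \<and>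
     (\<forall>y\<in>carrier V. \<forall>F\<in>full_dual H V. (\<Sum>i\<in>I. f i y * F (x i)) = F y)"

lemma dual_systemD:
  assumes "dual_system V I x f"
  shows dual_system_finite: "finite I"
    and dual_system_carrier: "i \<in> I \<Longrightarrow> x i \<in> carrier V"
    and dual_system_dual: "i \<in> I \<Longrightarrow> f i \<in> full_dual H V"
    and dual_system_expand: "y \<in> carrier V \<Longrightarrow> F \<in> full_dual H V \<Longrightarrow> (\<Sum>i\<in>I. f i y * F (x i)) = F y"
  using assms by (auto simp: dual_system_def)

text \<open>The identity defining a dual system, read with y varying, expands \<open>F\<close> in
  the \<open>f i\<close>. Off the carrier both sides vanish.\<close>

lemma dual_system_expand_form:
  assumes "dual_system V I x f" "F \<in> full_dual H V"
  shows "(\<lambda>y. \<Sum>i\<in>I. F (x i) * f i y) = F"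
proof
  fix y
  show "(\<Sum>i\<in>I. F (x i) * f i y) = F y"
  proof (cases "y \<in> carrier V")
    case True
    then show ?thesis using dual_system_expand[OF assms(1) _ assms(2)] by (simp add: mult.commute)
  next
    case False
    then show ?thesis
      using dual_outside[OF assms(2)] dual_outside[OF dual_system_dual[OF assms(1)]] by simp
  qed
qed

lemma bilinear_dual_sum:
  assumes "\<beta> \<in> bilinear_forms A (dual_vec (full_dual H V))" "x \<in> carrier A" "finite I"
    and "\<And>i. i \<in> I \<Longrightarrow> f i \<in> full_dual H V"
  shows "\<beta> x (\<lambda>y. \<Sum>i\<in>I. c i * f i y) = (\<Sum>i\<in>I. c i * \<beta> x (f i))"
  using assms(3,4)
proof (induction I)
  case empty
  have "\<beta> x (\<lambda>y. 0 * 0) = 0 * \<beta> x (\<lambda>y. 0)"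
    using assms(1,2) linear_forms_zero[of "vec H V"] unfolding bilinear_forms_def dual_vec_def by fastforce
  then show ?case by simp
next
  case (insert i I)
  have cl: "(\<lambda>y. c i * f i y) \<in> full_dual H V" "(\<lambda>y. \<Sum>i\<in>I. c i * f i y) \<in> full_dual H V"
    using insert by (auto intro!: linear_forms_cmul linear_forms_sum)
  have "\<beta> x (\<lambda>y. c i * f i y + (\<Sum>i\<in>I. c i * f i y)) =
      \<beta> x (\<lambda>y. c i * f i y) + \<beta> x (\<lambda>y. \<Sum>i\<in>I. c i * f i y)"
    using assms(1,2) cl by (simp add: bilinear_forms_def dual_vec_def)
  also have "\<beta> x (\<lambda>y. c i * f i y) = c i * \<beta> x (f i)"
    using assms(1,2) insert.prems by (simp add: bilinear_forms_def dual_vec_def)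
  finally show ?case using insert by simp
qed

text \<open>Independence of the canonical element from the dual system: expand each x_i in the y_j,
  then collect the coefficients g_j(x_i) of the f_i, which add up to g_j by the expansion of
  functionals.\<close>

lemma dual_system_canonical:
  assumes "left_module V" "dual_system V I x f" "dual_system V J y g"
    and "\<beta> \<in> bilinear_forms (vec H V) (dual_vec (full_dual H V))"
  shows "(\<Sum>i\<in>I. \<beta> (x i) (f i)) = (\<Sum>j\<in>J. \<beta> (y j) (g j))"
proof -
  have "\<beta> (x i) (f i) = (\<Sum>j\<in>J. g j (x i) * \<beta> (y j) (f i))" if "i \<in> I" for i
    using dual_system_expand[OF assms(3) dual_system_carrier[OF assms(2) that]
        bilinear_left[OF assms(1,4), of "f i"]] dual_systemD(2,3)[OF assms(2) that]
      dual_system_carrier[OF assms(3)]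
    by (simp add: dual_vec_def)
  then have "(\<Sum>i\<in>I. \<beta> (x i) (f i)) = (\<Sum>j\<in>J. \<Sum>i\<in>I. g j (x i) * \<beta> (y j) (f i))"
    by (subst sum.swap) simp
  also have "\<dots> = (\<Sum>j\<in>J. \<beta> (y j) (\<lambda>z. \<Sum>i\<in>I. g j (x i) * f i z))"
    using dual_systemD[OF assms(2)] dual_systemD[OF assms(3)]
    by (intro sum.cong refl) (simp add: bilinear_dual_sum[OF assms(4)])
  also have "\<dots> = (\<Sum>j\<in>J. \<beta> (y j) (g j))"
    using dual_system_expand_form[OF assms(2) dual_system_dual[OF assms(3)]]
    by (intro sum.cong refl) simp
  finally show ?thesis .
qed

text \<open>\<open>canonical_elt\<close> speaks of families indexed by numbers below n, whereas
  exact sequences and tensor products produce dual systems indexed by disjoint unions and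
  products.\<close>

lemma dual_system_reindex:
  assumes "dual_system V I x f"
  obtains n x' f' where "dual_system V {..<n::nat} x' f'"
proof -
  obtain b where b: "bij_betw b {..<card I} I"
    using ex_bij_betw_nat_finite[OF dual_system_finite[OF assms]] by (auto simp: lessThan_atLeast0)
  have "dual_system V {..<card I} (x \<circ> b) (f \<circ> b)"
    using assms bij_betwE[OF b] sum.reindex_bij_betw[OF b, of "\<lambda>i. f i _ * _ (x i)"]
    by (auto simp: dual_system_def)
  then show ?thesis by (rule that)
qed

text \<open>Links the vector identity inside \<open>canonical_elt\<close> to its tested version; the
  way back from functionals to vectors is where separation enters.\<close>

lemma dual_system_iff_finsum:
  assumes "separated V" and xf: "\<And>i. i < n \<Longrightarrow> x i \<in> carrier V \<and> f i \<in> full_dual H V"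
  shows "dual_system V {..<n::nat} x f \<longleftrightarrow>
    (\<forall>y\<in>carrier V. (\<Oplus>\<^bsub>V\<^esub>i\<in>{..<n}. f i y \<odot>\<^bsub>vec H V\<^esub> x i) = y)"
proof -
  interpret left_module V using assms(1) by (rule separated_module)
  have "(\<Oplus>\<^bsub>V\<^esub>i\<in>{..<n}. f i y \<odot>\<^bsub>vec H V\<^esub> x i) = y \<longleftrightarrow>
      (\<forall>F\<in>full_dual H V. (\<Sum>i<n. f i y * F (x i)) = F y)" if "y \<in> carrier V" for y
  proof -
    have F: "F (\<Oplus>\<^bsub>V\<^esub>i\<in>{..<n}. f i y \<odot>\<^bsub>vec H V\<^esub> x i) = (\<Sum>i<n. f i y * F (x i))" if "F \<in> full_dual H V" for F
      by (rule dual_finsum[OF left_module_axioms that]) (use xf in auto)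
    have cl: "(\<Oplus>\<^bsub>V\<^esub>i\<in>{..<n}. f i y \<odot>\<^bsub>vec H V\<^esub> x i) \<in> carrier V"
      using xf by (auto intro!: finsum_closed act_closed)
    show ?thesis
    proof
      assume eq: "(\<Oplus>\<^bsub>V\<^esub>i\<in>{..<n}. f i y \<odot>\<^bsub>vec H V\<^esub> x i) = y"
      show "\<forall>F\<in>full_dual H V. (\<Sum>i<n. f i y * F (x i)) = F y" by (intro ballI) (drule F, simp only: eq)
    next
      assume "\<forall>F\<in>full_dual H V. (\<Sum>i<n. f i y * F (x i)) = F y"
      then show "(\<Oplus>\<^bsub>V\<^esub>i\<in>{..<n}. f i y \<odot>\<^bsub>vec H V\<^esub> x i) = y"
        by (intro separated_eqI[OF assms(1) cl that]) (simp only: F)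
    qed
  qed
  then show ?thesis using xf by (auto simp: dual_system_def)
qed

text \<open>The trace formula for any dual system whatever. Existence and independence of dual
  systems make the description inside \<open>canonical_elt\<close> unique.\<close>

lemma char_elt_eq:
  assumes "separated V" and I: "dual_system V I x f"
  shows "char_elt H V = (\<lambda>h. \<Sum>i\<in>I. f i (h \<odot>\<^bsub>V\<^esub> x i))"
proof -
  interpret left_module V using assms(1) by (rule separated_module)
  let ?B = "balanced_forms H V (full_dual H V)"
  let ?P = "\<lambda>\<tau>. \<exists>n x f. (\<forall>i<n. x i \<in> carrier V \<and> f i \<in> full_dual H V) \<and>
     (\<forall>y\<in>carrier V. (\<Oplus>\<^bsub>V\<^esub>i\<in>{..<n}. f i y \<odot>\<^bsub>vec H V\<^esub> x i) = y) \<and> \<tau> = tensor_sum ?B n x f"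
  have P: "\<exists>n x f. dual_system V {..<n} x f \<and> \<tau> = tensor_sum ?B n x f" if \<tau>: "?P \<tau>" for \<tau>
  proof -
    from \<tau> obtain n x f where *: "\<forall>i<n. x i \<in> carrier V \<and> f i \<in> full_dual H V"
      "\<forall>y\<in>carrier V. (\<Oplus>\<^bsub>V\<^esub>i\<in>{..<n}. f i y \<odot>\<^bsub>vec H V\<^esub> x i) = y" "\<tau> = tensor_sum ?B n x f"
      by blast
    have "dual_system V {..<n} x f"
      using dual_system_iff_finsum[OF assms(1), of n x f] * by blast
    with * show ?thesis by blast
  qed
  have B: "\<beta> \<in> bilinear_forms (vec H V) (dual_vec (full_dual H V))" if "\<beta> \<in> ?B" for \<beta>
    using that by (simp add: balanced_forms_def)
  have T: "tensor_sum ?B n x f = (\<lambda>\<beta>. if \<beta> \<in> ?B then \<Sum>i<n. \<beta> (x i) (f i) else 0)" for n x f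
    by (auto simp: tensor_sum_def pure_tensor_def)
  obtain n y g where yg: "dual_system V {..<n::nat} y g" by (rule dual_system_reindex[OF I])
  have "?P (tensor_sum ?B n y g)"
    using dual_system_iff_finsum[OF assms(1), of n y g] dual_systemD(2,3)[OF yg] yg
    by (intro exI[of _ n] exI[of _ y] exI[of _ g]) auto
  moreover have "\<tau> = tensor_sum ?B n y g" if \<tau>: "?P \<tau>" for \<tau>
  proof -
    obtain m x f where xf: "dual_system V {..<m} x f" "\<tau> = tensor_sum ?B m x f"
      using P[OF \<tau>] by blast
    show ?thesis
      unfolding xf(2) T using dual_system_canonical[OF left_module_axioms xf(1) yg] B by auto
  qed
  ultimately have "canonical_elt H V = tensor_sum ?B n y g"
    unfolding canonical_elt_def by (rule the_equality)
  \<comment> \<open>Module endomorphisms commute with h, so the coefficient form is balanced over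
    D(V), and an element of the quotient can be evaluated at it.\<close>
  moreover have bal: "(\<lambda>x f. f (h \<odot>\<^bsub>V\<^esub> x)) \<in> ?B" for h
    using dual_act[OF left_module_axioms, of _ h]
    by (auto simp: balanced_forms_def bilinear_forms_def dual_vec_def transp_def dual_iff act_closed
        mod_homs_act mod_homs_closed)
  moreover have "(\<Sum>i<n. g i (h \<odot>\<^bsub>V\<^esub> y i)) = (\<Sum>i\<in>I. f i (h \<odot>\<^bsub>V\<^esub> x i))" for h
    by (rule dual_system_canonical[OF left_module_axioms yg I B[OF bal]])
  ultimately show ?thesis
    by (simp add: char_elt_def beta_def T)
qed

end

text \<open>A finite spanning family may be linearly dependent; elimination extracts dual bases from
  it. The normalisation f_i(x_i) = 1 makes the trace of 1 count the basis vectors.\<close>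

lemma (in bialgebra_over) fin_dim_basis:
  assumes "separated V" "fin_dim H V"
  obtains n x f where "dual_system V {..<n::nat} x f" "\<And>i. i < n \<Longrightarrow> f i (x i) = 1"
proof -
  interpret left_module V using assms(1) by (rule separated_module)
  from assms(2) obtain N :: nat and b where b: "\<And>i. i < N \<Longrightarrow> b i \<in> carrier V"
    and span: "\<And>y. y \<in> carrier V \<Longrightarrow> \<exists>c. y = (\<Oplus>\<^bsub>V\<^esub>i\<in>{..<N}. c i \<odot>\<^bsub>vec H V\<^esub> b i)"
    unfolding fin_dim_def by blast
  \<comment> \<open>Gaussian elimination: the projection \<open>\<Sum> f\<^sub>i(-) x\<^sub>i\<close> fixes one more vector \<open>b\<^sub>j\<close> in each step.\<close>
  have elim: "\<exists>(n::nat) x f. (\<forall>i<n. x i \<in> carrier V \<and> f i \<in> full_dual H V) \<and>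
      (\<forall>i<n. \<forall>j<n. f i (x j) = (if i = j then 1 else 0)) \<and>
      (\<forall>j<m. \<forall>F\<in>full_dual H V. (\<Sum>i<n. f i (b j) * F (x i)) = F (b j))" if "m \<le> N" for m
    using that
  proof (induction m)
    case 0
    then show ?case by (intro exI[of _ 0]) simp
  next
    case (Suc m)
    obtain n :: nat and x f where xf: "\<And>i. i < n \<Longrightarrow> x i \<in> carrier V" "\<And>i. i < n \<Longrightarrow> f i \<in> full_dual H V"
      and bi: "\<And>i j. i < n \<Longrightarrow> j < n \<Longrightarrow> f i (x j) = (if i = j then 1 else 0)"
      and fixed: "\<And>j F. j < m \<Longrightarrow> F \<in> full_dual H V \<Longrightarrow> (\<Sum>i<n. f i (b j) * F (x i)) = F (b j)"
      using Suc.IH[OF Suc_leD[OF Suc.prems]] by blast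
    have bm: "b m \<in> carrier V" using b Suc.prems by simp
    show ?case
    proof (cases "\<forall>F\<in>full_dual H V. (\<Sum>i<n. f i (b m) * F (x i)) = F (b m)")
      case True
      then show ?thesis using xf bi fixed
        by (intro exI[of _ n] exI[of _ x] exI[of _ f]) (auto simp: less_Suc_eq)
    next
      case False
      then obtain F where F: "F \<in> full_dual H V" "(\<Sum>i<n. f i (b m) * F (x i)) \<noteq> F (b m)" by blast
      obtain z where z: "z \<in> carrier V" "\<And>L. L \<in> full_dual H V \<Longrightarrow> L z = (\<Sum>i<n. f i (b m) * L (x i))"
        using lincomb_exists[OF left_module_axioms, of "{..<n}" x "\<lambda>i. f i (b m)"] xf by auto
      \<comment> \<open>The part of b_m that the current projection misses; \<open>F\<close> is a
        functional that detects it, and every \<open>f j\<close> kills it.\<close>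
      define y where "y = b m \<ominus>\<^bsub>V\<^esub> z"
      have y: "y \<in> carrier V" using bm z by (simp add: y_def)
      have Ly: "L y = L (b m) - (\<Sum>i<n. f i (b m) * L (x i))" if "L \<in> full_dual H V" for L
        using dual_minus[OF left_module_axioms that bm z(1)] z(2)[OF that] by (simp add: y_def)
      have delta: "(\<Sum>i<n. c i * (if j = i then 1 else 0)) = c j" "(\<Sum>i<n. c i * (if i = j then 1 else 0)) = c j"
        if "j < n" for j and c :: "nat \<Rightarrow> 'k"
        using that by (simp_all add: if_distrib[of "\<lambda>t. _ * t"] cong: if_cong)
      have fy: "f j y = 0" if "j < n" for j
        using that delta(1)[OF that, of "\<lambda>i. f i (b m)"] by (simp add: Ly xf bi)
      \<comment> \<open>\<open>F\<close> stripped of its components along the \<open>f i\<close>: it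
        vanishes on the old x_j and on b_j for j < m and keeps the value \<open>F y\<close> at y.
        Division by \<open>F y\<close> then gives the new dual vector.\<close>
      define G where "G = (\<lambda>y. F y - (\<Sum>i<n. F (x i) * f i y))"
      have G: "G \<in> full_dual H V"
      proof -
        have "(\<lambda>y. F y + (-1) * (\<Sum>i<n. F (x i) * f i y)) \<in> full_dual H V"
          using F xf by (intro linear_forms_add linear_forms_cmul linear_forms_sum) auto
        then show ?thesis by (simp add: G_def)
      qed
      have Gx: "G (x j) = 0" if "j < n" for j
        using that delta(2)[OF that, of "\<lambda>i. F (x i)"] by (simp add: G_def bi)
      have Gb: "G (b j) = 0" if "j < m" for j
        using fixed[OF that F(1)] by (simp add: G_def mult.commute)
      have Gy: "G y = F y" by (simp add: G_def fy)
      have "F y \<noteq> 0" using F(2) by (simp add: Ly[OF F(1)])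
      have Gbm: "G (b m) = F y" by (simp add: Ly[OF F(1)]) (simp add: G_def mult.commute)
      define g where "g = (\<lambda>v. inverse (F y) * G v)"
      have g: "g \<in> full_dual H V" unfolding g_def by (rule linear_forms_cmul[OF G])
      let ?x = "x(n := y)" and ?f = "f(n := g)"
      have "\<forall>i<Suc n. ?x i \<in> carrier V \<and> ?f i \<in> full_dual H V"
        using xf y g by (simp add: less_Suc_eq)
      moreover have "\<forall>i<Suc n. \<forall>j<Suc n. ?f i (?x j) = (if i = j then 1 else 0)"
        using bi fy Gx Gy \<open>F y \<noteq> 0\<close> by (auto simp: less_Suc_eq g_def)
      moreover have "(\<Sum>i<Suc n. ?f i (b j) * L (?x i)) = L (b j)" if j: "j < Suc m" and L: "L \<in> full_dual H V" for j L
      proof -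
        have "(\<Sum>i<Suc n. ?f i (b j) * L (?x i)) = (\<Sum>i<n. f i (b j) * L (x i)) + g (b j) * L y"
          by simp
        also have "\<dots> = L (b j)"
        proof (cases "j = m")
          case True
          then show ?thesis using \<open>F y \<noteq> 0\<close> by (simp add: g_def Gbm Ly[OF L])
        next
          case False
          then show ?thesis using j fixed[of j L] Gb[of j] L by (simp add: g_def)
        qed
        finally show ?thesis .
      qed
      ultimately show ?thesis by blast
    qed
  qed
  obtain n :: nat and x f where xf: "\<And>i. i < n \<Longrightarrow> x i \<in> carrier V" "\<And>i. i < n \<Longrightarrow> f i \<in> full_dual H V"
      and bi: "\<And>i j. i < n \<Longrightarrow> j < n \<Longrightarrow> f i (x j) = (if i = j then 1 else 0)"
      and fixed: "\<And>j F. j < N \<Longrightarrow> F \<in> full_dual H V \<Longrightarrow> (\<Sum>i<n. f i (b j) * F (x i)) = F (b j)"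
    using elim[OF order_refl] by blast
  have "(\<Sum>i<n. f i y * F (x i)) = F y" if y: "y \<in> carrier V" and F: "F \<in> full_dual H V" for y F
  proof -
    obtain c where c: "y = (\<Oplus>\<^bsub>V\<^esub>i\<in>{..<N}. c i \<odot>\<^bsub>vec H V\<^esub> b i)" using span[OF y] by blast
    have L: "L y = (\<Sum>j<N. c j * L (b j))" if "L \<in> full_dual H V" for L
      unfolding c by (rule dual_finsum[OF left_module_axioms that]) (use b in auto)
    have "(\<Sum>i<n. f i y * F (x i)) = (\<Sum>i<n. \<Sum>j<N. c j * (f i (b j) * F (x i)))"
      by (simp add: L xf sum_distrib_right mult.assoc)
    also have "\<dots> = (\<Sum>j<N. c j * (\<Sum>i<n. f i (b j) * F (x i)))"
      by (subst sum.swap) (simp add: sum_distrib_left)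
    also have "\<dots> = F y" by (simp add: fixed F L)
    finally show ?thesis .
  qed
  then have "dual_system V {..<n} x f" using xf by (simp add: dual_system_def)
  then show ?thesis by (rule that) (simp add: bi)
qed

context bialgebra_over
begin

text \<open>\<open>n\<close> is the length of a dual basis, so it detects the zero module in every
  characteristic, unlike its image in the field.\<close>

lemma char_elt_one:
  assumes "separated V" "fin_dim H V"
  obtains n :: nat where "char_elt H V 1 = of_nat n" "n = 0 \<longleftrightarrow> carrier V = {\<zero>\<^bsub>V\<^esub>}"
proof -
  interpret left_module V using assms(1) by (rule separated_module)
  obtain n :: nat and x f where xf: "dual_system V {..<n} x f" "\<And>i. i < n \<Longrightarrow> f i (x i) = 1"
    by (rule fin_dim_basis[OF assms]) blast
  have "char_elt H V 1 = of_nat n"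
    using char_elt_eq[OF assms(1) xf(1)] xf(2) dual_system_carrier[OF xf(1)] by (simp add: act_one)
  moreover have "n = 0 \<longleftrightarrow> carrier V = {\<zero>\<^bsub>V\<^esub>}"
  proof
    assume "n = 0"
    then have "F y = 0" if "y \<in> carrier V" "F \<in> full_dual H V" for y F
      using dual_system_expand[OF xf(1) that] by simp
    then show "carrier V = {\<zero>\<^bsub>V\<^esub>}" using assms(1) by (auto simp: separated_def)
  next
    assume V: "carrier V = {\<zero>\<^bsub>V\<^esub>}"
    have False if "0 < n"
      using xf(2)[OF that] dual_systemD(2,3)[OF xf(1), of 0] V that
        dual_zero[OF left_module_axioms, of "f 0"] by auto
    then show "n = 0" by blast
  qed
  ultimately show ?thesis by (rule that)
qed

lemma char_elt_form:
  assumes "separated V" "dual_system V I x f"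
  shows "char_elt H V \<in> Hdual"
  unfolding char_elt_eq[OF assms]
  by (rule linear_forms_sum, rule coeff_form[OF separated_module[OF assms(1)]])
    (use dual_systemD[OF assms(2)] in auto)

text \<open>The usual proof of tr(ab) = tr(ba): a dual system inserted between the two actions gives
  a double sum that is symmetric up to the order of summation.\<close>

lemma char_elt_commute:
  assumes "separated V" and xf: "dual_system V I x f"
  shows "char_elt H V (a * b) = char_elt H V (b * a)"
proof -
  interpret left_module V using assms(1) by (rule separated_module)
  note D = dual_systemD[OF xf]
  have tr: "char_elt H V (a * b) = (\<Sum>i\<in>I. \<Sum>j\<in>I. f j (b \<odot>\<^bsub>V\<^esub> x i) * f i (a \<odot>\<^bsub>V\<^esub> x j))" for a b
  proof -
    have "f i ((a * b) \<odot>\<^bsub>V\<^esub> x i) = (\<Sum>j\<in>I. f j (b \<odot>\<^bsub>V\<^esub> x i) * f i (a \<odot>\<^bsub>V\<^esub> x j))" if "i \<in> I" for i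
      using D(4)[of "b \<odot>\<^bsub>V\<^esub> x i" "transp V (\<lambda>x. a \<odot>\<^bsub>V\<^esub> x) (f i)"] dual_act[OF left_module_axioms D(3)[OF that]]
        D(2) that by (simp add: act_closed act_assoc transp_def)
    then show ?thesis by (simp add: char_elt_eq[OF assms])
  qed
  show ?thesis unfolding tr by (subst sum.swap) (simp add: mult.commute)
qed

text \<open>Lifting the vectors x''_j to u_j gives the linear section sending w to the sum of
  f''_j(w) u_j. What is left of v after subtracting the section of p v lies in the kernel of p, that
  is in the image of i, and this defines the retraction r. Neither the section nor r need be
  H-linear.\<close>

lemma short_exact_splitting:
  assumes "left_module V'" "separated V" "separated V''"
    and i: "i \<in> mod_homs V' V" and p: "p \<in> mod_homs V V''"
    and inj: "inj_on i (carrier V')" and exact: "i ` carrier V' = mod_ker V V'' p"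
    and surj: "p ` carrier V = carrier V''" and xf: "dual_system V'' J x'' f''"
  obtains u r where "\<And>j. j \<in> J \<Longrightarrow> u j \<in> carrier V" "\<And>j. j \<in> J \<Longrightarrow> p (u j) = x'' j"
    "\<And>v. v \<in> carrier V \<Longrightarrow> r v \<in> carrier V'"
    "\<And>v L. v \<in> carrier V \<Longrightarrow> L \<in> full_dual H V \<Longrightarrow> L v = L (i (r v)) + (\<Sum>j\<in>J. f'' j (p v) * L (u j))"
    "\<And>v. v \<in> carrier V' \<Longrightarrow> r (i v) = v"
    "\<And>F. F \<in> full_dual H V' \<Longrightarrow> transp V r F \<in> full_dual H V"
proof -
  interpret V: left_module V using assms(2) by (rule separated_module)
  interpret V': left_module V' by fact
  interpret V'': left_module V'' using assms(3) by (rule separated_module)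
  note D = dual_systemD[OF xf]
  have "\<exists>v\<in>carrier V. p v = x'' j" if "j \<in> J" for j using surj D(2)[OF that] by (metis imageE)
  then obtain u where u: "\<And>j. j \<in> J \<Longrightarrow> u j \<in> carrier V" "\<And>j. j \<in> J \<Longrightarrow> p (u j) = x'' j" by metis
  have "\<exists>v'\<in>carrier V'. \<forall>L\<in>full_dual H V. L v = L (i v') + (\<Sum>j\<in>J. f'' j (p v) * L (u j))"
    if v: "v \<in> carrier V" for v
  proof -
    \<comment> \<open>z is the section applied to p v; by the dual system of V'' it has the same
      image under p as v.\<close>
    obtain z where z: "z \<in> carrier V" "\<And>F. F \<in> full_dual H V \<Longrightarrow> F z = (\<Sum>j\<in>J. f'' j (p v) * F (u j))"
      using lincomb_exists[OF V.left_module_axioms D(1), of u "\<lambda>j. f'' j (p v)"] u(1) by blast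
    have "p (v \<ominus>\<^bsub>V\<^esub> z) = \<zero>\<^bsub>V''\<^esub>"
    proof (rule separated_eqI[OF assms(3)])
      fix F assume F: "F \<in> full_dual H V''"
      have tF: "transp V p F \<in> full_dual H V" by (rule dual_hom[OF V.left_module_axioms p F])
      have "F (p (v \<ominus>\<^bsub>V\<^esub> z)) = F (p v) - F (p z)"
        using dual_minus[OF V.left_module_axioms tF v z(1)] v z(1) by (simp add: transp_def)
      also have "F (p z) = (\<Sum>j\<in>J. f'' j (p v) * F (x'' j))"
        using z(2)[OF tF] z(1) u by (simp add: transp_def)
      also have "\<dots> = F (p v)" using D(4)[OF mod_homs_closed[OF p v] F] .
      finally show "F (p (v \<ominus>\<^bsub>V\<^esub> z)) = F \<zero>\<^bsub>V''\<^esub>" by (simp add: dual_zero[OF V''.left_module_axioms F])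
    qed (use p v z in \<open>auto simp: mod_homs_closed\<close>)
    then have "v \<ominus>\<^bsub>V\<^esub> z \<in> i ` carrier V'" using v z(1) by (simp add: exact mod_ker_def)
    then obtain v' where v': "v' \<in> carrier V'" "i v' = v \<ominus>\<^bsub>V\<^esub> z" by auto
    show ?thesis
      using v' dual_minus[OF V.left_module_axioms _ v z(1)] z(2)
      by (intro bexI[of _ v']) (simp_all add: algebra_simps)
  qed
  then have "\<forall>v\<in>carrier V. \<exists>v'. v' \<in> carrier V' \<and>
      (\<forall>L\<in>full_dual H V. L v = L (i v') + (\<Sum>j\<in>J. f'' j (p v) * L (u j)))"
    by blast
  from bchoice[OF this] obtain r where r: "\<And>v. v \<in> carrier V \<Longrightarrow> r v \<in> carrier V'"
    "\<And>v L. v \<in> carrier V \<Longrightarrow> L \<in> full_dual H V \<Longrightarrow> L v = L (i (r v)) + (\<Sum>j\<in>J. f'' j (p v) * L (u j))"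
    by blast
  have ir: "L (i (r v)) = L v - (\<Sum>j\<in>J. f'' j (p v) * L (u j))" if "v \<in> carrier V" "L \<in> full_dual H V" for v L
    using r(2)[OF that] by simp
  \<comment> \<open>Since i is injective and functionals separate V, the retraction is determined by
    its tested values. Linearity of r and r i = id are instances.\<close>
  have r_eq: "r v = v'" if v: "v \<in> carrier V" "v' \<in> carrier V'"
    and eq: "\<And>L. L \<in> full_dual H V \<Longrightarrow> L (i v') = L v - (\<Sum>j\<in>J. f'' j (p v) * L (u j))" for v v'
  proof -
    have "i (r v) = i v'"
    proof (rule separated_eqI[OF assms(2)])
      show "F (i (r v)) = F (i v')" if "F \<in> full_dual H V" for F
        by (simp only: ir[OF v(1) that] eq[OF that])
    qed (use v r(1) mod_homs_closed[OF i] in auto)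
    then show ?thesis using inj v r(1) by (auto dest: inj_onD)
  qed
  have f''p: "f'' j (p (v \<oplus>\<^bsub>V\<^esub> w)) = f'' j (p v) + f'' j (p w)"
      "f'' j (p (scl H c 1 \<odot>\<^bsub>V\<^esub> v)) = c * f'' j (p v)"
    if "j \<in> J" "v \<in> carrier V" "w \<in> carrier V" for j v w c
    using that D(3)[OF that(1)] p
    by (simp_all add: mod_homs_add mod_homs_act mod_homs_closed dual_add dual_smult)
  have "r (v \<oplus>\<^bsub>V\<^esub> w) = r v \<oplus>\<^bsub>V'\<^esub> r w" if "v \<in> carrier V" "w \<in> carrier V" for v w
    using that f''p(1)
    by (intro r_eq) (simp_all add: r(1) mod_homs_add[OF i] mod_homs_closed[OF i] dual_add ir
        distrib_right sum.distrib)
  moreover have "r (scl H c 1 \<odot>\<^bsub>V\<^esub> v) = scl H c 1 \<odot>\<^bsub>V'\<^esub> r v" if "v \<in> carrier V" for v c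
    using that f''p(2)
    by (intro r_eq) (simp_all add: r(1) V.act_closed V'.act_closed mod_homs_act[OF i] mod_homs_closed[OF i]
        dual_smult ir sum_distrib_left right_diff_distrib mult.assoc)
  ultimately have tr: "transp V r F \<in> full_dual H V" if "F \<in> full_dual H V'" for F
    using that r(1) by (auto simp: dual_iff transp_def V.act_closed)
  have "r (i v) = v" if v: "v \<in> carrier V'" for v
  proof (rule r_eq)
    have "i v \<in> mod_ker V V'' p" using v exact by auto
    then have "p (i v) = \<zero>\<^bsub>V''\<^esub>" by (simp add: mod_ker_def)
    then show "L (i v) = L (i v) - (\<Sum>j\<in>J. f'' j (p (i v)) * L (u j))" for L
      using dual_zero[OF V''.left_module_axioms D(3)] by simp
  qed (use v mod_homs_closed[OF i] in auto)
  with that u r tr show ?thesis by blast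
qed

text \<open>The trace of a block triangular matrix: i(x'_a) and u_j with the functionals f'_a r and
  f''_j p form a dual system of V. On the diagonal h acts as on V' and V'', because r i = id and p(h
  u_j) = h x''_j.\<close>

lemma char_elt_short_exact:
  assumes "separated V'" "separated V" "separated V''" and se: "short_exact V' V V''"
    and S': "dual_system V' I x' f'" and S'': "dual_system V'' J x'' f''"
  shows "char_elt H V h = char_elt H V' h + char_elt H V'' h"
proof -
  interpret V: left_module V using assms(2) by (rule separated_module)
  interpret V': left_module V' using assms(1) by (rule separated_module)
  interpret V'': left_module V'' using assms(3) by (rule separated_module)
  obtain i p where i: "i \<in> mod_homs V' V" and p: "p \<in> mod_homs V V''"
    and inj: "inj_on i (carrier V')" and exact: "i ` carrier V' = mod_ker V V'' p"
    and surj: "p ` carrier V = carrier V''"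
    using se unfolding short_exact_def by blast
  obtain u r where u: "\<And>j. j \<in> J \<Longrightarrow> u j \<in> carrier V" "\<And>j. j \<in> J \<Longrightarrow> p (u j) = x'' j"
    and r: "\<And>v. v \<in> carrier V \<Longrightarrow> r v \<in> carrier V'"
    and split: "\<And>v L. v \<in> carrier V \<Longrightarrow> L \<in> full_dual H V \<Longrightarrow> L v = L (i (r v)) + (\<Sum>j\<in>J. f'' j (p v) * L (u j))"
    and ri: "\<And>v. v \<in> carrier V' \<Longrightarrow> r (i v) = v"
    and tr: "\<And>F. F \<in> full_dual H V' \<Longrightarrow> transp V r F \<in> full_dual H V"
    by (rule short_exact_splitting[OF V'.left_module_axioms assms(2,3) i p inj exact surj S'']) blast
  note D' = dual_systemD[OF S'] and D'' = dual_systemD[OF S'']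
  \<comment> \<open>The left summand of the index set numbers the vectors coming from V', the right
    one the lifts from V''.\<close>
  let ?x = "case_sum (\<lambda>a. i (x' a)) u"
  let ?f = "case_sum (\<lambda>a. transp V r (f' a)) (\<lambda>j. transp V p (f'' j))"
  have "dual_system V (I <+> J) ?x ?f"
    unfolding dual_system_def
  proof (intro conjI ballI)
    show "finite (I <+> J)" using D'(1) D''(1) by simp
  next
    fix k assume "k \<in> I <+> J"
    then show "?x k \<in> carrier V" "?f k \<in> full_dual H V"
      using D' D'' u(1) mod_homs_closed[OF i] tr dual_hom[OF V.left_module_axioms p] by auto
  next
    fix y F assume y: "y \<in> carrier V" and F: "F \<in> full_dual H V"
    have "(\<Sum>a\<in>I. f' a (r y) * F (i (x' a))) = F (i (r y))"
      using D'(4)[OF r[OF y] dual_hom[OF V'.left_module_axioms i F]] D'(2) r[OF y] by (simp add: transp_def)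
    then show "(\<Sum>k\<in>I <+> J. ?f k y * F (?x k)) = F y"
      using y D'(1) D''(1) by (simp add: sum.Plus split[OF y F] transp_def)
  qed
  moreover have "r (h \<odot>\<^bsub>V\<^esub> i (x' a)) = h \<odot>\<^bsub>V'\<^esub> x' a" if "a \<in> I" for a
    using ri[of "h \<odot>\<^bsub>V'\<^esub> x' a"] D'(2)[OF that] by (simp add: V'.act_closed mod_homs_act[OF i])
  moreover have "p (h \<odot>\<^bsub>V\<^esub> u j) = h \<odot>\<^bsub>V''\<^esub> x'' j" if "j \<in> J" for j
    using u that by (simp add: mod_homs_act[OF p])
  ultimately show ?thesis
    using D'(1,2) D''(1) u(1) mod_homs_closed[OF i]
    by (simp add: char_elt_eq[OF assms(2)] char_elt_eq[OF assms(1) S'] char_elt_eq[OF assms(3) S'']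
        sum.Plus transp_def V.act_closed)
qed

end

section \<open>Tensor products of modules\<close>

text \<open>Closure under negatives and scalars is not demanded: elements of a tensor product are
  plain finite sums of pure tensors, and the resulting induction has only three cases.\<close>

definition add_gen :: "('h, 't) module \<Rightarrow> 't set \<Rightarrow> bool" where
  "add_gen T G \<longleftrightarrow> G \<subseteq> carrier T \<and>
     (\<forall>S\<subseteq>carrier T. \<zero>\<^bsub>T\<^esub> \<in> S \<longrightarrow> G \<subseteq> S \<longrightarrow> (\<forall>x\<in>S. \<forall>y\<in>S. x \<oplus>\<^bsub>T\<^esub> y \<in> S) \<longrightarrow> S = carrier T)"

lemma add_gen_induct [consumes 3, case_names zero gen add]:
  assumes "add_gen T G" "left_module T" "t \<in> carrier T"
    and "P \<zero>\<^bsub>T\<^esub>" "\<And>g. g \<in> G \<Longrightarrow> P g"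
    and "\<And>s t. s \<in> carrier T \<Longrightarrow> t \<in> carrier T \<Longrightarrow> P s \<Longrightarrow> P t \<Longrightarrow> P (s \<oplus>\<^bsub>T\<^esub> t)"
  shows "P t"
proof -
  interpret left_module T by fact
  have "{t \<in> carrier T. P t} = carrier T"
  proof -
    have "\<forall>S\<subseteq>carrier T. \<zero>\<^bsub>T\<^esub> \<in> S \<longrightarrow> G \<subseteq> S \<longrightarrow> (\<forall>x\<in>S. \<forall>y\<in>S. x \<oplus>\<^bsub>T\<^esub> y \<in> S) \<longrightarrow> S = carrier T"
      and "G \<subseteq> carrier T"
      using assms(1) by (auto simp: add_gen_def)
    then show ?thesis using assms(4-6) by (elim allE[of _ "{t \<in> carrier T. P t}"]) auto
  qed
  then show ?thesis using assms(3) by blast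
qed

context bialgebra_over
begin

text \<open>A homomorphism is built from its transpose. If every functional of T pulls back to one
  of T' with the right values on generators and on their translates, then each t in T' has an image
  s with F s equal to the pulled back value at t. Separation makes s unique, and uniqueness yields
  additivity and H-linearity.\<close>

lemma hom_from_generators:
  assumes "left_module T'" and sep: "separated T" and gen: "add_gen T' (\<mu> ` G)"
    and \<nu>: "\<And>g. g \<in> G \<Longrightarrow> \<nu> g \<in> carrier T"
    and ext: "\<And>F. F \<in> full_dual H T \<Longrightarrow>
      \<exists>F'\<in>full_dual H T'. \<forall>g\<in>G. F' (\<mu> g) = F (\<nu> g) \<and> (\<forall>h. F' (h \<odot>\<^bsub>T'\<^esub> \<mu> g) = F (h \<odot>\<^bsub>T\<^esub> \<nu> g))"
  shows "\<exists>\<theta>\<in>mod_homs T' T. \<forall>g\<in>G. \<theta> (\<mu> g) = \<nu> g"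
proof -
  interpret T: left_module T using sep by (rule separated_module)
  interpret T': left_module T' by fact
  \<comment> \<open>\<open>E\<close> plays the transpose of the map to be found; it is merely
    chosen, and no linearity of the choice is used.\<close>
  obtain E where E: "\<And>F. F \<in> full_dual H T \<Longrightarrow> E F \<in> full_dual H T'"
    and E_gen: "\<And>F g. F \<in> full_dual H T \<Longrightarrow> g \<in> G \<Longrightarrow> E F (\<mu> g) = F (\<nu> g)"
    and E_act: "\<And>F g h. F \<in> full_dual H T \<Longrightarrow> g \<in> G \<Longrightarrow> E F (h \<odot>\<^bsub>T'\<^esub> \<mu> g) = F (h \<odot>\<^bsub>T\<^esub> \<nu> g)"
    using ext by metis
  have mu: "\<mu> g \<in> carrier T'" if "g \<in> G" for g using gen that by (auto simp: add_gen_def)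
  \<comment> \<open>The clause on translates by h travels through the induction, so that H-linearity
    of \<theta> can be read off by comparing functionals.\<close>
  have "\<exists>s\<in>carrier T. \<forall>F\<in>full_dual H T. F s = E F t \<and> (\<forall>h. F (h \<odot>\<^bsub>T\<^esub> s) = E F (h \<odot>\<^bsub>T'\<^esub> t))"
    if "t \<in> carrier T'" for t
    using gen T'.left_module_axioms that
  proof (induction rule: add_gen_induct)
    case zero
    show ?case
    proof (intro bexI[of _ "\<zero>\<^bsub>T\<^esub>"] ballI)
      fix F assume F: "F \<in> full_dual H T"
      show "F \<zero>\<^bsub>T\<^esub> = E F \<zero>\<^bsub>T'\<^esub> \<and> (\<forall>h. F (h \<odot>\<^bsub>T\<^esub> \<zero>\<^bsub>T\<^esub>) = E F (h \<odot>\<^bsub>T'\<^esub> \<zero>\<^bsub>T'\<^esub>))"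
        by (simp add: T.act_zero T'.act_zero dual_zero[OF T.left_module_axioms F]
            dual_zero[OF T'.left_module_axioms E[OF F]])
    qed simp
  next
    case (gen g)
    then show ?case using \<nu> E_gen E_act by fastforce
  next
    case (add s t)
    from add.IH obtain s' where s': "s' \<in> carrier T" "\<And>F. F \<in> full_dual H T \<Longrightarrow> F s' = E F s"
      "\<And>F h. F \<in> full_dual H T \<Longrightarrow> F (h \<odot>\<^bsub>T\<^esub> s') = E F (h \<odot>\<^bsub>T'\<^esub> s)" by blast
    from add.IH obtain t' where t': "t' \<in> carrier T" "\<And>F. F \<in> full_dual H T \<Longrightarrow> F t' = E F t"
      "\<And>F h. F \<in> full_dual H T \<Longrightarrow> F (h \<odot>\<^bsub>T\<^esub> t') = E F (h \<odot>\<^bsub>T'\<^esub> t)" by blast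
    show ?case
    proof (intro bexI[of _ "s' \<oplus>\<^bsub>T\<^esub> t'"] ballI conjI allI)
      fix F assume F: "F \<in> full_dual H T"
      show "F (s' \<oplus>\<^bsub>T\<^esub> t') = E F (s \<oplus>\<^bsub>T'\<^esub> t)"
        using s' t' F add.hyps by (simp add: dual_add[OF F] dual_add[OF E[OF F]])
      show "F (h \<odot>\<^bsub>T\<^esub> (s' \<oplus>\<^bsub>T\<^esub> t')) = E F (h \<odot>\<^bsub>T'\<^esub> (s \<oplus>\<^bsub>T'\<^esub> t))" for h
        using s' t' F add.hyps
        by (simp add: T.act_r_distr T'.act_r_distr T.act_closed T'.act_closed dual_add[OF F] dual_add[OF E[OF F]])
    qed (use s' t' in simp)
  qed
  then have "\<forall>t\<in>carrier T'. \<exists>s. s \<in> carrier T \<and>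
      (\<forall>F\<in>full_dual H T. F s = E F t \<and> (\<forall>h. F (h \<odot>\<^bsub>T\<^esub> s) = E F (h \<odot>\<^bsub>T'\<^esub> t)))"
    by blast
  from bchoice[OF this] obtain \<theta> where \<theta>: "\<And>t. t \<in> carrier T' \<Longrightarrow> \<theta> t \<in> carrier T"
    "\<And>t F. t \<in> carrier T' \<Longrightarrow> F \<in> full_dual H T \<Longrightarrow> F (\<theta> t) = E F t"
    "\<And>t F h. t \<in> carrier T' \<Longrightarrow> F \<in> full_dual H T \<Longrightarrow> F (h \<odot>\<^bsub>T\<^esub> \<theta> t) = E F (h \<odot>\<^bsub>T'\<^esub> t)"
    by blast
  have "\<theta> (s \<oplus>\<^bsub>T'\<^esub> t) = \<theta> s \<oplus>\<^bsub>T\<^esub> \<theta> t" if "s \<in> carrier T'" "t \<in> carrier T'" for s t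
  proof (rule separated_eqI[OF sep])
    show "F (\<theta> (s \<oplus>\<^bsub>T'\<^esub> t)) = F (\<theta> s \<oplus>\<^bsub>T\<^esub> \<theta> t)" if F: "F \<in> full_dual H T" for F
      using \<open>s \<in> carrier T'\<close> \<open>t \<in> carrier T'\<close>
      by (simp add: \<theta>(1) \<theta>(2)[OF _ F] dual_add[OF F] dual_add[OF E[OF F]])
  qed (use that \<theta>(1) in simp_all)
  moreover have "\<theta> (h \<odot>\<^bsub>T'\<^esub> t) = h \<odot>\<^bsub>T\<^esub> \<theta> t" if "t \<in> carrier T'" for h t
  proof (rule separated_eqI[OF sep])
    show "F (\<theta> (h \<odot>\<^bsub>T'\<^esub> t)) = F (h \<odot>\<^bsub>T\<^esub> \<theta> t)" if F: "F \<in> full_dual H T" for F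
      using \<open>t \<in> carrier T'\<close> by (simp add: \<theta>(2,3)[OF _ F] T'.act_closed)
  qed (use that \<theta>(1) in \<open>simp_all add: T.act_closed T'.act_closed\<close>)
  ultimately have "\<theta> \<in> mod_homs T' T" using \<theta>(1) by (auto simp: mod_homs_def)
  moreover have "\<theta> (\<mu> g) = \<nu> g" if "g \<in> G" for g
  proof (rule separated_eqI[OF sep])
    show "F (\<theta> (\<mu> g)) = F (\<nu> g)" if F: "F \<in> full_dual H T" for F
      by (simp add: \<theta>(2)[OF mu[OF \<open>g \<in> G\<close>] F] E_gen[OF F \<open>g \<in> G\<close>])
  qed (use that \<theta>(1) mu \<nu> in simp_all)
  ultimately show ?thesis by blast
qed

lemma mod_homs_eq_on_generators:
  assumes "left_module T" "left_module T'" "add_gen T G" "\<theta> \<in> mod_homs T T'" "\<theta>' \<in> mod_homs T T'"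
    and "\<And>g. g \<in> G \<Longrightarrow> \<theta> g = \<theta>' g" and "t \<in> carrier T"
  shows "\<theta> t = \<theta>' t"
  using assms(3,1,7)
  by (induction rule: add_gen_induct)
    (simp_all add: assms mod_homs_zero[OF assms(1,2,4)] mod_homs_zero[OF assms(1,2,5)]
      mod_homs_add[OF assms(4)] mod_homs_add[OF assms(5)])

text \<open>A tensor product up to isomorphism, with bilinearity and the action tested against
  functionals.  The Sweedler functional \<open>D\<close> is a parameter, so that flipping it exchanges the
  two factors.\<close>

definition tensor_map ::
  "('h \<Rightarrow> ('h \<Rightarrow> 'h \<Rightarrow> 'k) \<Rightarrow> 'k) \<Rightarrow> ('h, 'a) module \<Rightarrow> ('h, 'b) module \<Rightarrow> ('h, 't) module \<Rightarrow>
   ('a \<Rightarrow> 'b \<Rightarrow> 't) \<Rightarrow> bool" where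
  "tensor_map D V W T \<mu> \<longleftrightarrow>
     add_gen T ((\<lambda>(v, w). \<mu> v w) ` (carrier V \<times> carrier W)) \<and>
     (\<forall>F\<in>full_dual H T. (\<lambda>v w. F (\<mu> v w)) \<in> bilinear_forms (vec H V) (vec H W)) \<and>
     (\<forall>\<beta>\<in>bilinear_forms (vec H V) (vec H W). \<exists>F\<in>full_dual H T.
        \<forall>v\<in>carrier V. \<forall>w\<in>carrier W. F (\<mu> v w) = \<beta> v w) \<and>
     (\<forall>F\<in>full_dual H T. \<forall>h. \<forall>v\<in>carrier V. \<forall>w\<in>carrier W.
        F (h \<odot>\<^bsub>T\<^esub> \<mu> v w) = D h (\<lambda>a b. F (\<mu> (a \<odot>\<^bsub>V\<^esub> v) (b \<odot>\<^bsub>W\<^esub> w))))"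

text \<open>Applied to \<open>comult H\<close>, this is the co-opposite comultiplication.\<close>

definition flip :: "('h \<Rightarrow> ('h \<Rightarrow> 'h \<Rightarrow> 'k) \<Rightarrow> 'k) \<Rightarrow> 'h \<Rightarrow> ('h \<Rightarrow> 'h \<Rightarrow> 'k) \<Rightarrow> 'k" where
  "flip D h \<beta> = D h (\<lambda>a b. \<beta> b a)"

lemma tensor_mapD:
  assumes "tensor_map D V W T \<mu>"
  shows tensor_map_gen: "add_gen T ((\<lambda>(v, w). \<mu> v w) ` (carrier V \<times> carrier W))"
    and tensor_map_closed: "v \<in> carrier V \<Longrightarrow> w \<in> carrier W \<Longrightarrow> \<mu> v w \<in> carrier T"
    and tensor_map_bilinear: "F \<in> full_dual H T \<Longrightarrow> (\<lambda>v w. F (\<mu> v w)) \<in> bilinear_forms (vec H V) (vec H W)"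
    and tensor_map_act: "F \<in> full_dual H T \<Longrightarrow> v \<in> carrier V \<Longrightarrow> w \<in> carrier W \<Longrightarrow>
      F (h \<odot>\<^bsub>T\<^esub> \<mu> v w) = D h (\<lambda>a b. F (\<mu> (a \<odot>\<^bsub>V\<^esub> v) (b \<odot>\<^bsub>W\<^esub> w)))"
  using assms by (auto simp: tensor_map_def add_gen_def)

lemma tensor_map_factor:
  assumes "tensor_map D V W T \<mu>" "\<beta> \<in> bilinear_forms (vec H V) (vec H W)"
  obtains F where "F \<in> full_dual H T" "\<And>v w. v \<in> carrier V \<Longrightarrow> w \<in> carrier W \<Longrightarrow> F (\<mu> v w) = \<beta> v w"
  using assms by (auto simp: tensor_map_def)

text \<open>Each statement about the left factor of a tensor product yields through this lemma its
  counterpart for the right factor.\<close>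

lemma tensor_map_flip:
  assumes "tensor_map D V W T \<mu>"
  shows "tensor_map (flip D) W V T (\<lambda>w v. \<mu> v w)"
  unfolding tensor_map_def
proof (intro conjI ballI allI)
  have "(\<lambda>(w, v). \<mu> v w) ` (carrier W \<times> carrier V) = (\<lambda>(v, w). \<mu> v w) ` (carrier V \<times> carrier W)"
    by force
  then show "add_gen T ((\<lambda>(w, v). \<mu> v w) ` (carrier W \<times> carrier V))"
    using tensor_map_gen[OF assms] by simp
next
  fix F assume "F \<in> full_dual H T"
  then show "(\<lambda>w v. F (\<mu> v w)) \<in> bilinear_forms (vec H W) (vec H V)"
    using bilinear_forms_flip[OF tensor_map_bilinear[OF assms]] by blast
next
  fix \<beta> assume \<beta>: "\<beta> \<in> bilinear_forms (vec H W) (vec H V)"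
  show "\<exists>F\<in>full_dual H T. \<forall>w\<in>carrier W. \<forall>v\<in>carrier V. F (\<mu> v w) = \<beta> w v"
    by (rule tensor_map_factor[OF assms bilinear_forms_flip[OF \<beta>]]) blast
next
  fix F h w v assume "F \<in> full_dual H T" "w \<in> carrier W" "v \<in> carrier V"
  then show "F (h \<odot>\<^bsub>T\<^esub> \<mu> v w) = flip D h (\<lambda>a b. F (\<mu> (b \<odot>\<^bsub>V\<^esub> v) (a \<odot>\<^bsub>W\<^esub> w)))"
    using tensor_map_act[OF assms] by (simp add: flip_def)
qed

lemma tensor_map_induct [consumes 3, case_names zero gen add]:
  assumes "tensor_map D V W T \<mu>" "left_module T" "t \<in> carrier T"
    and "P \<zero>\<^bsub>T\<^esub>" "\<And>v w. v \<in> carrier V \<Longrightarrow> w \<in> carrier W \<Longrightarrow> P (\<mu> v w)"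
    and "\<And>s t. s \<in> carrier T \<Longrightarrow> t \<in> carrier T \<Longrightarrow> P s \<Longrightarrow> P t \<Longrightarrow> P (s \<oplus>\<^bsub>T\<^esub> t)"
  shows "P t"
  using tensor_map_gen[OF assms(1)] assms(2,3)
  by (induction rule: add_gen_induct) (use assms(4-6) in auto)

lemma tensor_map_add_left:
  assumes "tensor_map D V W T \<mu>" "left_module V" "separated T" "v \<in> carrier V" "v' \<in> carrier V" "w \<in> carrier W"
  shows "\<mu> (v \<oplus>\<^bsub>V\<^esub> v') w = \<mu> v w \<oplus>\<^bsub>T\<^esub> \<mu> v' w"
proof -
  interpret V: left_module V by fact
  interpret T: left_module T using assms(3) by (rule separated_module)
  note tm = tensor_mapD[OF assms(1)]
  show ?thesis
  proof (rule separated_eqI[OF assms(3)])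
    show "F (\<mu> (v \<oplus>\<^bsub>V\<^esub> v') w) = F (\<mu> v w \<oplus>\<^bsub>T\<^esub> \<mu> v' w)" if F: "F \<in> full_dual H T" for F
      using assms(4-6) tm(3)[OF F] by (simp add: tm(2) dual_add[OF F] bilinear_forms_def)
  qed (use assms(4-6) tm(2) in auto)
qed

lemma tensor_map_zero_left:
  assumes "tensor_map D V W T \<mu>" "left_module V" "separated T" "w \<in> carrier W"
  shows "\<mu> \<zero>\<^bsub>V\<^esub> w = \<zero>\<^bsub>T\<^esub>"
proof -
  interpret V: left_module V by fact
  interpret T: left_module T using assms(3) by (rule separated_module)
  note tm = tensor_mapD[OF assms(1)]
  have "\<mu> \<zero>\<^bsub>V\<^esub> w \<oplus>\<^bsub>T\<^esub> \<mu> \<zero>\<^bsub>V\<^esub> w = \<mu> \<zero>\<^bsub>V\<^esub> w \<oplus>\<^bsub>T\<^esub> \<zero>\<^bsub>T\<^esub>"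
    using tensor_map_add_left[OF assms(1-3), of "\<zero>\<^bsub>V\<^esub>" "\<zero>\<^bsub>V\<^esub>" w] assms(4) tm(2) by simp
  then show ?thesis using tm(2)[of "\<zero>\<^bsub>V\<^esub>" w] assms(4) by (simp del: T.r_zero)
qed

lemma tensor_map_smult:
  assumes "tensor_map D V W T \<mu>" "left_module V" "left_module W" "separated T"
    and "v \<in> carrier V" "w \<in> carrier W"
  shows "\<mu> (scl H c 1 \<odot>\<^bsub>V\<^esub> v) w = \<mu> v (scl H c 1 \<odot>\<^bsub>W\<^esub> w)"
proof -
  interpret V: left_module V by fact
  interpret W: left_module W by fact
  note tm = tensor_mapD[OF assms(1)]
  show ?thesis
  proof (rule separated_eqI[OF assms(4)])
    show "F (\<mu> (scl H c 1 \<odot>\<^bsub>V\<^esub> v) w) = F (\<mu> v (scl H c 1 \<odot>\<^bsub>W\<^esub> w))" if F: "F \<in> full_dual H T" for F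
      using assms(5,6) tm(3)[OF F] by (simp add: bilinear_forms_def)
  qed (use assms(5,6) tm(2) in \<open>auto simp: V.act_closed W.act_closed\<close>)
qed

lemma tensor_map_form_left:
  assumes "tensor_map D V W T \<mu>" "left_module V" "F \<in> full_dual H T" "w \<in> carrier W"
  shows "(\<lambda>v. if v \<in> carrier V then F (\<mu> v w) else 0) \<in> full_dual H V"
  using bilinear_left[OF assms(2) tensor_map_bilinear[OF assms(1,3)], of w] assms(4) by simp

lemma tensor_map_form_right:
  assumes "tensor_map D V W T \<mu>" "left_module W" "F \<in> full_dual H T" "v \<in> carrier V"
  shows "(\<lambda>w. if w \<in> carrier W then F (\<mu> v w) else 0) \<in> full_dual H W"
  using tensor_map_form_left[OF tensor_map_flip[OF assms(1)] assms(2-4)] .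

text \<open>Over a field the sequence splits linearly, and a splitting survives tensoring with W:
  the retraction gives injectivity on the left, retraction and section together give exactness in
  the middle, and surjectivity is checked on pure tensors. The Sweedler functional is arbitrary, so
  tensoring from the other side is the flipped instance.\<close>

lemma short_exact_tensor:
  assumes "left_module V'" "separated V" "separated V''" "left_module W"
    and "separated T'" "separated T" "separated T''"
    and tm': "tensor_map D V' W T' \<mu>'" and tm: "tensor_map D V W T \<mu>" and tm'': "tensor_map D V'' W T'' \<mu>''"
    and se: "short_exact V' V V''" and S'': "dual_system V'' J x'' f''"
  shows "short_exact T' T T''"
proof -
  interpret V: left_module V using assms(2) by (rule separated_module)
  interpret V': left_module V' using assms(1) .
  interpret V'': left_module V'' using assms(3) by (rule separated_module)
  interpret T: left_module T using assms(6) by (rule separated_module)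
  interpret T': left_module T' using assms(5) by (rule separated_module)
  interpret T'': left_module T'' using assms(7) by (rule separated_module)
  interpret W: left_module W by fact
  obtain i p where i: "i \<in> mod_homs V' V" and p: "p \<in> mod_homs V V''"
    and inj: "inj_on i (carrier V')" and exact: "i ` carrier V' = mod_ker V V'' p"
    and surj: "p ` carrier V = carrier V''"
    using se unfolding short_exact_def by blast
  obtain u r where u: "\<And>j. j \<in> J \<Longrightarrow> u j \<in> carrier V" "\<And>j. j \<in> J \<Longrightarrow> p (u j) = x'' j"
    and r: "\<And>v. v \<in> carrier V \<Longrightarrow> r v \<in> carrier V'"
    and split: "\<And>v L. v \<in> carrier V \<Longrightarrow> L \<in> full_dual H V \<Longrightarrow> L v = L (i (r v)) + (\<Sum>j\<in>J. f'' j (p v) * L (u j))"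
    and ri: "\<And>v. v \<in> carrier V' \<Longrightarrow> r (i v) = v"
    and tr: "\<And>F. F \<in> full_dual H V' \<Longrightarrow> transp V r F \<in> full_dual H V"
    by (rule short_exact_splitting[OF V'.left_module_axioms assms(2,3) i p inj exact surj S'']) blast
  note D'' = dual_systemD[OF S'']
  note cl = mod_homs_closed[OF i] mod_homs_closed[OF p] tensor_map_closed[OF tm'] tensor_map_closed[OF tm]
    tensor_map_closed[OF tm''] V.act_closed V'.act_closed V''.act_closed W.act_closed
  \<comment> \<open>Functoriality of tensoring with W: functionals are pulled back along g on pure
    tensors, and H-linearity of g matches the actions.\<close>
  have induced: "\<exists>\<theta>\<in>mod_homs S S'. \<forall>v\<in>carrier A. \<forall>w\<in>carrier W. \<theta> (\<nu> v w) = \<nu>' (g v) w"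
    if "separated S" "separated S'" "left_module A" "left_module A'"
      "tensor_map D A W S \<nu>" "tensor_map D A' W S' \<nu>'" "g \<in> mod_homs A A'" for A A' S S' \<nu> \<nu>' g
  proof -
    interpret A: left_module A by fact
    have ext: "\<exists>F'\<in>full_dual H S. \<forall>x\<in>carrier A \<times> carrier W.
        F' ((\<lambda>(v, w). \<nu> v w) x) = F ((\<lambda>(v, w). \<nu>' (g v) w) x) \<and>
        (\<forall>h. F' (h \<odot>\<^bsub>S\<^esub> (\<lambda>(v, w). \<nu> v w) x) = F (h \<odot>\<^bsub>S'\<^esub> (\<lambda>(v, w). \<nu>' (g v) w) x))"
      if F: "F \<in> full_dual H S'" for F
    proof -
      have "(\<lambda>v w. F (\<nu>' (g v) w)) \<in> bilinear_forms (vec H A) (vec H W)"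
        using tensor_map_bilinear[OF \<open>tensor_map D A' W S' \<nu>'\<close> F] mod_homsD[OF \<open>g \<in> mod_homs A A'\<close>]
        by (auto simp: bilinear_forms_def)
      then obtain F' where F': "F' \<in> full_dual H S"
        "\<And>v w. v \<in> carrier A \<Longrightarrow> w \<in> carrier W \<Longrightarrow> F' (\<nu> v w) = F (\<nu>' (g v) w)"
        by (rule tensor_map_factor[OF \<open>tensor_map D A W S \<nu>\<close>]) blast
      then show ?thesis
        using tensor_map_act[OF \<open>tensor_map D A W S \<nu>\<close> F'(1)] tensor_map_act[OF \<open>tensor_map D A' W S' \<nu>'\<close> F]
          mod_homsD[OF \<open>g \<in> mod_homs A A'\<close>]
        by (intro bexI[of _ F']) (auto simp: A.act_closed W.act_closed)
    qed
    have closed: "(\<lambda>(v, w). \<nu>' (g v) w) x \<in> carrier S'" if "x \<in> carrier A \<times> carrier W" for x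
      using that mod_homs_closed[OF \<open>g \<in> mod_homs A A'\<close>] tensor_map_closed[OF \<open>tensor_map D A' W S' \<nu>'\<close>]
      by auto
    show ?thesis
      using hom_from_generators[OF separated_module[OF \<open>separated S\<close>] \<open>separated S'\<close>
          tensor_map_gen[OF \<open>tensor_map D A W S \<nu>\<close>] closed ext] by simp
  qed
  obtain \<theta>i where \<theta>i: "\<theta>i \<in> mod_homs T' T"
      "\<And>v w. v \<in> carrier V' \<Longrightarrow> w \<in> carrier W \<Longrightarrow> \<theta>i (\<mu>' v w) = \<mu> (i v) w"
    using induced[OF assms(5,6) V'.left_module_axioms V.left_module_axioms tm' tm i] by blast
  obtain \<theta>p where \<theta>p: "\<theta>p \<in> mod_homs T T''"
      "\<And>v w. v \<in> carrier V \<Longrightarrow> w \<in> carrier W \<Longrightarrow> \<theta>p (\<mu> v w) = \<mu>'' (p v) w"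
    using induced[OF assms(6,7) V.left_module_axioms V''.left_module_axioms tm tm'' p] by blast
  note mh = mod_homs_closed[OF \<theta>i(1)] mod_homs_closed[OF \<theta>p(1)] mod_homs_add[OF \<theta>i(1)] mod_homs_add[OF \<theta>p(1)]
    mod_homs_zero[OF T'.left_module_axioms T.left_module_axioms \<theta>i(1)]
    mod_homs_zero[OF T.left_module_axioms T''.left_module_axioms \<theta>p(1)]
  have pi: "p (i v) = \<zero>\<^bsub>V''\<^esub>" if "v \<in> carrier V'" for v
  proof -
    have "i v \<in> mod_ker V V'' p" using that exact by auto
    then show ?thesis by (simp add: mod_ker_def)
  qed
  have "inj_on \<theta>i (carrier T')"
  proof (rule inj_onI)
    fix s t assume st: "s \<in> carrier T'" "t \<in> carrier T'" "\<theta>i s = \<theta>i t"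
    show "s = t"
    proof (rule separated_eqI[OF assms(5) st(1,2)])
      fix F assume F: "F \<in> full_dual H T'"
      \<comment> \<open>The form of F composed with r \<otimes> id. The functional G obtained from
        it satisfies G \<theta>i = F, so \<theta>i loses nothing that functionals of T' can
        see.\<close>
      have "(\<lambda>v w. F (\<mu>' (r v) w)) \<in> bilinear_forms (vec H V) (vec H W)"
      proof -
        have "F (\<mu>' (r v) w) = transp V r (\<lambda>v. if v \<in> carrier V' then F (\<mu>' v w) else 0) v"
          if "v \<in> carrier V" for v w using that r by (simp add: transp_def)
        moreover have "transp V r (\<lambda>v. if v \<in> carrier V' then F (\<mu>' v w) else 0) \<in> full_dual H V"
          if "w \<in> carrier W" for w
          by (rule tr, rule tensor_map_form_left[OF tm' V'.left_module_axioms F that])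
        ultimately show ?thesis
          using tensor_map_bilinear[OF tm' F] r
          by (simp add: bilinear_forms_def dual_add dual_smult V.act_closed)
      qed
      then obtain G where G: "G \<in> full_dual H T"
        "\<And>v w. v \<in> carrier V \<Longrightarrow> w \<in> carrier W \<Longrightarrow> G (\<mu> v w) = F (\<mu>' (r v) w)"
        by (rule tensor_map_factor[OF tm]) blast
      have "G (\<theta>i t) = F t" if "t \<in> carrier T'" for t
        using tm' T'.left_module_axioms that
      proof (induction rule: tensor_map_induct)
        case zero
        then show ?case using mh dual_zero[OF T.left_module_axioms G(1)] dual_zero[OF T'.left_module_axioms F] by simp
      next
        case (gen v w)
        then show ?case by (simp add: \<theta>i G cl ri)
      next
        case (add s t)
        then show ?case by (simp add: mh dual_add[OF G(1)] dual_add[OF F])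
      qed
      then show "F s = F t" using st by metis
    qed
  qed
  moreover have "\<theta>p ` carrier T = carrier T''"
  proof (intro equalityI subsetI)
    fix t assume "t \<in> carrier T''"
    with tm'' T''.left_module_axioms show "t \<in> \<theta>p ` carrier T"
    proof (induction rule: tensor_map_induct)
      case zero
      show ?case by (rule image_eqI[of _ _ "\<zero>\<^bsub>T\<^esub>"]) (simp_all add: mh)
    next
      case (gen v w)
      from gen(1) obtain v' where "v' \<in> carrier V" "p v' = v" unfolding surj[symmetric] by auto
      then show ?case using gen by (intro image_eqI[of _ _ "\<mu> v' w"]) (simp_all add: cl \<theta>p)
    next
      case (add s t)
      then obtain s' t' where "s' \<in> carrier T" "t' \<in> carrier T" "s = \<theta>p s'" "t = \<theta>p t'" by auto
      then show ?case by (intro image_eqI[of _ _ "s' \<oplus>\<^bsub>T\<^esub> t'"]) (simp_all add: mh)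
    qed
  qed (use mh in auto)
  moreover have "\<theta>i ` carrier T' = mod_ker T T'' \<theta>p"
  proof (intro equalityI subsetI)
    have "\<theta>p (\<theta>i t) = \<zero>\<^bsub>T''\<^esub>" if "t \<in> carrier T'" for t
      using tm' T'.left_module_axioms that
    proof (induction rule: tensor_map_induct)
      case (gen v w)
      then show ?case
        using tensor_map_zero_left[OF tm'' V''.left_module_axioms assms(7)] by (simp add: \<theta>i \<theta>p cl pi)
    qed (simp_all add: mh)
    then show "t \<in> mod_ker T T'' \<theta>p" if "t \<in> \<theta>i ` carrier T'" for t
      using that mh by (auto simp: mod_ker_def)
  next
    fix t assume "t \<in> mod_ker T T'' \<theta>p"
    then have t: "t \<in> carrier T" "\<theta>p t = \<zero>\<^bsub>T''\<^esub>" by (auto simp: mod_ker_def)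
    \<comment> \<open>G is F composed with the section tensored with W, which sends v \<otimes> w to
      the sum of f''_j(v) u_j \<otimes> w.\<close>
    have "\<exists>G\<in>full_dual H T''. \<forall>v\<in>carrier V''. \<forall>w\<in>carrier W. G (\<mu>'' v w) = (\<Sum>j\<in>J. f'' j v * F (\<mu> (u j) w))"
      if F: "F \<in> full_dual H T" for F
    proof -
      have "(\<lambda>v w. \<Sum>j\<in>J. f'' j v * F (\<mu> (u j) w)) \<in> bilinear_forms (vec H V'') (vec H W)"
        using tensor_map_bilinear[OF tm F] D''(3) u(1)
        by (intro bilinear_forms_sum) (simp add: bilinear_forms_def dual_add dual_smult algebra_simps)
      then show ?thesis by (rule tensor_map_factor[OF tm'']) blast
    qed
    then have "\<forall>F\<in>full_dual H T. \<exists>G. G \<in> full_dual H T'' \<and>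
        (\<forall>v\<in>carrier V''. \<forall>w\<in>carrier W. G (\<mu>'' v w) = (\<Sum>j\<in>J. f'' j v * F (\<mu> (u j) w)))"
      by blast
    from bchoice[OF this] obtain G where G: "\<And>F. F \<in> full_dual H T \<Longrightarrow> G F \<in> full_dual H T''"
      "\<And>F v w. F \<in> full_dual H T \<Longrightarrow> v \<in> carrier V'' \<Longrightarrow> w \<in> carrier W \<Longrightarrow>
         G F (\<mu>'' v w) = (\<Sum>j\<in>J. f'' j v * F (\<mu> (u j) w))"
      by blast
    \<comment> \<open>The linear splitting of V tensored with W, in tested form. For t in the kernel
      of \<theta>p the second summand disappears.\<close>
    have "\<exists>t'\<in>carrier T'. \<forall>F\<in>full_dual H T. F t = F (\<theta>i t') + G F (\<theta>p t)"
      using tm T.left_module_axioms t(1)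
    proof (induction rule: tensor_map_induct)
      case zero
      show ?case
      proof (intro bexI[of _ "\<zero>\<^bsub>T'\<^esub>"] ballI)
        fix F assume F: "F \<in> full_dual H T"
        show "F \<zero>\<^bsub>T\<^esub> = F (\<theta>i \<zero>\<^bsub>T'\<^esub>) + G F (\<theta>p \<zero>\<^bsub>T\<^esub>)"
          by (simp add: mh dual_zero[OF T''.left_module_axioms G(1)[OF F]])
      qed simp
    next
      case (gen v w)
      have "F (\<mu> v w) = F (\<theta>i (\<mu>' (r v) w)) + G F (\<theta>p (\<mu> v w))" if F: "F \<in> full_dual H T" for F
        using split[OF gen(1) tensor_map_form_left[OF tm V.left_module_axioms F gen(2)]] gen r u(1)
        by (simp add: \<theta>i \<theta>p cl G(2)[OF F])
      then show ?case using gen r by (intro bexI[of _ "\<mu>' (r v) w"]) (auto simp: cl)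
    next
      case (add s t)
      then obtain s' t' where st: "s' \<in> carrier T'" "t' \<in> carrier T'"
        "\<And>F. F \<in> full_dual H T \<Longrightarrow> F s = F (\<theta>i s') + G F (\<theta>p s)"
        "\<And>F. F \<in> full_dual H T \<Longrightarrow> F t = F (\<theta>i t') + G F (\<theta>p t)" by blast
      have "F (s \<oplus>\<^bsub>T\<^esub> t) = F (\<theta>i (s' \<oplus>\<^bsub>T'\<^esub> t')) + G F (\<theta>p (s \<oplus>\<^bsub>T\<^esub> t))" if "F \<in> full_dual H T" for F
        using add.hyps st(1,2)
        by (simp add: mh dual_add[OF that] dual_add[OF G(1)[OF that]] st(3,4)[OF that])
      then show ?case using st by (intro bexI[of _ "s' \<oplus>\<^bsub>T'\<^esub> t'"]) auto
    qed
    then obtain t' where t': "t' \<in> carrier T'" "\<And>F. F \<in> full_dual H T \<Longrightarrow> F t = F (\<theta>i t') + G F \<zero>\<^bsub>T''\<^esub>"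
      unfolding t(2) by blast
    have "t = \<theta>i t'"
    proof (rule separated_eqI[OF assms(6)])
      show "F t = F (\<theta>i t')" if F: "F \<in> full_dual H T" for F
        using t'(2)[OF F] by (simp add: dual_zero[OF T''.left_module_axioms G(1)[OF F]])
    qed (use t(1) t'(1) mh in simp_all)
    then show "t \<in> \<theta>i ` carrier T'" using t'(1) by blast
  qed
  ultimately show ?thesis using \<theta>i(1) \<theta>p(1) unfolding short_exact_def by blast
qed

section \<open>The concrete tensor product seen through an isomorphism onto an object\<close>

lemma
  assumes "left_module V" "left_module W"
  defines "B \<equiv> bilinear_forms (vec H V) (vec H W)"
  shows pure_in_tensor: "v \<in> carrier V \<Longrightarrow> w \<in> carrier W \<Longrightarrow> pure_tensor B v w \<in> carrier (tensor_module H V W)"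
    and tensor_module_add: "\<sigma> \<oplus>\<^bsub>tensor_module H V W\<^esub> \<tau> = (\<lambda>\<beta>. \<sigma> \<beta> + \<tau> \<beta>)"
    and tensor_module_zero: "\<zero>\<^bsub>tensor_module H V W\<^esub> = (\<lambda>\<beta>. 0)"
    and tensor_module_carrier: "carrier (tensor_module H V W) =
      {tensor_sum B n v w | n v w. \<forall>i<n. v i \<in> carrier V \<and> w i \<in> carrier W}"
proof -
  show *: "carrier (tensor_module H V W) =
      {tensor_sum B n v w | n v w. \<forall>i<n. v i \<in> carrier V \<and> w i \<in> carrier W}"
    by (simp add: tensor_module_def tensor_space_def Let_def tensor_span_def B_def)
  show "\<sigma> \<oplus>\<^bsub>tensor_module H V W\<^esub> \<tau> = (\<lambda>\<beta>. \<sigma> \<beta> + \<tau> \<beta>)" "\<zero>\<^bsub>tensor_module H V W\<^esub> = (\<lambda>\<beta>. 0)"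
    by (simp_all add: tensor_module_def tensor_space_def Let_def)
  assume "v \<in> carrier V" "w \<in> carrier W"
  then show "pure_tensor B v w \<in> carrier (tensor_module H V W)"
    unfolding * by (intro CollectI exI[of _ 1] exI[of _ "\<lambda>_. v"] exI[of _ "\<lambda>_. w"]) (simp add: tensor_sum_def)
qed

lemma tensor_module_induct:
  assumes "left_module V" "left_module W" "\<tau> \<in> carrier (tensor_module H V W)"
    and zero: "P (\<lambda>\<beta>. 0)"
    and step: "\<And>\<sigma> v w. \<sigma> \<in> carrier (tensor_module H V W) \<Longrightarrow> P \<sigma> \<Longrightarrow> v \<in> carrier V \<Longrightarrow> w \<in> carrier W \<Longrightarrow>
      P (\<sigma> \<oplus>\<^bsub>tensor_module H V W\<^esub> pure_tensor (bilinear_forms (vec H V) (vec H W)) v w)"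
  shows "P \<tau>"
proof -
  let ?B = "bilinear_forms (vec H V) (vec H W)"
  note car = tensor_module_carrier[OF assms(1,2)]
  obtain n v w where \<tau>: "\<tau> = tensor_sum ?B n v w" "\<And>i. i < n \<Longrightarrow> v i \<in> carrier V \<and> w i \<in> carrier W"
    using assms(3) unfolding car by blast
  have "m \<le> n \<Longrightarrow> P (tensor_sum ?B m v w)" for m
  proof (induction m)
    case 0
    then show ?case using zero by (simp add: tensor_sum_def)
  next
    case (Suc m)
    have "tensor_sum ?B (Suc m) v w = tensor_sum ?B m v w \<oplus>\<^bsub>tensor_module H V W\<^esub> pure_tensor ?B (v m) (w m)"
      by (simp add: tensor_sum_def tensor_module_add[OF assms(1,2)])
    moreover have "tensor_sum ?B m v w \<in> carrier (tensor_module H V W)"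
      unfolding car using Suc.prems \<tau>(2) by (intro CollectI exI[of _ m] exI[of _ v] exI[of _ w]) auto
    ultimately show ?case using step[of "tensor_sum ?B m v w" "v m" "w m"] Suc \<tau>(2)[of m] by simp
  qed
  then show ?thesis using \<tau>(1) by simp
qed

lemma bilinear_vecI:
  assumes "\<And>x x' y. x \<in> carrier V \<Longrightarrow> x' \<in> carrier V \<Longrightarrow> y \<in> carrier W \<Longrightarrow> \<beta> (x \<oplus>\<^bsub>V\<^esub> x') y = \<beta> x y + \<beta> x' y"
    and "\<And>x y y'. x \<in> carrier V \<Longrightarrow> y \<in> carrier W \<Longrightarrow> y' \<in> carrier W \<Longrightarrow> \<beta> x (y \<oplus>\<^bsub>W\<^esub> y') = \<beta> x y + \<beta> x y'"
    and "\<And>c x y. x \<in> carrier V \<Longrightarrow> y \<in> carrier W \<Longrightarrow> \<beta> (scl H c 1 \<odot>\<^bsub>V\<^esub> x) y = c * \<beta> x y"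
    and "\<And>c x y. x \<in> carrier V \<Longrightarrow> y \<in> carrier W \<Longrightarrow> \<beta> x (scl H c 1 \<odot>\<^bsub>W\<^esub> y) = c * \<beta> x y"
  shows "\<beta> \<in> bilinear_forms (vec H V) (vec H W)"
  using assms by (simp add: bilinear_forms_def)

lemma bilinear_translate:
  assumes "left_module V" "left_module W" "\<beta> \<in> bilinear_forms (vec H V) (vec H W)"
  shows "(\<lambda>v w. \<beta> (x \<odot>\<^bsub>V\<^esub> v) (y \<odot>\<^bsub>W\<^esub> w)) \<in> bilinear_forms (vec H V) (vec H W)"
proof -
  interpret V: left_module V by fact
  interpret W: left_module W by fact
  have [simp]: "x \<odot>\<^bsub>V\<^esub> (scl H c 1 \<odot>\<^bsub>V\<^esub> v) = scl H c 1 \<odot>\<^bsub>V\<^esub> (x \<odot>\<^bsub>V\<^esub> v)" if "v \<in> carrier V" for c v x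
    using that by (simp flip: V.act_assoc add: mult_scl_1 scl_1_mult)
  have [simp]: "x \<odot>\<^bsub>W\<^esub> (scl H c 1 \<odot>\<^bsub>W\<^esub> v) = scl H c 1 \<odot>\<^bsub>W\<^esub> (x \<odot>\<^bsub>W\<^esub> v)" if "v \<in> carrier W" for c v x
    using that by (simp flip: W.act_assoc add: mult_scl_1 scl_1_mult)
  show ?thesis using assms(3)
    by (simp add: bilinear_forms_def V.act_closed W.act_closed V.act_r_distr W.act_r_distr)
qed

lemma tensor_module_act_pure:
  assumes "left_module V" "left_module W" "v \<in> carrier V" "w \<in> carrier W"
    and "\<beta> \<in> bilinear_forms (vec H V) (vec H W)"
  shows "(h \<odot>\<^bsub>tensor_module H V W\<^esub> pure_tensor (bilinear_forms (vec H V) (vec H W)) v w) \<beta> =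
    comult H h (\<lambda>a b. \<beta> (a \<odot>\<^bsub>V\<^esub> v) (b \<odot>\<^bsub>W\<^esub> w))"
proof -
  have "(\<lambda>v w. \<beta> (x \<odot>\<^bsub>V\<^esub> v) (y \<odot>\<^bsub>W\<^esub> w)) \<in> bilinear_forms (vec H V) (vec H W)" for x y
    by (rule bilinear_translate[OF assms(1,2,5)])
  then show ?thesis using assms(5) by (simp add: tensor_module_def Let_def pure_tensor_def)
qed

text \<open>The bridge from the double dual realisation to \<open>tensor_map\<close>. The module
  axioms are known for T, so zero and scalars are transported through \<phi>, while forms become
  functionals of T by evaluation after undoing \<phi>.\<close>

lemma tensor_map_of_iso:
  assumes "left_module V" "left_module W" "separated T" "\<phi> \<in> mod_isos (tensor_module H V W) T"
  shows "tensor_map (comult H) V W T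
    (\<lambda>v w. \<phi> (pure_tensor (bilinear_forms (vec H V) (vec H W)) v w))"
proof -
  interpret V: left_module V by fact
  interpret W: left_module W by fact
  interpret T: left_module T using assms(3) by (rule separated_module)
  let ?M = "tensor_module H V W"
  let ?B = "bilinear_forms (vec H V) (vec H W)"
  let ?p = "pure_tensor ?B"
  let ?k = "inv_into (carrier ?M) \<phi>"
  have bij: "bij_betw \<phi> (carrier ?M) (carrier T)" and \<phi>: "\<phi> \<in> mod_homs ?M T"
    using assms(4) by (auto simp: mod_isos_def)
  note add = tensor_module_add[OF assms(1,2)] and zero = tensor_module_zero[OF assms(1,2)]
    and pure = pure_in_tensor[OF assms(1,2)] and car = tensor_module_carrier[OF assms(1,2)]
  have k: "?k y \<in> carrier ?M" "\<phi> (?k y) = y" if "y \<in> carrier T" for y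
    using that bij by (auto simp: bij_betw_def inv_into_into f_inv_into_f)
  have k\<phi>: "?k (\<phi> \<tau>) = \<tau>" if "\<tau> \<in> carrier ?M" for \<tau>
    using that bij by (simp add: bij_betw_def)
  have zero_in: "(\<lambda>\<beta>. 0) \<in> carrier ?M"
    unfolding car by (intro CollectI exI[of _ 0]) (simp add: tensor_sum_def)
  have add_in: "(\<lambda>\<beta>. \<sigma> \<beta> + \<tau> \<beta>) \<in> carrier ?M"
    if in_M: "\<sigma> \<in> carrier ?M" "\<tau> \<in> carrier ?M" for \<sigma> \<tau>
  proof -
    obtain n v w where \<sigma>: "\<sigma> = tensor_sum ?B n v w" "\<And>i. i < n \<Longrightarrow> v i \<in> carrier V \<and> w i \<in> carrier W"
      using in_M(1) unfolding car by blast
    obtain m v' w' where \<tau>: "\<tau> = tensor_sum ?B m v' w'" "\<And>i. i < m \<Longrightarrow> v' i \<in> carrier V \<and> w' i \<in> carrier W"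
      using in_M(2) unfolding car by blast
    let ?v = "\<lambda>i. if i < n then v i else v' (i - n)" and ?w = "\<lambda>i. if i < n then w i else w' (i - n)"
    have "(\<Sum>i<n + m. ?p (?v i) (?w i) \<beta>) = (\<Sum>i<n. ?p (v i) (w i) \<beta>) + (\<Sum>i<m. ?p (v' i) (w' i) \<beta>)" for \<beta>
      unfolding sum_append[symmetric] by (intro sum.cong) auto
    then have "(\<lambda>\<beta>. \<sigma> \<beta> + \<tau> \<beta>) = tensor_sum ?B (n + m) ?v ?w"
      unfolding \<sigma> \<tau> tensor_sum_def by auto
    moreover have "\<forall>i<n + m. ?v i \<in> carrier V \<and> ?w i \<in> carrier W"
      using \<sigma>(2) \<tau>(2) by (auto simp: not_less less_diff_conv2 add.commute)
    ultimately show ?thesis unfolding car by blast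
  qed
  have \<phi>_add: "\<phi> (\<lambda>\<beta>. \<sigma> \<beta> + \<tau> \<beta>) = \<phi> \<sigma> \<oplus>\<^bsub>T\<^esub> \<phi> \<tau>" if "\<sigma> \<in> carrier ?M" "\<tau> \<in> carrier ?M" for \<sigma> \<tau>
    using mod_homs_add[OF \<phi> that] by (simp add: add)
  have \<phi>_zero: "\<phi> (\<lambda>\<beta>. 0) = \<zero>\<^bsub>T\<^esub>"
  proof -
    have "\<phi> (\<lambda>\<beta>. 0) \<oplus>\<^bsub>T\<^esub> \<phi> (\<lambda>\<beta>. 0) = \<phi> (\<lambda>\<beta>. 0) \<oplus>\<^bsub>T\<^esub> \<zero>\<^bsub>T\<^esub>"
      using \<phi>_add[OF zero_in zero_in] mod_homs_closed[OF \<phi> zero_in] by simp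
    then show ?thesis using mod_homs_closed[OF \<phi> zero_in] by (simp del: T.r_zero)
  qed
  \<comment> \<open>The scalar c acts through c 1, and \<Delta>(c 1) = c (1 \<otimes> 1), so the
    twisted action restricts to pointwise scaling.\<close>
  have smult: "scl H c 1 \<odot>\<^bsub>?M\<^esub> \<tau> = (\<lambda>\<beta>. c * \<tau> \<beta>)" if in_M: "\<tau> \<in> carrier ?M" for c \<tau>
  proof
    fix \<beta>
    obtain n v w where \<tau>: "\<tau> = tensor_sum ?B n v w" "\<And>i. i < n \<Longrightarrow> v i \<in> carrier V \<and> w i \<in> carrier W"
      using in_M unfolding car by blast
    show "(scl H c 1 \<odot>\<^bsub>?M\<^esub> \<tau>) \<beta> = c * \<tau> \<beta>"
    proof (cases "\<beta> \<in> ?B")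
      case False
      then show ?thesis by (simp add: \<tau> tensor_module_def Let_def tensor_sum_def pure_tensor_def)
    next
      case True
      note B = bilinear_translate[OF assms(1,2) True]
      have H2: "(\<lambda>x y. \<beta> (x \<odot>\<^bsub>V\<^esub> v i) (y \<odot>\<^bsub>W\<^esub> w i)) \<in> H2" if "i < n" for i
        using bilinear_act[OF assms(1,2) True] \<tau>(2)[OF that] by blast
      have "(scl H c 1 \<odot>\<^bsub>?M\<^esub> \<tau>) \<beta> =
          comult H (scl H c 1) (\<lambda>x y. \<Sum>i<n. \<beta> (x \<odot>\<^bsub>V\<^esub> v i) (y \<odot>\<^bsub>W\<^esub> w i))"
        using True B by (simp add: \<tau> tensor_module_def Let_def tensor_sum_def pure_tensor_def)
      also have "\<dots> = c * (\<Sum>i<n. \<beta> (1 \<odot>\<^bsub>V\<^esub> v i) (1 \<odot>\<^bsub>W\<^esub> w i))"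
        by (subst comult_scl, subst comult_1, rule bilinear_forms_sum) (use H2 in auto)
      also have "\<dots> = c * \<tau> \<beta>"
        using True \<tau>(2) by (simp add: \<tau>(1) tensor_sum_def pure_tensor_def V.act_one W.act_one)
      finally show ?thesis .
    qed
  qed
  have p_add: "?p (v \<oplus>\<^bsub>V\<^esub> v') w = (\<lambda>\<beta>. ?p v w \<beta> + ?p v' w \<beta>)"
    "?p (scl H c 1 \<odot>\<^bsub>V\<^esub> v) w = (\<lambda>\<beta>. c * ?p v w \<beta>)"
    if "v \<in> carrier V" "v' \<in> carrier V" "w \<in> carrier W" for v v' w c
    using that by (auto simp: pure_tensor_def bilinear_forms_def)
  have p_add': "?p v (w \<oplus>\<^bsub>W\<^esub> w') = (\<lambda>\<beta>. ?p v w \<beta> + ?p v w' \<beta>)"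
    "?p v (scl H c 1 \<odot>\<^bsub>W\<^esub> w) = (\<lambda>\<beta>. c * ?p v w \<beta>)"
    if "v \<in> carrier V" "w \<in> carrier W" "w' \<in> carrier W" for v w w' c
    using that by (auto simp: pure_tensor_def bilinear_forms_def)
  have \<phi>_smult: "\<phi> (\<lambda>\<beta>. c * \<tau> \<beta>) = scl H c 1 \<odot>\<^bsub>T\<^esub> \<phi> \<tau>" if "\<tau> \<in> carrier ?M" for c \<tau>
    using mod_homs_act[OF \<phi> that] smult[OF that] by metis
  have smult_in: "(\<lambda>\<beta>. c * \<tau> \<beta>) \<in> carrier ?M" if "\<tau> \<in> carrier ?M" for c \<tau>
    using assms(1,2) that
  proof (rule tensor_module_induct)
    show "(\<lambda>\<beta>. c * 0) \<in> carrier ?M" using zero_in by simp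
    show "(\<lambda>\<beta>. c * (\<sigma> \<oplus>\<^bsub>?M\<^esub> ?p v w) \<beta>) \<in> carrier ?M"
      if "(\<lambda>\<beta>. c * \<sigma> \<beta>) \<in> carrier ?M" "v \<in> carrier V" "w \<in> carrier W" for \<sigma> v w
      using add_in[OF that(1) pure[of "scl H c 1 \<odot>\<^bsub>V\<^esub> v" w]] p_add(2)[OF that(2,2,3)] that V.act_closed
      by (simp add: add distrib_left)
  qed
  have bil: "(\<lambda>v w. F (\<phi> (?p v w))) \<in> ?B" if F: "F \<in> full_dual H T" for F
    by (rule bilinear_vecI)
      (simp_all add: p_add p_add' \<phi>_add \<phi>_smult pure mod_homs_closed[OF \<phi>] dual_add[OF F] dual_smult[OF F])
  show ?thesis
    unfolding tensor_map_def
  proof (intro conjI ballI allI)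
    have "S = carrier T" if S: "S \<subseteq> carrier T" "\<zero>\<^bsub>T\<^esub> \<in> S" "(\<lambda>(v, w). \<phi> (?p v w)) ` (carrier V \<times> carrier W) \<subseteq> S"
      "\<forall>x\<in>S. \<forall>y\<in>S. x \<oplus>\<^bsub>T\<^esub> y \<in> S" for S
    proof -
      have "\<phi> \<tau> \<in> S" if "\<tau> \<in> carrier ?M" for \<tau>
        using assms(1,2) that
      proof (rule tensor_module_induct)
        show "\<phi> (\<lambda>\<beta>. 0) \<in> S" using S by (simp add: \<phi>_zero)
        show "\<phi> (\<sigma> \<oplus>\<^bsub>?M\<^esub> ?p v w) \<in> S"
          if "\<sigma> \<in> carrier ?M" "\<phi> \<sigma> \<in> S" "v \<in> carrier V" "w \<in> carrier W" for \<sigma> v w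
          using S(3,4) that by (auto simp: mod_homs_add[OF \<phi>] pure)
      qed
      then show ?thesis using k S(1) by (metis subsetI subset_antisym)
    qed
    moreover have "(\<lambda>(v, w). \<phi> (?p v w)) ` (carrier V \<times> carrier W) \<subseteq> carrier T"
      using pure mod_homs_closed[OF \<phi>] by auto
    ultimately show "add_gen T ((\<lambda>(v, w). \<phi> (?p v w)) ` (carrier V \<times> carrier W))"
      unfolding add_gen_def by blast
  next
    fix F assume "F \<in> full_dual H T"
    then show "(\<lambda>v w. F (\<phi> (?p v w))) \<in> ?B" by (rule bil)
  next
    fix \<beta> assume \<beta>: "\<beta> \<in> ?B"
    \<comment> \<open>Elements of the tensor product are functions on forms, so evaluation at
      \<beta> is the functional that \<beta> induces.\<close>
    let ?F = "\<lambda>t. if t \<in> carrier T then ?k t \<beta> else 0"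
    have "?k (s \<oplus>\<^bsub>T\<^esub> t) = (\<lambda>\<beta>. ?k s \<beta> + ?k t \<beta>)" if "s \<in> carrier T" "t \<in> carrier T" for s t
      using k\<phi>[OF add_in[of "?k s" "?k t"]] that by (simp add: k \<phi>_add)
    moreover have "?k (scl H c 1 \<odot>\<^bsub>T\<^esub> t) = (\<lambda>\<beta>. c * ?k t \<beta>)" if "t \<in> carrier T" for t c
      using k\<phi>[OF smult_in[of "?k t" c]] that by (simp add: k \<phi>_smult)
    ultimately have F: "?F \<in> full_dual H T" by (auto simp: dual_iff T.act_closed)
    have "?F (\<phi> (?p v w)) = \<beta> v w" if "v \<in> carrier V" "w \<in> carrier W" for v w
      using that \<beta> mod_homs_closed[OF \<phi> pure] by (simp add: k\<phi> pure) (simp add: pure_tensor_def)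
    then show "\<exists>F\<in>full_dual H T. \<forall>v\<in>carrier V. \<forall>w\<in>carrier W. F (\<phi> (?p v w)) = \<beta> v w"
      by (intro bexI[OF _ F] ballI)
  next
    fix F h v w assume F: "F \<in> full_dual H T" and v: "v \<in> carrier V" and w: "w \<in> carrier W"
    \<comment> \<open>With one fixed representation of \<Delta>(h), the translate of a pure tensor
      is the finite sum of a_k v \<otimes> b_k w, an element to which additivity of F and \<phi>
      applies.\<close>
    obtain n and a b :: "nat \<Rightarrow> 'h" where ab: "\<And>\<beta>. \<beta> \<in> H2 \<Longrightarrow> comult H h \<beta> = (\<Sum>k<n. \<beta> (a k) (b k))"
      by (rule comult_expand[of h]) blast
    have "h \<odot>\<^bsub>?M\<^esub> ?p v w = tensor_sum ?B n (\<lambda>i. a i \<odot>\<^bsub>V\<^esub> v) (\<lambda>i. b i \<odot>\<^bsub>W\<^esub> w)"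
    proof
      fix \<beta>
      show "(h \<odot>\<^bsub>?M\<^esub> ?p v w) \<beta> = tensor_sum ?B n (\<lambda>i. a i \<odot>\<^bsub>V\<^esub> v) (\<lambda>i. b i \<odot>\<^bsub>W\<^esub> w) \<beta>"
      proof (cases "\<beta> \<in> ?B")
        case True
        then show ?thesis
          using tensor_module_act_pure[OF assms(1,2) v w True] ab[OF bilinear_act[OF assms(1,2) True v w]]
          by (simp add: tensor_sum_def pure_tensor_def)
      qed (simp add: tensor_module_def Let_def tensor_sum_def pure_tensor_def)
    qed
    then have "h \<odot>\<^bsub>T\<^esub> \<phi> (?p v w) = \<phi> (tensor_sum ?B n (\<lambda>i. a i \<odot>\<^bsub>V\<^esub> v) (\<lambda>i. b i \<odot>\<^bsub>W\<^esub> w))"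
      using mod_homs_act[OF \<phi> pure[OF v w], of h] by simp
    moreover have "tensor_sum ?B m (\<lambda>i. a i \<odot>\<^bsub>V\<^esub> v) (\<lambda>i. b i \<odot>\<^bsub>W\<^esub> w) \<in> carrier ?M \<and>
        F (\<phi> (tensor_sum ?B m (\<lambda>i. a i \<odot>\<^bsub>V\<^esub> v) (\<lambda>i. b i \<odot>\<^bsub>W\<^esub> w))) =
        (\<Sum>i<m. F (\<phi> (?p (a i \<odot>\<^bsub>V\<^esub> v) (b i \<odot>\<^bsub>W\<^esub> w))))" for m
    proof (induction m)
      case 0
      then show ?case using zero_in by (simp add: tensor_sum_def \<phi>_zero dual_zero[OF T.left_module_axioms F])
    next
      case (Suc m)
      let ?t = "tensor_sum ?B m (\<lambda>i. a i \<odot>\<^bsub>V\<^esub> v) (\<lambda>i. b i \<odot>\<^bsub>W\<^esub> w)"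
      have "tensor_sum ?B (Suc m) (\<lambda>i. a i \<odot>\<^bsub>V\<^esub> v) (\<lambda>i. b i \<odot>\<^bsub>W\<^esub> w) =
          (\<lambda>\<beta>. ?t \<beta> + ?p (a m \<odot>\<^bsub>V\<^esub> v) (b m \<odot>\<^bsub>W\<^esub> w) \<beta>)" by (simp add: tensor_sum_def)
      then show ?case
        using Suc v w mod_homs_closed[OF \<phi>]
        by (simp add: add_in \<phi>_add pure V.act_closed W.act_closed dual_add[OF F])
    qed
    moreover have "(\<lambda>x y. F (\<phi> (?p (x \<odot>\<^bsub>V\<^esub> v) (y \<odot>\<^bsub>W\<^esub> w)))) \<in> H2"
      by (rule bilinear_act[OF assms(1,2) bil[OF F] v w])
    ultimately show "F (h \<odot>\<^bsub>T\<^esub> \<phi> (?p v w)) =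
        comult H h (\<lambda>x y. F (\<phi> (?p (x \<odot>\<^bsub>V\<^esub> v) (y \<odot>\<^bsub>W\<^esub> w))))"
      by (simp add: ab)
  qed
qed

text \<open>The functionals are the products f_i \<otimes> g_j. On a pure tensor the sum over j
  reproduces w, then the sum over i reproduces v; additivity does the rest.\<close>

lemma dual_system_tensor:
  assumes "left_module V" "left_module W" "left_module T" and tm: "tensor_map D V W T \<mu>"
    and V: "dual_system V I x f" and W: "dual_system W J y g"
  obtains F where "dual_system T (I \<times> J) (\<lambda>(i, j). \<mu> (x i) (y j)) F"
    "\<And>i j v w. i \<in> I \<Longrightarrow> j \<in> J \<Longrightarrow> v \<in> carrier V \<Longrightarrow> w \<in> carrier W \<Longrightarrow> F (i, j) (\<mu> v w) = f i v * g j w"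
proof -
  interpret T: left_module T by fact
  note D = dual_systemD[OF V] and D' = dual_systemD[OF W]
  have "\<forall>k\<in>I \<times> J. \<exists>F. F \<in> full_dual H T \<and>
      (\<forall>v\<in>carrier V. \<forall>w\<in>carrier W. F (\<mu> v w) = f (fst k) v * g (snd k) w)"
    using D(3) D'(3) tensor_map_factor[OF tm bilinear_forms_prod] by (metis mem_Times_iff)
  then obtain F where "\<forall>k\<in>I \<times> J. F k \<in> full_dual H T \<and>
      (\<forall>v\<in>carrier V. \<forall>w\<in>carrier W. F k (\<mu> v w) = f (fst k) v * g (snd k) w)"
    by (rule bchoice[elim_format]) blast
  then have F: "\<And>i j. i \<in> I \<Longrightarrow> j \<in> J \<Longrightarrow> F (i, j) \<in> full_dual H T"
    "\<And>i j v w. i \<in> I \<Longrightarrow> j \<in> J \<Longrightarrow> v \<in> carrier V \<Longrightarrow> w \<in> carrier W \<Longrightarrow> F (i, j) (\<mu> v w) = f i v * g j w"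
    by auto
  have "(\<Sum>k\<in>I \<times> J. F k t * L (case k of (i, j) \<Rightarrow> \<mu> (x i) (y j))) = L t"
    if "t \<in> carrier T" and L: "L \<in> full_dual H T" for t L
    using tm T.left_module_axioms that(1)
  proof (induction rule: tensor_map_induct)
    case zero
    then show ?case using dual_zero[OF T.left_module_axioms L] dual_zero[OF T.left_module_axioms F(1)]
      by (auto intro!: sum.neutral)
  next
    case (gen v w)
    have 1: "(\<Sum>i\<in>I. f i v * L (\<mu> (x i) w)) = L (\<mu> v w)" if "w \<in> carrier W" for w
      using D(4)[OF gen(1) tensor_map_form_left[OF tm assms(1) L that]] D(2) gen by simp
    have 2: "(\<Sum>j\<in>J. g j w * L (\<mu> v (y j))) = L (\<mu> v w)" if "v \<in> carrier V" for v
      using D'(4)[OF gen(2) tensor_map_form_right[OF tm assms(2) L that]] D'(2) gen by simp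
    have "(\<Sum>k\<in>I \<times> J. F k (\<mu> v w) * L (case k of (i, j) \<Rightarrow> \<mu> (x i) (y j))) =
        (\<Sum>i\<in>I. \<Sum>j\<in>J. f i v * (g j w * L (\<mu> (x i) (y j))))"
      unfolding sum.cartesian_product using gen F(2) by (intro sum.cong refl) auto
    also have "\<dots> = (\<Sum>i\<in>I. f i v * L (\<mu> (x i) w))"
      using 2 D(2) by (simp flip: sum_distrib_left)
    finally show ?case using 1 gen by simp
  next
    case (add s t)
    have "(\<Sum>k\<in>I \<times> J. F k (s \<oplus>\<^bsub>T\<^esub> t) * L (case k of (i, j) \<Rightarrow> \<mu> (x i) (y j))) =
        (\<Sum>k\<in>I \<times> J. F k s * L (case k of (i, j) \<Rightarrow> \<mu> (x i) (y j)) + F k t * L (case k of (i, j) \<Rightarrow> \<mu> (x i) (y j)))"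
      using add.hyps F(1) by (intro sum.cong refl) (auto simp: dual_add distrib_right)
    then show ?case using add by (simp add: sum.distrib dual_add[OF L])
  qed
  then have "dual_system T (I \<times> J) (\<lambda>(i, j). \<mu> (x i) (y j)) F"
    using D D' F(1) tensor_map_closed[OF tm] by (auto simp: dual_system_def)
  then show ?thesis using F(2) by (rule that)
qed

lemma char_elt_tensor:
  assumes "separated V" "separated W" "separated T" and tm: "tensor_map (comult H) V W T \<mu>"
    and V: "dual_system V I x f" and W: "dual_system W J y g"
  shows "char_elt H V \<star> char_elt H W = char_elt H T"
proof -
  interpret V: left_module V using assms(1) by (rule separated_module)
  interpret W: left_module W using assms(2) by (rule separated_module)
  interpret T: left_module T using assms(3) by (rule separated_module)
  note D = dual_systemD[OF V] and D' = dual_systemD[OF W]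
  obtain F where F: "dual_system T (I \<times> J) (\<lambda>(i, j). \<mu> (x i) (y j)) F"
    "\<And>i j v w. i \<in> I \<Longrightarrow> j \<in> J \<Longrightarrow> v \<in> carrier V \<Longrightarrow> w \<in> carrier W \<Longrightarrow> F (i, j) (\<mu> v w) = f i v * g j w"
    by (rule dual_system_tensor[OF V.left_module_axioms W.left_module_axioms T.left_module_axioms tm V W]) blast
  have "(\<Sum>k\<in>I \<times> J. F k (h \<odot>\<^bsub>T\<^esub> (case k of (i, j) \<Rightarrow> \<mu> (x i) (y j)))) =
      (\<Sum>i\<in>I. \<Sum>j\<in>J. comult H h (\<lambda>a b. f i (a \<odot>\<^bsub>V\<^esub> x i) * g j (b \<odot>\<^bsub>W\<^esub> y j)))" for h
    unfolding sum.cartesian_product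
    using D D' F(2) tensor_map_act[OF tm dual_system_dual[OF F(1)]]
    by (intro sum.cong refl) (auto simp: V.act_closed W.act_closed)
  then have "char_elt H T = (\<lambda>h. \<Sum>i\<in>I. \<Sum>j\<in>J. comult H h (\<lambda>a b. f i (a \<odot>\<^bsub>V\<^esub> x i) * g j (b \<odot>\<^bsub>W\<^esub> y j)))"
    by (simp add: char_elt_eq[OF assms(3) F(1)])
  also have "\<dots> = char_elt H V \<star> char_elt H W"
    using D D' coeff_form[OF V.left_module_axioms] coeff_form[OF W.left_module_axioms]
    by (simp add: char_elt_eq[OF assms(1) V] char_elt_eq[OF assms(2) W] dual_algebra_sum_sum)
      (simp add: dual_algebra_mult)
  finally show ?thesis by simp
qed

section \<open>Associativity of the tensor product\<close>

lemma tensor_map_gen3: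
  assumes "left_module A" "separated B" "tensor_map D U V A \<alpha>" "tensor_map D A W B \<beta>"
  shows "add_gen B ((\<lambda>(u, v, w). \<beta> (\<alpha> u v) w) ` (carrier U \<times> carrier V \<times> carrier W))"
  unfolding add_gen_def
proof (intro conjI allI impI)
  note cl = tensor_map_closed[OF assms(3)] tensor_map_closed[OF assms(4)]
  show "(\<lambda>(u, v, w). \<beta> (\<alpha> u v) w) ` (carrier U \<times> carrier V \<times> carrier W) \<subseteq> carrier B"
    using cl by auto
  fix S assume S: "S \<subseteq> carrier B" "\<zero>\<^bsub>B\<^esub> \<in> S"
    "(\<lambda>(u, v, w). \<beta> (\<alpha> u v) w) ` (carrier U \<times> carrier V \<times> carrier W) \<subseteq> S"
    "\<forall>x\<in>S. \<forall>y\<in>S. x \<oplus>\<^bsub>B\<^esub> y \<in> S"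
  have \<beta>: "\<beta> a w \<in> S" if "a \<in> carrier A" and w: "w \<in> carrier W" for a w
    using assms(3,1) that(1)
  proof (induction rule: tensor_map_induct)
    case zero
    show ?case using tensor_map_zero_left[OF assms(4,1,2) w] S(2) by simp
  next
    case (gen u v)
    then show ?case using S(3) w by force
  next
    case (add s t)
    then show ?case using tensor_map_add_left[OF assms(4,1,2) _ _ w] S(4) by simp
  qed
  have "t \<in> S" if "t \<in> carrier B" for t
    using assms(4) separated_module[OF assms(2)] that
    by (induction rule: tensor_map_induct) (use S(2,4) \<beta> in auto)
  then show "S = carrier B" using S(1) by blast
qed

text \<open>Stated for an arbitrary functional so that the co-opposite comultiplication is covered
  too.\<close>

definition coassoc :: "('h \<Rightarrow> ('h \<Rightarrow> 'h \<Rightarrow> 'k) \<Rightarrow> 'k) \<Rightarrow> bool" where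
  "coassoc D \<longleftrightarrow> (\<forall>h. \<forall>t\<in>H3_forms H.
     D h (\<lambda>x z. D x (\<lambda>a b. t a b z)) = D h (\<lambda>x y. D y (\<lambda>b c. t x b c)))"

lemma coassoc_comult: "coassoc (comult H)"
  using comult_coassoc by (simp add: coassoc_def)

text \<open>Reversing the three arguments of the trilinear form exchanges the two sides.\<close>

lemma coassoc_flip:
  assumes "coassoc D" shows "coassoc (flip D)"
  unfolding coassoc_def
proof (intro allI ballI)
  fix h t assume "t \<in> H3_forms H"
  then have "(\<lambda>c b a. t a b c) \<in> H3_forms H" by (simp add: H3_iff)
  then show "flip D h (\<lambda>x z. flip D x (\<lambda>a b. t a b z)) = flip D h (\<lambda>x y. flip D y (\<lambda>b c. t x b c))"
    using assms by (simp add: flip_def coassoc_def)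
qed

text \<open>A functional on U \<otimes> (V \<otimes> W) gives a trilinear form, which factors first
  through U \<otimes> V for fixed w and then through (U \<otimes> V) \<otimes> W. The two actions
  agree on triple tensors by coassociativity.\<close>

lemma tensor_assoc_hom:
  assumes "left_module U" "left_module V" "left_module W"
    and "left_module A" "left_module A'" "separated B" "separated B'"
    and \<alpha>: "tensor_map D U V A \<alpha>" and \<beta>: "tensor_map D A W B \<beta>"
    and \<alpha>': "tensor_map D V W A' \<alpha>'" and \<beta>': "tensor_map D U A' B' \<beta>'"
    and coassoc: "coassoc D"
  shows "\<exists>\<theta>\<in>mod_homs B B'. \<forall>u\<in>carrier U. \<forall>v\<in>carrier V. \<forall>w\<in>carrier W. \<theta> (\<beta> (\<alpha> u v) w) = \<beta>' u (\<alpha>' v w)"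
proof -
  interpret U: left_module U by fact
  interpret V: left_module V by fact
  interpret W: left_module W by fact
  interpret A: left_module A by fact
  interpret A': left_module A' by fact
  interpret B: left_module B using assms(6) by (rule separated_module)
  note cl = tensor_map_closed[OF \<alpha>] tensor_map_closed[OF \<beta>] tensor_map_closed[OF \<alpha>'] tensor_map_closed[OF \<beta>']
    U.act_closed V.act_closed W.act_closed A.act_closed A'.act_closed
  have ext: "\<exists>F'\<in>full_dual H B. \<forall>x\<in>carrier U \<times> carrier V \<times> carrier W.
      F' ((\<lambda>(u, v, w). \<beta> (\<alpha> u v) w) x) = F ((\<lambda>(u, v, w). \<beta>' u (\<alpha>' v w)) x) \<and>
      (\<forall>h. F' (h \<odot>\<^bsub>B\<^esub> (\<lambda>(u, v, w). \<beta> (\<alpha> u v) w) x) = F (h \<odot>\<^bsub>B'\<^esub> (\<lambda>(u, v, w). \<beta>' u (\<alpha>' v w)) x))"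
    if F: "F \<in> full_dual H B'" for F
  proof -
    \<comment> \<open>The trilinear form of F; its linearity in each variable is proved by fixing
      the other two and using the functionals \<open>f1\<close>, \<open>f2\<close>,
      \<open>f3\<close>.\<close>
    define t where "t = (\<lambda>u v w. F (\<beta>' u (\<alpha>' v w)))"
    have f1: "(\<lambda>u. if u \<in> carrier U then t u v w else 0) \<in> full_dual H U"
      if "v \<in> carrier V" "w \<in> carrier W" for v w
      unfolding t_def using tensor_map_form_left[OF \<beta>' U.left_module_axioms F cl(3)[OF that]] .
    have FA': "(\<lambda>x. if x \<in> carrier A' then F (\<beta>' u x) else 0) \<in> full_dual H A'" if "u \<in> carrier U" for u
      by (rule tensor_map_form_right[OF \<beta>' A'.left_module_axioms F that])
    have f2: "(\<lambda>v. if v \<in> carrier V then t u v w else 0) \<in> full_dual H V"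
      if "u \<in> carrier U" "w \<in> carrier W" for u w
      using tensor_map_form_left[OF \<alpha>' V.left_module_axioms FA'[OF that(1)] that(2)] cl(3) that
      by (simp add: t_def cong: if_cong)
    have f3: "(\<lambda>w. if w \<in> carrier W then t u v w else 0) \<in> full_dual H W"
      if "u \<in> carrier U" "v \<in> carrier V" for u v
      using tensor_map_form_right[OF \<alpha>' W.left_module_axioms FA'[OF that(1)] that(2)] cl(3) that
      by (simp add: t_def cong: if_cong)
    have tri: "t (u \<oplus>\<^bsub>U\<^esub> u') v w = t u v w + t u' v w" "t (scl H c 1 \<odot>\<^bsub>U\<^esub> u) v w = c * t u v w"
      "t u (v \<oplus>\<^bsub>V\<^esub> v') w = t u v w + t u v' w" "t u (scl H c 1 \<odot>\<^bsub>V\<^esub> v) w = c * t u v w"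
      "t u v (w \<oplus>\<^bsub>W\<^esub> w') = t u v w + t u v w'" "t u v (scl H c 1 \<odot>\<^bsub>W\<^esub> w) = c * t u v w"
      if "u \<in> carrier U" "u' \<in> carrier U" "v \<in> carrier V" "v' \<in> carrier V" "w \<in> carrier W" "w' \<in> carrier W"
      for u u' v v' w w' c
      using that dual_add[OF f1[of v w], of u u'] dual_smult[OF f1[of v w], of u c]
        dual_add[OF f2[of u w], of v v'] dual_smult[OF f2[of u w], of v c]
        dual_add[OF f3[of u v], of w w'] dual_smult[OF f3[of u v], of w c]
      by (simp_all add: cl)
    have "\<forall>w\<in>carrier W. \<exists>L. L \<in> full_dual H A \<and> (\<forall>u\<in>carrier U. \<forall>v\<in>carrier V. L (\<alpha> u v) = t u v w)"
    proof
      fix w assume w: "w \<in> carrier W"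
      have "(\<lambda>u v. t u v w) \<in> bilinear_forms (vec H U) (vec H V)"
        by (rule bilinear_vecI) (use w tri in auto)
      then show "\<exists>L. L \<in> full_dual H A \<and> (\<forall>u\<in>carrier U. \<forall>v\<in>carrier V. L (\<alpha> u v) = t u v w)"
        by (rule tensor_map_factor[OF \<alpha>]) blast
    qed
    then obtain L where "\<forall>w\<in>carrier W. L w \<in> full_dual H A \<and> (\<forall>u\<in>carrier U. \<forall>v\<in>carrier V. L w (\<alpha> u v) = t u v w)"
      by (rule bchoice[elim_format]) blast
    then have L: "\<And>w. w \<in> carrier W \<Longrightarrow> L w \<in> full_dual H A"
      "\<And>u v w. u \<in> carrier U \<Longrightarrow> v \<in> carrier V \<Longrightarrow> w \<in> carrier W \<Longrightarrow> L w (\<alpha> u v) = t u v w" by blast+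
    \<comment> \<open>\<open>L w\<close> was chosen separately for each w and is prescribed only on
      tensors \<alpha> u v, so linearity in w is verified on these generators of A.\<close>
    have L_add: "L (w \<oplus>\<^bsub>W\<^esub> w') a = L w a + L w' a"
      if "a \<in> carrier A" and w: "w \<in> carrier W" "w' \<in> carrier W" for a w w'
      using \<alpha> A.left_module_axioms that(1)
    proof (induction rule: tensor_map_induct)
      case zero
      show ?case using w by (simp add: dual_zero[OF A.left_module_axioms L(1)])
    next
      case (add s t)
      then show ?case using w by (simp add: dual_add[OF L(1)])
    qed (use w in \<open>simp add: L(2) tri\<close>)
    have L_smult: "L (scl H c 1 \<odot>\<^bsub>W\<^esub> w) a = c * L w a"
      if "a \<in> carrier A" and w: "w \<in> carrier W" for a w c
      using \<alpha> A.left_module_axioms that(1)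
    proof (induction rule: tensor_map_induct)
      case zero
      show ?case using w by (simp add: dual_zero[OF A.left_module_axioms L(1)] cl)
    next
      case (add s t)
      then show ?case using w by (simp add: dual_add[OF L(1)] cl distrib_left)
    qed (use w in \<open>simp add: L(2) tri cl\<close>)
    have "(\<lambda>a w. L w a) \<in> bilinear_forms (vec H A) (vec H W)"
      by (rule bilinear_vecI) (simp_all add: dual_add[OF L(1)] dual_smult[OF L(1)] L_add L_smult)
    then obtain F' where F': "F' \<in> full_dual H B"
      "\<And>a w. a \<in> carrier A \<Longrightarrow> w \<in> carrier W \<Longrightarrow> F' (\<beta> a w) = L w a"
      by (rule tensor_map_factor[OF \<beta>]) blast
    have "F' (h \<odot>\<^bsub>B\<^esub> \<beta> (\<alpha> u v) w) = F (h \<odot>\<^bsub>B'\<^esub> \<beta>' u (\<alpha>' v w))"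
      if u: "u \<in> carrier U" and v: "v \<in> carrier V" and w: "w \<in> carrier W" for h u v w
    proof -
      \<comment> \<open>The coefficient of the triple action is trilinear in H, the situation in
        which coassociativity may be invoked.\<close>
      have H3: "(\<lambda>a b c. t (a \<odot>\<^bsub>U\<^esub> u) (b \<odot>\<^bsub>V\<^esub> v) (c \<odot>\<^bsub>W\<^esub> w)) \<in> H3_forms H"
        using coeff_form[OF U.left_module_axioms f1 u] coeff_form[OF V.left_module_axioms f2 v]
          coeff_form[OF W.left_module_axioms f3 w] u v w
        by (simp add: H3_iff cl)
      have eq: "D h (\<lambda>x z. D x (\<lambda>a b. t (a \<odot>\<^bsub>U\<^esub> u) (b \<odot>\<^bsub>V\<^esub> v) (z \<odot>\<^bsub>W\<^esub> w))) =
          D h (\<lambda>x y. D y (\<lambda>b c. t (x \<odot>\<^bsub>U\<^esub> u) (b \<odot>\<^bsub>V\<^esub> v) (c \<odot>\<^bsub>W\<^esub> w)))"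
        by (rule bspec[OF spec[OF coassoc[unfolded coassoc_def]] H3])
      have "L (z \<odot>\<^bsub>W\<^esub> w) (x \<odot>\<^bsub>A\<^esub> \<alpha> u v) = D x (\<lambda>a b. t (a \<odot>\<^bsub>U\<^esub> u) (b \<odot>\<^bsub>V\<^esub> v) (z \<odot>\<^bsub>W\<^esub> w))" for x z
        using tensor_map_act[OF \<alpha> L(1) u v, of "z \<odot>\<^bsub>W\<^esub> w" x] u v w by (simp add: cl L(2))
      then have 1: "F' (h \<odot>\<^bsub>B\<^esub> \<beta> (\<alpha> u v) w) = D h (\<lambda>x z. D x (\<lambda>a b. t (a \<odot>\<^bsub>U\<^esub> u) (b \<odot>\<^bsub>V\<^esub> v) (z \<odot>\<^bsub>W\<^esub> w)))"
        using tensor_map_act[OF \<beta> F'(1), of "\<alpha> u v" w h] u v w by (simp add: cl F'(2))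
      have "F (\<beta>' (x \<odot>\<^bsub>U\<^esub> u) (y \<odot>\<^bsub>A'\<^esub> \<alpha>' v w)) = D y (\<lambda>b c. t (x \<odot>\<^bsub>U\<^esub> u) (b \<odot>\<^bsub>V\<^esub> v) (c \<odot>\<^bsub>W\<^esub> w))" for x y
        using tensor_map_act[OF \<alpha>' FA' v w, of "x \<odot>\<^bsub>U\<^esub> u" y] u v w by (simp add: cl t_def)
      then have 2: "F (h \<odot>\<^bsub>B'\<^esub> \<beta>' u (\<alpha>' v w)) = D h (\<lambda>x y. D y (\<lambda>b c. t (x \<odot>\<^bsub>U\<^esub> u) (b \<odot>\<^bsub>V\<^esub> v) (c \<odot>\<^bsub>W\<^esub> w)))"
        using tensor_map_act[OF \<beta>' F, of u "\<alpha>' v w" h] u v w by (simp add: cl)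
      show ?thesis unfolding 1 2 by (rule eq)
    qed
    then show ?thesis using F' by (intro bexI[of _ F']) (auto simp: cl L(2) t_def)
  qed
  have closed: "(\<lambda>(u, v, w). \<beta>' u (\<alpha>' v w)) x \<in> carrier B'" if "x \<in> carrier U \<times> carrier V \<times> carrier W" for x
    using that by (auto simp: cl)
  show ?thesis
    using hom_from_generators[OF B.left_module_axioms assms(7) tensor_map_gen3[OF assms(4,6) \<alpha> \<beta>] closed ext]
    by simp
qed

text \<open>The inverse is the same homomorphism for the flipped products: reading U, V, W backwards
  turns the right bracketing into a left one. Both composites fix the triple tensors and hence
  everything.\<close>

lemma tensor_assoc:
  assumes "left_module U" "left_module V" "left_module W"
    and "left_module A" "left_module A'" "separated B" "separated B'"
    and \<alpha>: "tensor_map D U V A \<alpha>" and \<beta>: "tensor_map D A W B \<beta>"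
    and \<alpha>': "tensor_map D V W A' \<alpha>'" and \<beta>': "tensor_map D U A' B' \<beta>'"
    and coassoc: "coassoc D"
  shows "mod_isomorphic B B'"
proof -
  note B = separated_module[OF assms(6)] and B' = separated_module[OF assms(7)]
  note fl = tensor_map_flip[OF \<alpha>] tensor_map_flip[OF \<beta>] tensor_map_flip[OF \<alpha>'] tensor_map_flip[OF \<beta>']
  obtain \<theta> where \<theta>: "\<theta> \<in> mod_homs B B'"
    "\<And>u v w. u \<in> carrier U \<Longrightarrow> v \<in> carrier V \<Longrightarrow> w \<in> carrier W \<Longrightarrow> \<theta> (\<beta> (\<alpha> u v) w) = \<beta>' u (\<alpha>' v w)"
    using tensor_assoc_hom[OF assms] by blast
  obtain \<theta>' where \<theta>': "\<theta>' \<in> mod_homs B' B"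
    "\<And>u v w. u \<in> carrier U \<Longrightarrow> v \<in> carrier V \<Longrightarrow> w \<in> carrier W \<Longrightarrow> \<theta>' (\<beta>' u (\<alpha>' v w)) = \<beta> (\<alpha> u v) w"
    using tensor_assoc_hom[OF assms(3,2,1,5,4,7,6) fl(3,4,1,2) coassoc_flip[OF coassoc]] by blast
  have id: "(\<lambda>x. x) \<in> mod_homs M M" for M :: "('h, 'z) module" by (simp add: mod_homs_def)
  show ?thesis
  proof (rule mod_isomorphicI[OF \<theta>(1) \<theta>'(1)])
    show "\<theta>' (\<theta> x) = x" if "x \<in> carrier B" for x
      by (rule mod_homs_eq_on_generators[OF B B tensor_map_gen3[OF assms(4,6) \<alpha> \<beta>]
            mod_homs_comp[OF \<theta>(1) \<theta>'(1)] id _ that]) (auto simp: \<theta> \<theta>')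
    show "\<theta> (\<theta>' x) = x" if "x \<in> carrier B'" for x
      by (rule mod_homs_eq_on_generators[OF B' B' tensor_map_gen3[OF assms(5,7) fl(3,4)]
            mod_homs_comp[OF \<theta>'(1) \<theta>(1)] id _ that]) (auto simp: \<theta> \<theta>')
  qed
qed

text \<open>Describes a unit object by a basis vector u, the image of 1, and its coordinate
  functional l, so that the isomorphism itself can be forgotten.\<close>

lemma trivial_module_iso:
  assumes "left_module U" "\<phi> \<in> mod_isos (trivial_module H) U"
  obtains u l where "u \<in> carrier U" "l \<in> full_dual H U" "l u = 1"
    "\<And>h. h \<odot>\<^bsub>U\<^esub> u = scl H (\<epsilon> h) 1 \<odot>\<^bsub>U\<^esub> u"
    "\<And>y. y \<in> carrier U \<Longrightarrow> y = scl H (l y) 1 \<odot>\<^bsub>U\<^esub> u"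
proof -
  interpret left_module U by fact
  have bij: "bij_betw \<phi> UNIV (carrier U)" and \<phi>: "\<phi> \<in> mod_homs (trivial_module H) U"
    using assms(2) by (auto simp: mod_isos_def trivial_module_def)
  have closed: "\<phi> c \<in> carrier U" for c using bij by (auto simp: bij_betw_def)
  have act: "h \<odot>\<^bsub>U\<^esub> \<phi> c = \<phi> (\<epsilon> h * c)" for h c
    using mod_homs_act[OF \<phi>, of c h] by (simp add: trivial_module_def)
  have add: "\<phi> (c + d) = \<phi> c \<oplus>\<^bsub>U\<^esub> \<phi> d" for c d
    using mod_homs_add[OF \<phi>, of c d] by (simp add: trivial_module_def)
  let ?l = "\<lambda>y. if y \<in> carrier U then inv_into UNIV \<phi> y else 0"
  have inv: "inv_into UNIV \<phi> (\<phi> c) = c" for c using bij by (simp add: bij_betw_def)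
  have surj: "\<exists>c. y = \<phi> c" if "y \<in> carrier U" for y using bij that by (auto simp: bij_betw_def)
  show ?thesis
  proof (rule that)
    show "\<phi> 1 \<in> carrier U" by (rule closed)
    show "?l \<in> full_dual H U"
      unfolding dual_iff
    proof (intro conjI ballI allI impI)
      fix x y assume "x \<in> carrier U" "y \<in> carrier U"
      then obtain c d where "x = \<phi> c" "y = \<phi> d" using surj by blast
      then show "?l (x \<oplus>\<^bsub>U\<^esub> y) = ?l x + ?l y" by (simp add: closed inv flip: add)
    next
      fix c x assume "x \<in> carrier U"
      then obtain d where "x = \<phi> d" using surj by blast
      then show "?l (scl H c 1 \<odot>\<^bsub>U\<^esub> x) = c * ?l x" by (simp add: closed inv act counit_scl counit_1)
    qed simp
    show "?l (\<phi> 1) = 1" by (simp add: closed inv)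
    show "h \<odot>\<^bsub>U\<^esub> \<phi> 1 = scl H (\<epsilon> h) 1 \<odot>\<^bsub>U\<^esub> \<phi> 1" for h by (simp add: act counit_scl counit_1)
    show "y = scl H (?l y) 1 \<odot>\<^bsub>U\<^esub> \<phi> 1" if y: "y \<in> carrier U" for y
      using surj[OF y] by (auto simp: act counit_scl counit_1 closed inv)
  qed
qed

text \<open>The map sends v to u \<otimes> v. The counit axiom makes it H-linear, the functionals l
  \<otimes> f make it injective, and moving the scalar l(y) across y \<otimes> v makes it
  surjective. The counit axiom is assumed for D, so the flip gives the unit on the other
  side.\<close>

lemma tensor_unit:
  assumes "left_module U" "\<phi> \<in> mod_isos (trivial_module H) U" "separated V" "separated T"
    and tm: "tensor_map D U V T \<mu>"
    and counit: "\<And>h \<xi>. \<xi> \<in> Hdual \<Longrightarrow> D h (\<lambda>a b. \<epsilon> a * \<xi> b) = \<xi> h"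
  shows "mod_isomorphic V T"
proof -
  interpret U: left_module U by fact
  interpret V: left_module V using assms(3) by (rule separated_module)
  interpret T: left_module T using assms(4) by (rule separated_module)
  obtain u l where u: "u \<in> carrier U" and l: "l \<in> full_dual H U" "l u = 1"
    and act: "\<And>h. h \<odot>\<^bsub>U\<^esub> u = scl H (\<epsilon> h) 1 \<odot>\<^bsub>U\<^esub> u"
    and span: "\<And>y. y \<in> carrier U \<Longrightarrow> y = scl H (l y) 1 \<odot>\<^bsub>U\<^esub> u"
    by (rule trivial_module_iso[OF assms(1,2)]) blast
  note cl = tensor_map_closed[OF tm]
  have add: "\<mu> u (v \<oplus>\<^bsub>V\<^esub> v') = \<mu> u v \<oplus>\<^bsub>T\<^esub> \<mu> u v'" if "v \<in> carrier V" "v' \<in> carrier V" for v v'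
    by (rule tensor_map_add_left[OF tensor_map_flip[OF tm] V.left_module_axioms assms(4) that u])
  have hom: "\<mu> u \<in> mod_homs V T"
    unfolding mod_homs_def
  proof (intro CollectI conjI ballI allI)
    fix h v assume v: "v \<in> carrier V"
    show "\<mu> u (h \<odot>\<^bsub>V\<^esub> v) = h \<odot>\<^bsub>T\<^esub> \<mu> u v"
    proof (rule separated_eqI[OF assms(4)])
      fix F assume F: "F \<in> full_dual H T"
      have f: "(\<lambda>w. if w \<in> carrier V then F (\<mu> u w) else 0) \<in> full_dual H V"
        by (rule tensor_map_form_right[OF tm V.left_module_axioms F u])
      have "F (\<mu> (a \<odot>\<^bsub>U\<^esub> u) (b \<odot>\<^bsub>V\<^esub> v)) = \<epsilon> a * F (\<mu> u (b \<odot>\<^bsub>V\<^esub> v))" for a b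
        using tensor_map_bilinear[OF tm F] u v by (subst act) (simp add: bilinear_forms_def V.act_closed)
      then have "F (h \<odot>\<^bsub>T\<^esub> \<mu> u v) = D h (\<lambda>a b. \<epsilon> a * F (\<mu> u (b \<odot>\<^bsub>V\<^esub> v)))"
        using tensor_map_act[OF tm F u v, of h] by simp
      also have "\<dots> = F (\<mu> u (h \<odot>\<^bsub>V\<^esub> v))"
        using coeff_form[OF V.left_module_axioms f v] v by (intro counit) (simp add: V.act_closed)
      finally show "F (\<mu> u (h \<odot>\<^bsub>V\<^esub> v)) = F (h \<odot>\<^bsub>T\<^esub> \<mu> u v)" by simp
    qed (use v u in \<open>auto simp: cl V.act_closed T.act_closed\<close>)
  qed (use u add in \<open>auto simp: cl\<close>)
  have "inj_on (\<mu> u) (carrier V)"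
  proof (rule inj_onI)
    fix v v' assume v: "v \<in> carrier V" "v' \<in> carrier V" "\<mu> u v = \<mu> u v'"
    show "v = v'"
    proof (rule separated_eqI[OF assms(3) v(1,2)])
      fix f assume f: "f \<in> full_dual H V"
      obtain F where "F \<in> full_dual H T" "\<And>x w. x \<in> carrier U \<Longrightarrow> w \<in> carrier V \<Longrightarrow> F (\<mu> x w) = l x * f w"
        by (rule tensor_map_factor[OF tm bilinear_forms_prod[OF l(1) f]]) blast
      then show "f v = f v'" using u v l(2) by (metis mult_1)
    qed
  qed
  moreover have "t \<in> \<mu> u ` carrier V" if "t \<in> carrier T" for t
    using tm T.left_module_axioms that
  proof (induction rule: tensor_map_induct)
    case zero
    show ?case
      using mod_homs_zero[OF V.left_module_axioms T.left_module_axioms hom]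
      by (intro image_eqI[of _ _ "\<zero>\<^bsub>V\<^esub>"]) simp_all
  next
    case (gen y v)
    have "\<mu> y v = \<mu> (scl H (l y) 1 \<odot>\<^bsub>U\<^esub> u) v" using span[OF gen(1)] by simp
    also have "\<dots> = \<mu> u (scl H (l y) 1 \<odot>\<^bsub>V\<^esub> v)"
      by (rule tensor_map_smult[OF tm U.left_module_axioms V.left_module_axioms assms(4) u gen(2)])
    finally show ?case using gen(2) V.act_closed by blast
  next
    case (add s t)
    then obtain v v' where "v \<in> carrier V" "v' \<in> carrier V" "s = \<mu> u v" "t = \<mu> u v'" by blast
    then show ?case using mod_homs_add[OF hom] by (intro image_eqI[of _ _ "v \<oplus>\<^bsub>V\<^esub> v'"]) simp_all
  qed
  ultimately have "bij_betw (\<mu> u) (carrier V) (carrier T)"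
    using cl[OF u] by (auto simp: bij_betw_def)
  then show ?thesis using hom by (auto simp: mod_isomorphic_def mod_isos_def)
qed

text \<open>The basis vector and its coordinate functional form a dual system with one member, on
  which h acts by \<epsilon>(h).\<close>

lemma char_elt_trivial:
  assumes "separated U" "\<phi> \<in> mod_isos (trivial_module H) U"
  shows "char_elt H U = \<epsilon>"
proof -
  interpret U: left_module U using assms(1) by (rule separated_module)
  obtain u l where u: "u \<in> carrier U" and l: "l \<in> full_dual H U" "l u = 1"
    and act: "\<And>h. h \<odot>\<^bsub>U\<^esub> u = scl H (\<epsilon> h) 1 \<odot>\<^bsub>U\<^esub> u"
    and span: "\<And>y. y \<in> carrier U \<Longrightarrow> y = scl H (l y) 1 \<odot>\<^bsub>U\<^esub> u"
    by (rule trivial_module_iso[OF U.left_module_axioms assms(2)]) blast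
  have "l y * F u = F y" if "y \<in> carrier U" "F \<in> full_dual H U" for y F
    using span[OF that(1)] dual_smult[OF that(2) u] by metis
  then have "dual_system U {()} (\<lambda>_. u) (\<lambda>_. l)" using u l by (simp add: dual_system_def)
  moreover have "l (h \<odot>\<^bsub>U\<^esub> u) = \<epsilon> h" for h
    by (subst act) (simp add: dual_smult[OF l(1) u] l(2))
  ultimately show ?thesis by (simp add: char_elt_eq[OF assms(1)])
qed

end

section \<open>Matrix coefficients\<close>

lemma mod_isomorphic_sym:
  assumes "left_module V" "left_module W" "mod_isomorphic V W"
  shows "mod_isomorphic W V"
  using mod_isos_inv[OF assms(1,2)] assms(3) unfolding mod_isomorphic_def by blast

locale tensor_category = bialgebra_over H
  for H :: "('k::field, 'h::ring_1) bialg" +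
  fixes C :: "('h, 'v) module set"
    and star :: "('h, 'v) module \<Rightarrow> ('v \<Rightarrow> 'k) set"
  assumes abelian: "full_abelian_subcategory C"
    and submodules: "closed_under_submodules C"
    and tensor: "tensor_subcategory H C"
    and duality: "finite_duality H C star"
    and compatible: "star_tensor_compatible H C star"
begin

section \<open>Consequences of the duality functor\<close>

lemma left_module_C: "V \<in> C \<Longrightarrow> left_module V"
  using abelian by (simp add: full_abelian_subcategory_def)

lemma star_submodule: "V \<in> C \<Longrightarrow> is_submodule (star V) (dual_module V (full_dual H V))"
  using duality by (simp add: finite_duality_def)

lemma star_dual:
  assumes "V \<in> C" "f \<in> star V" shows "f \<in> full_dual H V"
  using subgroup.subset[of "star V" "add_monoid (dual_module V (full_dual H V))"] star_submodule[OF assms(1)]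
    assms(2) by (auto simp: is_submodule_def dual_module_def)

lemma star_act: "V \<in> C \<Longrightarrow> f \<in> star V \<Longrightarrow> transp V (\<lambda>x. h \<odot>\<^bsub>V\<^esub> x) f \<in> star V"
  using star_submodule[of V] by (simp add: is_submodule_def dual_module_def)

text \<open>\<open>star V\<close> is given as a submodule, so its scalars come from the action of
  the elements c 1.\<close>

lemma star_cmul:
  assumes "V \<in> C" "f \<in> star V" shows "(\<lambda>x. c * f x) \<in> star V"
proof -
  have "(\<lambda>x. c * f x) = transp V (\<lambda>x. scl H c 1 \<odot>\<^bsub>V\<^esub> x) f"
    using star_dual[OF assms] by (auto simp: transp_def dual_iff)
  then show ?thesis using star_act[OF assms] by simp
qed

lemma star_separates:
  "V \<in> C \<Longrightarrow> x \<in> carrier V \<Longrightarrow> (\<And>f. f \<in> star V \<Longrightarrow> f x = 0) \<Longrightarrow> x = \<zero>\<^bsub>V\<^esub>"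
  using duality by (simp add: finite_duality_def)

text \<open>Non-degeneracy of the pairing already separates points by members of
  \<open>star V\<close>, which lie in the full dual.\<close>

lemma separated_C: "V \<in> C \<Longrightarrow> separated V"
  using left_module_C star_dual star_separates unfolding separated_def by blast

lemma tensor_exists:
  assumes "V \<in> C" "W \<in> C" obtains T where "T \<in> C" "mod_isomorphic (tensor_module H V W) T"
  using tensor assms unfolding tensor_subcategory_def ess_mem_def by blast

lemma tensor_map_exists:
  assumes "V \<in> C" "W \<in> C" "T \<in> C" "mod_isomorphic (tensor_module H V W) T"
  obtains \<mu> where "tensor_map (comult H) V W T \<mu>"
  using tensor_map_of_iso[OF left_module_C[OF assms(1)] left_module_C[OF assms(2)] separated_C[OF assms(3)]]
    assms(4) unfolding mod_isomorphic_def by blast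

text \<open>For infinite dimensional factors the full dual of V \<otimes> W is larger than the span
  of the products f \<otimes> g. Bijectivity of the compatibility map says that
  \<open>star T\<close> is precisely this span: products belong to it, and each member is a finite
  sum of products.\<close>

lemma star_tensor_map_exists:
  assumes V: "V \<in> C" and W: "W \<in> C" and T: "T \<in> C" and "mod_isomorphic (tensor_module H V W) T"
  obtains \<mu> where "tensor_map (comult H) V W T \<mu>"
    "\<And>f g. f \<in> star V \<Longrightarrow> g \<in> star W \<Longrightarrow>
       \<exists>F\<in>star T. \<forall>v\<in>carrier V. \<forall>w\<in>carrier W. F (\<mu> v w) = f v * g w"
    "\<And>F. F \<in> star T \<Longrightarrow> \<exists>(n::nat) f g. (\<forall>i<n. f i \<in> star V \<and> g i \<in> star W) \<and>
       (\<forall>v\<in>carrier V. \<forall>w\<in>carrier W. F (\<mu> v w) = (\<Sum>i<n. f i v * g i w))"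
proof -
  let ?B = "bilinear_forms (vec H V) (vec H W)"
  let ?B' = "bilinear_forms (dual_vec (star W)) (dual_vec (star V))"
  let ?M = "tensor_module H V W"
  obtain \<phi> where \<phi>: "\<phi> \<in> mod_isos ?M T" using assms(4) unfolding mod_isomorphic_def by blast
  define \<mu> where "\<mu> = (\<lambda>v w. \<phi> (pure_tensor ?B v w))"
  have tm: "tensor_map (comult H) V W T \<mu>"
    unfolding \<mu>_def using tensor_map_of_iso[OF left_module_C[OF V] left_module_C[OF W] separated_C[OF T] \<phi>] .
  define D where "D = dual_tensor_map H V W T \<phi>"
  have iso: "D \<in> mod_isos (dual_tensor H V (star V) W (star W)) (dual_module T (star T))"
    unfolding D_def using compatible V W T \<phi> unfolding star_tensor_compatible_def by blast
  have car: "carrier (dual_tensor H V (star V) W (star W)) = tensor_span ?B' (star W) (star V)"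
    "carrier (dual_module T (star T)) = star T"
    by (simp_all add: dual_tensor_def Let_def tensor_space_def dual_vec_def dual_module_def)
  have D: "D ` tensor_span ?B' (star W) (star V) = star T"
    using iso by (simp add: mod_isos_def bij_betw_def car)
  have B': "(\<lambda>f' f. f v * f' w) \<in> ?B'" for v w
    by (auto simp: bilinear_forms_def dual_vec_def algebra_simps)
  \<comment> \<open>\<open>D\<close> undoes \<phi>, which returns the pure tensor of v and w, and
    evaluates it at the form of the sum. The factors appear as g, f because
    \<open>dual_tensor\<close> puts the dual of W first.\<close>
  have D_eq: "D (tensor_sum ?B' n g f) (\<mu> v w) = (\<Sum>i<n. f i v * g i w)"
    if fg: "\<And>i. i < n \<Longrightarrow> f i \<in> star V \<and> g i \<in> star W" and v: "v \<in> carrier V" and w: "w \<in> carrier W"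
    for n v w f and g :: "nat \<Rightarrow> 'v \<Rightarrow> 'k"
  proof -
    have "inv_into (carrier ?M) \<phi> (\<mu> v w) = pure_tensor ?B v w"
      using \<phi> pure_in_tensor[OF left_module_C[OF V] left_module_C[OF W] v w]
      by (simp add: \<mu>_def mod_isos_def bij_betw_def)
    moreover have "(\<lambda>v w. \<Sum>i<n. f i v * g i w) \<in> ?B"
      by (intro bilinear_forms_sum bilinear_forms_prod star_dual[OF V] star_dual[OF W]) (use fg in auto)
    ultimately show ?thesis
      using tensor_map_closed[OF tm v w]
      by (simp add: D_def dual_tensor_map_def tensor_sum_def pure_tensor_def B')
  qed
  show ?thesis
  proof (rule that[OF tm])
    fix f g assume fg: "f \<in> star V" "g \<in> star W"
    have "tensor_sum ?B' 1 (\<lambda>_. g) (\<lambda>_. f) \<in> tensor_span ?B' (star W) (star V)"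
      unfolding tensor_span_def using fg by blast
    then have "D (tensor_sum ?B' 1 (\<lambda>_. g) (\<lambda>_. f)) \<in> star T" using D by blast
    then show "\<exists>F\<in>star T. \<forall>v\<in>carrier V. \<forall>w\<in>carrier W. F (\<mu> v w) = f v * g w"
      by (rule bexI[rotated]) (simp add: D_eq fg)
  next
    fix F assume "F \<in> star T"
    then obtain n f g where "F = D (tensor_sum ?B' n g f)" "\<And>i. i < n \<Longrightarrow> g i \<in> star W \<and> f i \<in> star V"
      unfolding D[symmetric] tensor_span_def by blast
    then show "\<exists>(n::nat) f g. (\<forall>i<n. f i \<in> star V \<and> g i \<in> star W) \<and>
       (\<forall>v\<in>carrier V. \<forall>w\<in>carrier W. F (\<mu> v w) = (\<Sum>i<n. f i v * g i w))"
      using D_eq[of n f g] by (intro exI[of _ n] exI[of _ f] exI[of _ g]) simp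
  qed
qed

text \<open>The coefficient forms are balanced over D(V), so passing to the quotient leaves their
  values, and hence the image of \<open>beta\<close>, as for plain finite sums.\<close>

lemma coeffs_eq:
  assumes "V \<in> C"
  shows "coeffs H star V = {(\<lambda>h. \<Sum>i<n. f i (h \<odot>\<^bsub>V\<^esub> x i)) | (n::nat) f x. \<forall>i<n. f i \<in> star V \<and> x i \<in> carrier V}"
proof -
  interpret left_module V using assms by (rule left_module_C)
  have "(\<lambda>x f. f (h \<odot>\<^bsub>V\<^esub> x)) \<in> balanced_forms H V (star V)" for h
    using dual_act[OF left_module_axioms star_dual[OF assms], of _ h]
    by (auto simp: balanced_forms_def bilinear_forms_def dual_vec_def transp_def dual_iff act_closed
        mod_homs_act mod_homs_closed)
  then have beta_eq: "beta V (tensor_sum (balanced_forms H V (star V)) n x f) = (\<lambda>h. \<Sum>i<n. f i (h \<odot>\<^bsub>V\<^esub> x i))" for n x f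
    by (simp add: beta_def tensor_sum_def pure_tensor_def)
  have "coeffs H star V = {beta V (tensor_sum (balanced_forms H V (star V)) n x f) | n x f.
      \<forall>i<n. x i \<in> carrier V \<and> f i \<in> star V}"
    unfolding coeffs_def balanced_tensor_def tensor_span_def by blast
  then show ?thesis unfolding beta_eq by blast
qed

text \<open>Sums without coefficients suffice for linear spans, as the generating sets in use are
  stable under scalars.\<close>

definition span_sums :: "('h \<Rightarrow> 'k) set \<Rightarrow> ('h \<Rightarrow> 'k) set" where
  "span_sums A = {(\<lambda>h. \<Sum>i<n. \<xi> i h) | (n::nat) \<xi>. \<forall>i<n. \<xi> i \<in> A}"

lemma span_sums_zero: "(\<lambda>h. 0) \<in> span_sums A"
  unfolding span_sums_def by (intro CollectI exI[of _ 0]) simp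

lemma span_sums_base: "\<xi> \<in> A \<Longrightarrow> \<xi> \<in> span_sums A"
  unfolding span_sums_def by (intro CollectI exI[of _ 1] exI[of _ "\<lambda>_. \<xi>"]) simp

lemma span_sums_add:
  assumes "\<phi> \<in> span_sums A" "\<psi> \<in> span_sums A" shows "(\<lambda>h. \<phi> h + \<psi> h) \<in> span_sums A"
proof -
  from assms obtain n m :: nat and f g where "\<phi> = (\<lambda>h. \<Sum>i<n. f i h)" "\<forall>i<n. f i \<in> A"
    "\<psi> = (\<lambda>h. \<Sum>i<m. g i h)" "\<forall>i<m. g i \<in> A"
    unfolding span_sums_def by blast
  then show ?thesis
    unfolding span_sums_def
    by (intro CollectI exI[of _ "n + m"] exI[of _ "\<lambda>i. if i < n then f i else g (i - n)"])
      (auto simp: sum_append[symmetric] fun_eq_iff if_distribR not_less less_diff_conv2 add.commute)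
qed

lemma span_sums_sum:
  assumes "finite I" "\<And>i. i \<in> I \<Longrightarrow> \<phi> i \<in> span_sums A" shows "(\<lambda>h. \<Sum>i\<in>I. \<phi> i h) \<in> span_sums A"
  using assms by (induction I) (auto simp: span_sums_zero span_sums_add)

lemma span_sums_induct [consumes 1, case_names zero base add]:
  assumes "\<xi> \<in> span_sums A" "P (\<lambda>h. 0)" "\<And>\<xi>. \<xi> \<in> A \<Longrightarrow> P \<xi>"
    "\<And>\<phi> \<psi>. \<phi> \<in> span_sums A \<Longrightarrow> \<psi> \<in> span_sums A \<Longrightarrow> P \<phi> \<Longrightarrow> P \<psi> \<Longrightarrow> P (\<lambda>h. \<phi> h + \<psi> h)"
  shows "P \<xi>"
proof -
  obtain n and f :: "nat \<Rightarrow> _" where f: "\<xi> = (\<lambda>h. \<Sum>i<n. f i h)" "\<forall>i<n. f i \<in> A"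
    using assms(1) unfolding span_sums_def by blast
  have "m \<le> n \<Longrightarrow> (\<lambda>h. \<Sum>i<m. f i h) \<in> span_sums A \<and> P (\<lambda>h. \<Sum>i<m. f i h)" for m
    by (induction m) (use f(2) assms(2-4) in \<open>auto simp: span_sums_zero span_sums_base span_sums_add\<close>)
  then show ?thesis using f by blast
qed

lemma coeffs_eq_span:
  assumes "V \<in> C"
  shows "coeffs H star V = span_sums {(\<lambda>h. f (h \<odot>\<^bsub>V\<^esub> x)) | f x. f \<in> star V \<and> x \<in> carrier V}"
proof (intro equalityI subsetI)
  fix \<xi> assume "\<xi> \<in> coeffs H star V"
  then obtain n :: nat and f x where \<xi>: "\<xi> = (\<lambda>h. \<Sum>i<n. f i (h \<odot>\<^bsub>V\<^esub> x i))"
    "\<forall>i<n. f i \<in> star V \<and> x i \<in> carrier V"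
    unfolding coeffs_eq[OF assms] by blast
  show "\<xi> \<in> span_sums {(\<lambda>h. f (h \<odot>\<^bsub>V\<^esub> x)) | f x. f \<in> star V \<and> x \<in> carrier V}"
    unfolding \<xi>(1) by (intro span_sums_sum finite_lessThan span_sums_base) (use \<xi>(2) in blast)
next
  fix \<xi> assume "\<xi> \<in> span_sums {(\<lambda>h. f (h \<odot>\<^bsub>V\<^esub> x)) | f x. f \<in> star V \<and> x \<in> carrier V}"
  then obtain n and \<xi>' :: "nat \<Rightarrow> _" where \<xi>: "\<xi> = (\<lambda>h. \<Sum>i<n. \<xi>' i h)"
    "\<forall>i<n. \<exists>f x. \<xi>' i = (\<lambda>h. f (h \<odot>\<^bsub>V\<^esub> x)) \<and> f \<in> star V \<and> x \<in> carrier V"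
    unfolding span_sums_def by blast
  then obtain f x where "\<forall>i<n. \<xi>' i = (\<lambda>h. f i (h \<odot>\<^bsub>V\<^esub> x i)) \<and> f i \<in> star V \<and> x i \<in> carrier V"
    by metis
  then show "\<xi> \<in> coeffs H star V"
    unfolding coeffs_eq[OF assms] \<xi>(1)
    by (intro CollectI exI[of _ n] exI[of _ f] exI[of _ x]) auto
qed

lemma coeffs_cmul:
  assumes "V \<in> C" "\<xi> \<in> coeffs H star V" shows "(\<lambda>h. c * \<xi> h) \<in> coeffs H star V"
proof -
  obtain n :: nat and f x where "\<xi> = (\<lambda>h. \<Sum>i<n. f i (h \<odot>\<^bsub>V\<^esub> x i))" "\<forall>i<n. f i \<in> star V \<and> x i \<in> carrier V"
    using assms(2) unfolding coeffs_eq[OF assms(1)] by blast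
  then show ?thesis
    unfolding coeffs_eq[OF assms(1)]
    by (intro CollectI exI[of _ n] exI[of _ "\<lambda>i y. c * f i y"] exI[of _ x])
      (auto simp: sum_distrib_left star_cmul[OF assms(1)])
qed

lemma coeffs_form:
  assumes "V \<in> C" "\<xi> \<in> coeffs H star V" shows "\<xi> \<in> Hdual"
  using assms(2) unfolding coeffs_eq[OF assms(1)]
  by (auto intro!: linear_forms_sum coeff_form[OF left_module_C[OF assms(1)]] star_dual[OF assms(1)])

lemma coeffs_add:
  "V \<in> C \<Longrightarrow> \<xi> \<in> coeffs H star V \<Longrightarrow> \<psi> \<in> coeffs H star V \<Longrightarrow> (\<lambda>h. \<xi> h + \<psi> h) \<in> coeffs H star V"
  unfolding coeffs_eq_span by (rule span_sums_add)

lemma coeffs_sum: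
  "V \<in> C \<Longrightarrow> finite I \<Longrightarrow> (\<And>i. i \<in> I \<Longrightarrow> \<xi> i \<in> coeffs H star V) \<Longrightarrow> (\<lambda>h. \<Sum>i\<in>I. \<xi> i h) \<in> coeffs H star V"
  unfolding coeffs_eq_span by (rule span_sums_sum)

lemma coeffs_base: "V \<in> C \<Longrightarrow> f \<in> star V \<Longrightarrow> x \<in> carrier V \<Longrightarrow> (\<lambda>h. f (h \<odot>\<^bsub>V\<^esub> x)) \<in> coeffs H star V"
  unfolding coeffs_eq_span by (rule span_sums_base) blast

text \<open>A scalar is absorbed by the left factor, which ranges over a subspace.\<close>

lemma products_span_eq:
  assumes "V \<in> C" and "B \<subseteq> Hdual"
  shows "products_span H (coeffs H star V) B =
    span_sums {\<phi> \<star> \<xi> | \<phi> \<xi>. \<phi> \<in> coeffs H star V \<and> \<xi> \<in> B \<inter> Hdual}"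
proof (intro equalityI subsetI)
  fix \<zeta> assume "\<zeta> \<in> products_span H (coeffs H star V) B"
  then obtain n :: nat and c \<phi> \<xi> where \<zeta>: "\<zeta> = (\<lambda>h. \<Sum>i<n. c i * (\<phi> i \<star> \<xi> i) h)"
    "\<forall>i<n. \<phi> i \<in> coeffs H star V \<and> \<xi> i \<in> B"
    unfolding products_span_def by blast
  have "(\<lambda>h. c i * (\<phi> i \<star> \<xi> i) h) = (\<lambda>h. c i * \<phi> i h) \<star> \<xi> i"
    if "i < n" for i
    using dual_algebra_cmul[of "\<phi> i" "\<xi> i" "c i" 1] \<zeta>(2) that \<open>B \<subseteq> Hdual\<close> coeffs_form[OF assms(1)] by auto
  then show "\<zeta> \<in> span_sums {\<phi> \<star> \<xi> | \<phi> \<xi>. \<phi> \<in> coeffs H star V \<and> \<xi> \<in> B \<inter> Hdual}"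
    unfolding \<zeta>(1) using \<zeta>(2) coeffs_cmul[OF assms(1)] \<open>B \<subseteq> Hdual\<close>
    by (intro span_sums_sum span_sums_base) (auto, metis subsetD)
next
  fix \<zeta> assume "\<zeta> \<in> span_sums {\<phi> \<star> \<xi> | \<phi> \<xi>. \<phi> \<in> coeffs H star V \<and> \<xi> \<in> B \<inter> Hdual}"
  then obtain n and \<xi>' :: "nat \<Rightarrow> _" where \<zeta>: "\<zeta> = (\<lambda>h. \<Sum>i<n. \<xi>' i h)"
    "\<forall>i<n. \<exists>\<phi> \<xi>. \<xi>' i = \<phi> \<star> \<xi> \<and> \<phi> \<in> coeffs H star V \<and> \<xi> \<in> B \<inter> Hdual"
    unfolding span_sums_def by blast
  then obtain \<phi> \<xi> where "\<forall>i<n. \<xi>' i = \<phi> i \<star> \<xi> i \<and> \<phi> i \<in> coeffs H star V \<and> \<xi> i \<in> B \<inter> Hdual"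
    by metis
  then show "\<zeta> \<in> products_span H (coeffs H star V) B"
    unfolding \<zeta>(1) products_span_def
    by (intro CollectI exI[of _ n] exI[of _ "\<lambda>_. 1"] exI[of _ \<phi>] exI[of _ \<xi>]) auto
qed

text \<open>One inclusion needs f \<otimes> g to lie in \<open>star T\<close>. The other needs each
  F in \<open>star T\<close> to be a finite sum of such products: its coefficient at v \<otimes> w
  is then a finite sum of products of coefficients, and a general t is reached by
  additivity.\<close>

lemma coeffs_tensor:
  assumes V: "V \<in> C" and W: "W \<in> C" and T: "T \<in> C" and iso: "mod_isomorphic (tensor_module H V W) T"
  shows "products_span H (coeffs H star V) (coeffs H star W) = coeffs H star T"
proof -
  interpret V: left_module V using V by (rule left_module_C)
  interpret W: left_module W using W by (rule left_module_C)
  interpret T: left_module T using T by (rule left_module_C)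
  let ?P = "{\<phi> \<star> \<xi> | \<phi> \<xi>. \<phi> \<in> coeffs H star V \<and> \<xi> \<in> coeffs H star W \<inter> Hdual}"
  have P: "products_span H (coeffs H star V) (coeffs H star W) = span_sums ?P"
    by (rule products_span_eq[OF V]) (use coeffs_form[OF W] in blast)
  obtain \<mu> where tm: "tensor_map (comult H) V W T \<mu>"
    and \<mu>1: "\<And>f g. f \<in> star V \<Longrightarrow> g \<in> star W \<Longrightarrow>
       \<exists>F\<in>star T. \<forall>v\<in>carrier V. \<forall>w\<in>carrier W. F (\<mu> v w) = f v * g w"
    and \<mu>2: "\<And>F. F \<in> star T \<Longrightarrow> \<exists>(n::nat) f g. (\<forall>i<n. f i \<in> star V \<and> g i \<in> star W) \<and>
       (\<forall>v\<in>carrier V. \<forall>w\<in>carrier W. F (\<mu> v w) = (\<Sum>i<n. f i v * g i w))"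
    by (rule star_tensor_map_exists[OF assms]) blast
  have pure: "(\<lambda>h. f (h \<odot>\<^bsub>V\<^esub> x)) \<star> (\<lambda>h. g (h \<odot>\<^bsub>W\<^esub> y)) \<in> coeffs H star T"
    if f: "f \<in> star V" and x: "x \<in> carrier V" and g: "g \<in> star W" and y: "y \<in> carrier W" for f x g y
  proof -
    obtain F where F: "F \<in> star T" "\<And>v w. v \<in> carrier V \<Longrightarrow> w \<in> carrier W \<Longrightarrow> F (\<mu> v w) = f v * g w"
      using \<mu>1[OF f g] by blast
    have "(\<lambda>h. f (h \<odot>\<^bsub>V\<^esub> x)) \<star> (\<lambda>h. g (h \<odot>\<^bsub>W\<^esub> y)) = (\<lambda>h. F (h \<odot>\<^bsub>T\<^esub> \<mu> x y))"
      using tensor_map_act[OF tm star_dual[OF T F(1)] x y] x y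
      by (simp add: dual_algebra_mult F(2) V.act_closed W.act_closed)
    then show ?thesis using coeffs_base[OF T F(1) tensor_map_closed[OF tm x y]] by simp
  qed
  have "\<zeta> \<in> coeffs H star T" if "\<zeta> \<in> span_sums ?P" for \<zeta>
    using that
  proof (induction rule: span_sums_induct)
    case zero
    show ?case unfolding coeffs_eq_span[OF T] by (rule span_sums_zero)
  next
    case (base \<zeta>)
    then obtain \<phi> \<xi> where \<zeta>: "\<zeta> = \<phi> \<star> \<xi>" "\<phi> \<in> coeffs H star V" "\<xi> \<in> coeffs H star W" by blast
    obtain n :: nat and f x where \<phi>: "\<phi> = (\<lambda>h. \<Sum>i<n. f i (h \<odot>\<^bsub>V\<^esub> x i))" "\<forall>i<n. f i \<in> star V \<and> x i \<in> carrier V"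
      using \<zeta>(2) unfolding coeffs_eq[OF V] by blast
    obtain m :: nat and g y where \<xi>: "\<xi> = (\<lambda>h. \<Sum>i<m. g i (h \<odot>\<^bsub>W\<^esub> y i))" "\<forall>i<m. g i \<in> star W \<and> y i \<in> carrier W"
      using \<zeta>(3) unfolding coeffs_eq[OF W] by blast
    have "\<zeta> = (\<lambda>h. \<Sum>i<n. \<Sum>j<m. ((\<lambda>h. f i (h \<odot>\<^bsub>V\<^esub> x i)) \<star> (\<lambda>h. g j (h \<odot>\<^bsub>W\<^esub> y j))) h)"
      unfolding \<zeta>(1) \<phi>(1) \<xi>(1)
      by (rule dual_algebra_sum_sum)
        (use \<phi>(2) \<xi>(2) in \<open>auto intro!: coeff_form V.left_module_axioms W.left_module_axioms star_dual V W\<close>)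
    then show ?case using \<phi>(2) \<xi>(2) by (auto intro!: coeffs_sum[OF T] pure)
  next
    case (add \<phi> \<psi>)
    then show ?case by (intro coeffs_add[OF T])
  qed
  moreover have "(\<lambda>h. F (h \<odot>\<^bsub>T\<^esub> t)) \<in> span_sums ?P" if F: "F \<in> star T" and "t \<in> carrier T" for F t
    using tm T.left_module_axioms that(2)
  proof (induction rule: tensor_map_induct)
    case zero
    have "(\<lambda>h. F (h \<odot>\<^bsub>T\<^esub> \<zero>\<^bsub>T\<^esub>)) = (\<lambda>h. 0)"
      using dual_zero[OF T.left_module_axioms star_dual[OF T F]] by (simp add: T.act_zero)
    then show ?case using span_sums_zero by simp
  next
    case (gen v w)
    obtain n :: nat and f g where fg: "\<forall>i<n. f i \<in> star V \<and> g i \<in> star W"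
       "\<forall>v\<in>carrier V. \<forall>w\<in>carrier W. F (\<mu> v w) = (\<Sum>i<n. f i v * g i w)"
      using \<mu>2[OF F] by blast
    have Hd: "(\<lambda>h. f i (h \<odot>\<^bsub>V\<^esub> v)) \<in> Hdual" "(\<lambda>h. g i (h \<odot>\<^bsub>W\<^esub> w)) \<in> Hdual" if "i < n" for i
      using fg(1) that gen coeff_form[OF V.left_module_axioms star_dual[OF V]]
        coeff_form[OF W.left_module_axioms star_dual[OF W]] by auto
    have eq: "F (h \<odot>\<^bsub>T\<^esub> \<mu> v w) =
        (\<Sum>i<n. ((\<lambda>h. f i (h \<odot>\<^bsub>V\<^esub> v)) \<star> (\<lambda>h. g i (h \<odot>\<^bsub>W\<^esub> w))) h)" for h
    proof -
      have "F (h \<odot>\<^bsub>T\<^esub> \<mu> v w) = comult H h (\<lambda>a b. \<Sum>i<n. f i (a \<odot>\<^bsub>V\<^esub> v) * g i (b \<odot>\<^bsub>W\<^esub> w))"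
        using tensor_map_act[OF tm star_dual[OF T F] gen] gen fg(2) by (simp add: V.act_closed W.act_closed)
      also have "\<dots> = (\<Sum>i<n. ((\<lambda>h. f i (h \<odot>\<^bsub>V\<^esub> v)) \<star> (\<lambda>h. g i (h \<odot>\<^bsub>W\<^esub> w))) h)"
        unfolding dual_algebra_mult by (rule comult_sum) (use Hd H2_prod in auto)
      finally show ?thesis .
    qed
    have "(\<lambda>h. f i (h \<odot>\<^bsub>V\<^esub> v)) \<star> (\<lambda>h. g i (h \<odot>\<^bsub>W\<^esub> w)) \<in> span_sums ?P" if "i < n" for i
      using coeffs_base[OF V _ gen(1)] coeffs_base[OF W _ gen(2)] fg(1) Hd that
      by (intro span_sums_base) blast
    then show ?case unfolding eq by (intro span_sums_sum) auto
  next
    case (add s t)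
    then show ?case
      using span_sums_add[OF add.IH] by (simp add: T.act_r_distr T.act_closed dual_add[OF star_dual[OF T F]])
  qed
  then have "\<zeta> \<in> span_sums ?P" if "\<zeta> \<in> coeffs H star T" for \<zeta>
    using that unfolding coeffs_eq[OF T] by (auto intro!: span_sums_sum)
  ultimately show ?thesis unfolding P by blast
qed

lemma all_coeffs_eq: "all_coeffs H C star = span_sums (\<Union>V\<in>C. coeffs H star V)"
  unfolding all_coeffs_def span_sums_def by auto

lemma all_coeffs_form: "all_coeffs H C star \<subseteq> Hdual"
  unfolding all_coeffs_def using coeffs_form by (auto intro!: linear_forms_sum)

lemma all_coeffs_cmul:
  assumes "\<xi> \<in> all_coeffs H C star" shows "(\<lambda>h. c * \<xi> h) \<in> all_coeffs H C star"
  using assms unfolding all_coeffs_eq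
proof (induction rule: span_sums_induct)
  case (add \<phi> \<psi>)
  then show ?case using span_sums_add[OF add.IH] by (simp add: distrib_left)
next
  case (base \<xi>)
  then show ?case by (blast intro: span_sums_base coeffs_cmul)
qed (simp add: span_sums_zero)

lemma unit_exists:
  obtains U where "U \<in> C" "mod_isomorphic (trivial_module H) U"
  using tensor unfolding tensor_subcategory_def ess_mem_def by blast

text \<open>On the unit object h acts by \<epsilon>(h), so any f in \<open>star U\<close> with f(u)
  nonzero, which exists by non-degeneracy, has \<epsilon> as a rescaled coefficient.\<close>

lemma counit_all_coeffs: "\<epsilon> \<in> all_coeffs H C star"
proof -
  obtain U \<phi> where U: "U \<in> C" and \<phi>: "\<phi> \<in> mod_isos (trivial_module H) U"
    using unit_exists unfolding mod_isomorphic_def by blast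
  interpret left_module U using U by (rule left_module_C)
  obtain u l where u: "u \<in> carrier U" and l: "l \<in> full_dual H U" "l u = 1"
    and act: "\<And>h. h \<odot>\<^bsub>U\<^esub> u = scl H (\<epsilon> h) 1 \<odot>\<^bsub>U\<^esub> u"
    by (rule trivial_module_iso[OF left_module_axioms \<phi>]) blast
  have "u \<noteq> \<zero>\<^bsub>U\<^esub>" using l dual_zero[OF left_module_axioms] by fastforce
  then obtain f where f: "f \<in> star U" "f u \<noteq> 0" using star_separates[OF U u] by blast
  have "\<epsilon> = (\<lambda>h. inverse (f u) * f (h \<odot>\<^bsub>U\<^esub> u))"
  proof
    show "\<epsilon> h = inverse (f u) * f (h \<odot>\<^bsub>U\<^esub> u)" for h
      by (subst act) (simp add: dual_smult[OF star_dual[OF U f(1)] u] f(2))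
  qed
  also have "\<dots> \<in> coeffs H star U" by (rule coeffs_base[OF U star_cmul[OF U f(1)] u])
  finally show ?thesis unfolding all_coeffs_eq using U by (intro span_sums_base) blast
qed

text \<open>Different summands may come from different objects; each pair is handled by its own
  tensor product, and convolution is biadditive.\<close>

lemma all_coeffs_mult:
  assumes "\<phi> \<in> all_coeffs H C star" "\<xi> \<in> all_coeffs H C star"
  shows "\<phi> \<star> \<xi> \<in> all_coeffs H C star"
proof -
  have prod: "\<alpha> \<star> \<gamma> \<in> all_coeffs H C star"
    if V: "V \<in> C" "\<alpha> \<in> coeffs H star V" and W: "W \<in> C" "\<gamma> \<in> coeffs H star W" for \<alpha> \<gamma> V W
  proof -
    obtain T where T: "T \<in> C" "mod_isomorphic (tensor_module H V W) T"
      using tensor_exists[OF V(1) W(1)] .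
    have WH: "coeffs H star W \<subseteq> Hdual" using coeffs_form[OF W(1)] by blast
    have "\<alpha> \<star> \<gamma> \<in> products_span H (coeffs H star V) (coeffs H star W)"
      unfolding products_span_eq[OF V(1) WH] using V(2) W(2) WH by (intro span_sums_base) blast
    then show ?thesis
      unfolding coeffs_tensor[OF V(1) W(1) T] all_coeffs_eq using T(1) by (intro span_sums_base) blast
  qed
  obtain n :: nat and \<alpha> where \<phi>: "\<phi> = (\<lambda>h. \<Sum>i<n. \<alpha> i h)" "\<forall>i<n. \<exists>V\<in>C. \<alpha> i \<in> coeffs H star V"
    using assms(1) unfolding all_coeffs_def by blast
  obtain m :: nat and \<gamma> where \<xi>: "\<xi> = (\<lambda>h. \<Sum>i<m. \<gamma> i h)" "\<forall>i<m. \<exists>V\<in>C. \<gamma> i \<in> coeffs H star V"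
    using assms(2) unfolding all_coeffs_def by blast
  have "\<phi> \<star> \<xi> = (\<lambda>h. \<Sum>i<n. \<Sum>j<m. (\<alpha> i \<star> \<gamma> j) h)"
    unfolding \<phi>(1) \<xi>(1) by (rule dual_algebra_sum_sum) (use \<phi>(2) \<xi>(2) coeffs_form in auto)
  moreover have "(\<lambda>h. \<Sum>i<n. \<Sum>j<m. (\<alpha> i \<star> \<gamma> j) h) \<in> all_coeffs H C star"
    using \<phi>(2) \<xi>(2) prod unfolding all_coeffs_eq by (intro span_sums_sum finite_lessThan) blast
  ultimately show ?thesis by simp
qed

lemma all_coeffs_add:
  "\<phi> \<in> all_coeffs H C star \<Longrightarrow> \<xi> \<in> all_coeffs H C star \<Longrightarrow> (\<lambda>h. \<phi> h + \<xi> h) \<in> all_coeffs H C star"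
  unfolding all_coeffs_eq by (rule span_sums_add)

lemma subring_all_coeffs: "subring (all_coeffs H C star) (dual_algebra H)"
  using all_coeffs_form counit_all_coeffs all_coeffs_cmul[of _ "-1"] all_coeffs_add all_coeffs_mult
  by (intro subring_dual_algebraI) auto

lemma subring_invariant_part:
  "subring (invariant_part (all_coeffs H C star)) (dual_algebra H)"
proof (rule subring_dual_algebraI)
  show "invariant_part (all_coeffs H C star) \<subseteq> Hdual"
    using all_coeffs_form by (auto simp: invariant_part_def)
  show "\<epsilon> \<in> invariant_part (all_coeffs H C star)"
    by (simp add: invariant_part_def counit_all_coeffs counit_mult mult.commute)
  fix \<phi> assume \<phi>: "\<phi> \<in> invariant_part (all_coeffs H C star)"
  then show "(\<lambda>h. - \<phi> h) \<in> invariant_part (all_coeffs H C star)"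
    using all_coeffs_cmul[of \<phi> "-1"] by (auto simp: invariant_part_def fun_eq_iff)
  fix \<xi> assume \<xi>: "\<xi> \<in> invariant_part (all_coeffs H C star)"
  show "(\<lambda>h. \<phi> h + \<xi> h) \<in> invariant_part (all_coeffs H C star)"
    using \<phi> \<xi> by (auto simp: invariant_part_def fun_eq_iff all_coeffs_add)
  have "(\<phi> \<star> \<xi>) (x * h) = (\<phi> \<star> \<xi>) (h * x)" for x h
    by (rule invariant_part_mult) (use \<phi> \<xi> all_coeffs_form in \<open>auto simp: invariant_part_def fun_eq_iff\<close>)
  then show "\<phi> \<star> \<xi> \<in> invariant_part (all_coeffs H C star)"
    using \<phi> \<xi> by (auto simp: invariant_part_def all_coeffs_mult)
qed

lemma char_elt_mult:
  assumes "V \<in> C" "W \<in> C" "T \<in> C" "fin_dim H V" "fin_dim H W" "mod_isomorphic (tensor_module H V W) T"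
  shows "char_elt H V \<star> char_elt H W = char_elt H T"
proof -
  obtain n :: nat and x f where V: "dual_system V {..<n} x f"
    by (rule fin_dim_basis[OF separated_C[OF assms(1)] assms(4)]) blast
  obtain m :: nat and y g where W: "dual_system W {..<m} y g"
    by (rule fin_dim_basis[OF separated_C[OF assms(2)] assms(5)]) blast
  obtain \<mu> where "tensor_map (comult H) V W T \<mu>"
    by (rule tensor_map_exists[OF assms(1-3,6)]) blast
  then show ?thesis
    by (rule char_elt_tensor[OF assms(1-3)[THEN separated_C] _ V W])
qed

end

section \<open>The Grothendieck ring\<close>

text \<open>Turns isomorphisms into relations of the Grothendieck group, which is presented by exact
  sequences alone.\<close>

lemma short_exact_iso:
  assumes "left_module Z" "left_module V" "left_module W" "carrier Z = {\<zero>\<^bsub>Z\<^esub>}" "mod_isomorphic V W"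
  shows "short_exact Z V W"
proof -
  interpret Z: left_module Z by fact
  interpret V: left_module V by fact
  interpret W: left_module W by fact
  obtain p where p: "p \<in> mod_homs V W" "bij_betw p (carrier V) (carrier W)"
    using assms(5) by (auto simp: mod_isomorphic_def mod_isos_def)
  have "(\<lambda>_. \<zero>\<^bsub>V\<^esub>) \<in> mod_homs Z V"
    by (auto simp: mod_homs_def V.act_zero)
  moreover have "x = \<zero>\<^bsub>V\<^esub>" if "x \<in> carrier V" "p x = \<zero>\<^bsub>W\<^esub>" for x
    using that p(2) mod_homs_zero[OF assms(2,3) p(1)] V.zero_closed by (metis bij_betw_def inj_onD)
  then have "(\<lambda>_. \<zero>\<^bsub>V\<^esub>) ` carrier Z = mod_ker V W p"
    using mod_homs_zero[OF assms(2,3) p(1)] unfolding assms(4) mod_ker_def by auto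
  moreover have "inj_on (\<lambda>_. \<zero>\<^bsub>V\<^esub>) (carrier Z)" unfolding assms(4) by simp
  moreover have "p ` carrier V = carrier W" using p(2) by (simp add: bij_betw_def)
  ultimately show ?thesis using p(1) unfolding short_exact_def by blast
qed

locale finite_tensor_category = tensor_category H C star
  for H :: "('k::field, 'h::ring_1) bialg" and C :: "('h, 'v) module set"
    and star :: "('h, 'v) module \<Rightarrow> ('v \<Rightarrow> 'k) set" +
  assumes fin_dim: "V \<in> C \<Longrightarrow> fin_dim H V"
begin

lemma dual_system_exists:
  assumes "V \<in> C" obtains n :: nat and x f where "dual_system V {..<n} x f"
  by (rule fin_dim_basis[OF separated_C[OF assms] fin_dim[OF assms]]) (rule that)

lemma zero_object:
  obtains Z where "Z \<in> C" "carrier Z = {\<zero>\<^bsub>Z\<^esub>}"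
  using abelian unfolding full_abelian_subcategory_def by blast

lemma tensor_obj:
  assumes "V \<in> C" "W \<in> C"
  shows tensor_obj_closed: "tensor_obj H C V W \<in> C"
    and tensor_obj_iso: "mod_isomorphic (tensor_module H V W) (tensor_obj H C V W)"
proof -
  have "\<exists>T. T \<in> C \<and> mod_isomorphic (tensor_module H V W) T" using tensor_exists[OF assms] by blast
  from someI_ex[OF this] show "tensor_obj H C V W \<in> C" "mod_isomorphic (tensor_module H V W) (tensor_obj H C V W)"
    by (auto simp: tensor_obj_def)
qed

lemma unit_obj:
  shows unit_obj_closed: "unit_obj H C \<in> C"
    and unit_obj_iso: "mod_isomorphic (trivial_module H) (unit_obj H C)"
proof -
  have "\<exists>T. T \<in> C \<and> mod_isomorphic (trivial_module H) T" using unit_exists by blast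
  from someI_ex[OF this] show "unit_obj H C \<in> C" "mod_isomorphic (trivial_module H) (unit_obj H C)"
    by (auto simp: unit_obj_def)
qed

lemma tensor_obj_map:
  assumes "V \<in> C" "W \<in> C"
  obtains \<mu> where "tensor_map (comult H) V W (tensor_obj H C V W) \<mu>"
  by (rule tensor_map_exists[OF assms tensor_obj_closed[OF assms] tensor_obj_iso[OF assms]]) (rule that)

section \<open>The free group on objects, its product and the relations\<close>

abbreviation "I \<equiv> K0_relations C"
abbreviation "R \<equiv> free_K0 H C"

lemma R_simps [simp]:
  "a \<in> carrier R \<longleftrightarrow> Poly_Mapping.keys a \<subseteq> C" "a \<oplus>\<^bsub>R\<^esub> b = a + b" "\<zero>\<^bsub>R\<^esub> = 0" "\<one>\<^bsub>R\<^esub> = frag_of (unit_obj H C)"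
  by (simp_all add: free_K0_def)

text \<open>The product of \<open>free_K0\<close> rewritten as an iterated
  \<open>frag_extend\<close>, a form in which additivity in the left argument is immediate.\<close>

definition tmult :: "(('h, 'v) module \<Rightarrow>\<^sub>0 int) \<Rightarrow> (('h, 'v) module \<Rightarrow>\<^sub>0 int) \<Rightarrow> (('h, 'v) module \<Rightarrow>\<^sub>0 int)" where
  "tmult a b = frag_extend (\<lambda>V. frag_extend (\<lambda>W. frag_of (tensor_obj H C V W)) b) a"

lemma R_mult [simp]: "a \<otimes>\<^bsub>R\<^esub> b = tmult a b"
  by (simp add: free_K0_def tmult_def frag_extend_def frag_cmul_sum)

lemma tmult_diff_left: "tmult (a - b) c = tmult a c - tmult b c"
  by (simp add: tmult_def frag_extend_diff)

lemma tmult_diff_right: "tmult c (a - b) = tmult c a - tmult c b"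
proof -
  have "frag_cmul k (x - y) = frag_cmul k x - frag_cmul k y" for k and x y :: "('h, 'v) module \<Rightarrow>\<^sub>0 int"
    by (simp add: poly_mapping_eqI lookup_minus right_diff_distrib)
  then show ?thesis
    unfolding tmult_def frag_extend_diff by (simp add: frag_extend_def sum_subtractf)
qed

lemma tmult_zero: "tmult 0 a = 0" "tmult a 0 = 0"
  using tmult_diff_left[of 0 0 a] tmult_diff_right[of a 0 0] by simp_all

lemma tmult_minus: "tmult (- a) c = - tmult a c" "tmult c (- a) = - tmult c a"
  using tmult_diff_left[of 0 a c] tmult_diff_right[of c 0 a] by (simp_all add: tmult_zero)

lemma tmult_add: "tmult (a + b) c = tmult a c + tmult b c" "tmult c (a + b) = tmult c a + tmult c b"
  using tmult_diff_left[of a "- b" c] tmult_diff_right[of c a "- b"] by (simp_all add: tmult_minus)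

lemma tmult_of: "tmult (frag_of V) (frag_of W) = frag_of (tensor_obj H C V W)"
  by (simp add: tmult_def)

lemma keys_diff_C:
  "Poly_Mapping.keys a \<subseteq> C \<Longrightarrow> Poly_Mapping.keys b \<subseteq> C \<Longrightarrow> Poly_Mapping.keys (a - b) \<subseteq> C"
  using keys_diff[of a b] by blast

lemma keys_add_C:
  "Poly_Mapping.keys a \<subseteq> C \<Longrightarrow> Poly_Mapping.keys b \<subseteq> C \<Longrightarrow> Poly_Mapping.keys (a + b) \<subseteq> C"
  using Poly_Mapping.keys_add[of a b] by blast

lemma keys_tmult:
  assumes "Poly_Mapping.keys a \<subseteq> C" "Poly_Mapping.keys b \<subseteq> C"
  shows "Poly_Mapping.keys (tmult a b) \<subseteq> C"
  using assms(1)
proof (induction a rule: frag_induction)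
  case (one V)
  show ?case using assms(2)
  proof (induction b rule: frag_induction)
    case (one W)
    then show ?case using tensor_obj_closed \<open>V \<in> C\<close> by (simp add: tmult_of)
  qed (simp_all add: tmult_zero tmult_diff_right keys_diff_C)
qed (simp_all add: tmult_zero tmult_diff_left keys_diff_C)

interpretation G: group "free_Abelian_group C" by (rule group_free_Abelian_group)

abbreviation "relators \<equiv> {frag_of V - (frag_of V' + frag_of V'') | V' V V''.
        V' \<in> C \<and> V \<in> C \<and> V'' \<in> C \<and> short_exact V' V V''}"

lemma relators_carrier: "relators \<subseteq> carrier (free_Abelian_group C)"
proof
  fix x assume "x \<in> relators"
  then obtain V V' V'' where "x = frag_of V - (frag_of V' + frag_of V'')" "V' \<in> C" "V \<in> C" "V'' \<in> C" by blast
  then show "x \<in> carrier (free_Abelian_group C)" by (simp add: keys_diff_C keys_add_C)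
qed

lemma I_subgroup: "subgroup I (free_Abelian_group C)"
  unfolding K0_relations_def by (rule G.generate_is_subgroup[OF relators_carrier])

lemma I_carrier: "a \<in> I \<Longrightarrow> Poly_Mapping.keys a \<subseteq> C"
  using subgroup.subset[OF I_subgroup] by (metis carrier_free_Abelian_group_iff subsetD)

lemma I_zero: "0 \<in> I" and I_add: "a \<in> I \<Longrightarrow> b \<in> I \<Longrightarrow> a + b \<in> I"
  using subgroup.one_closed[OF I_subgroup] subgroup.m_closed[OF I_subgroup] by simp_all

lemma I_minus: "a \<in> I \<Longrightarrow> - a \<in> I"
  using subgroup.m_inv_closed[OF I_subgroup, of a] I_carrier[of a] by simp

lemma I_diff: "a \<in> I \<Longrightarrow> b \<in> I \<Longrightarrow> a - b \<in> I"
  using I_add[OF _ I_minus] by fastforce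

lemma I_relator:
  "V' \<in> C \<Longrightarrow> V \<in> C \<Longrightarrow> V'' \<in> C \<Longrightarrow> short_exact V' V V'' \<Longrightarrow> frag_of V - (frag_of V' + frag_of V'') \<in> I"
  unfolding K0_relations_def by (intro generate.incl) blast

lemma I_induct [consumes 1, case_names zero relator minus add]:
  assumes "a \<in> I" "P 0"
    and rel: "\<And>V' V V''. V' \<in> C \<Longrightarrow> V \<in> C \<Longrightarrow> V'' \<in> C \<Longrightarrow> short_exact V' V V'' \<Longrightarrow>
      P (frag_of V - (frag_of V' + frag_of V''))"
    and minus: "\<And>a. P a \<Longrightarrow> P (- a)" and add: "\<And>a b. P a \<Longrightarrow> P b \<Longrightarrow> P (a + b)"
  shows "P a"
  using assms(1) unfolding K0_relations_def
proof (induction rule: generate.induct)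
  case one
  then show ?case using assms(2) by simp
next
  case (incl h)
  then show ?case using rel by blast
next
  case (inv h)
  have "h \<in> carrier (free_Abelian_group C)" using relators_carrier inv by (rule subsetD)
  then have "inv\<^bsub>free_Abelian_group C\<^esub> h = - h"
    by (intro inv_free_Abelian_group) (simp only: carrier_free_Abelian_group_iff)
  moreover have "P h" using inv rel by blast
  ultimately show ?case using minus by simp
next
  case (eng h1 h2)
  then show ?case using add by simp
qed

text \<open>The sequence Z, Z, Z is exact for a zero object Z, so the difference of its class and
  twice its class is a relation.\<close>

lemma zero_object_I:
  assumes "Z \<in> C" "carrier Z = {\<zero>\<^bsub>Z\<^esub>}" shows "frag_of Z \<in> I"
proof -
  have "mod_isomorphic Z Z"
    by (rule mod_isomorphicI[of "\<lambda>x. x" _ _ "\<lambda>x. x"]) (auto simp: mod_homs_def)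
  then have "frag_of Z - (frag_of Z + frag_of Z) \<in> I"
    using short_exact_iso[OF left_module_C left_module_C left_module_C] assms by (intro I_relator) auto
  from I_minus[OF this] show ?thesis by simp
qed

text \<open>A zero object followed by the isomorphism is a short exact sequence, and the class of
  the zero object is itself a relation.\<close>

lemma iso_I:
  assumes "V \<in> C" "W \<in> C" "mod_isomorphic V W"
  shows "frag_of V - frag_of W \<in> I"
proof -
  obtain Z where Z: "Z \<in> C" "carrier Z = {\<zero>\<^bsub>Z\<^esub>}" by (rule zero_object)
  have "frag_of V - (frag_of Z + frag_of W) \<in> I"
    using short_exact_iso[OF left_module_C left_module_C left_module_C Z(2) assms(3)] assms Z
    by (intro I_relator) auto
  from I_add[OF this zero_object_I[OF Z]] show ?thesis by simp
qed

lemma short_exact_tensor_obj: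
  assumes "V' \<in> C" "V \<in> C" "V'' \<in> C" "W \<in> C" "short_exact V' V V''"
  shows "short_exact (tensor_obj H C V' W) (tensor_obj H C V W) (tensor_obj H C V'' W)"
    and "short_exact (tensor_obj H C W V') (tensor_obj H C W V) (tensor_obj H C W V'')"
proof -
  obtain n :: nat and x f where S: "dual_system V'' {..<n} x f" by (rule dual_system_exists[OF assms(3)])
  obtain \<mu>' where 1: "tensor_map (comult H) V' W (tensor_obj H C V' W) \<mu>'" by (rule tensor_obj_map[OF assms(1,4)])
  obtain \<mu> where 2: "tensor_map (comult H) V W (tensor_obj H C V W) \<mu>" by (rule tensor_obj_map[OF assms(2,4)])
  obtain \<mu>'' where 3: "tensor_map (comult H) V'' W (tensor_obj H C V'' W) \<mu>''" by (rule tensor_obj_map[OF assms(3,4)])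
  show "short_exact (tensor_obj H C V' W) (tensor_obj H C V W) (tensor_obj H C V'' W)"
    by (rule short_exact_tensor[OF _ _ _ _ _ _ _ 1 2 3 assms(5) S])
      (simp_all add: assms left_module_C separated_C tensor_obj_closed)
  obtain \<nu>' where 4: "tensor_map (comult H) W V' (tensor_obj H C W V') \<nu>'" by (rule tensor_obj_map[OF assms(4,1)])
  obtain \<nu> where 5: "tensor_map (comult H) W V (tensor_obj H C W V) \<nu>" by (rule tensor_obj_map[OF assms(4,2)])
  obtain \<nu>'' where 6: "tensor_map (comult H) W V'' (tensor_obj H C W V'') \<nu>''" by (rule tensor_obj_map[OF assms(4,3)])
  show "short_exact (tensor_obj H C W V') (tensor_obj H C W V) (tensor_obj H C W V'')"
    by (rule short_exact_tensor[OF _ _ _ _ _ _ _ tensor_map_flip[OF 4] tensor_map_flip[OF 5] tensor_map_flip[OF 6] assms(5) S])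
      (simp_all add: assms left_module_C separated_C tensor_obj_closed)
qed

text \<open>Exactness of the tensor product in each factor sends relators to relators. The relations
  thus absorb products from both sides, which makes multiplication of cosets well defined.\<close>

lemma tmult_I:
  assumes "a \<in> I" "Poly_Mapping.keys b \<subseteq> C"
  shows "tmult a b \<in> I" "tmult b a \<in> I"
proof -
  have "tmult a b \<in> I \<and> tmult b a \<in> I"
    using assms(1)
  proof (induction rule: I_induct)
    case (relator V' V V'')
    show ?case using assms(2)
    proof (induction b rule: frag_induction)
      case (one W)
      then show ?case
        using relator short_exact_tensor_obj[OF relator(1-3) _ relator(4), of W]
        by (simp add: tmult_add tmult_diff_left tmult_diff_right tmult_of I_relator tensor_obj_closed)
    next
      case (diff b c)
      then show ?case
        unfolding tmult_diff_left[of b] tmult_diff_right[of _ b] by (simp add: I_diff)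
    qed (simp add: tmult_zero I_zero)
  qed (simp_all add: tmult_zero tmult_minus tmult_add I_zero I_minus I_add)
  then show "tmult a b \<in> I" "tmult b a \<in> I" by blast+
qed

lemma tmult_cong:
  assumes "a - a' \<in> I" "b - b' \<in> I" "Poly_Mapping.keys a' \<subseteq> C" "Poly_Mapping.keys b \<subseteq> C"
  shows "tmult a b - tmult a' b' \<in> I"
proof -
  have "tmult (a - a') b + tmult a' (b - b') \<in> I" using assms tmult_I by (intro I_add) auto
  then show ?thesis by (simp add: tmult_diff_left tmult_diff_right)
qed

text \<open>\<open>tensor_obj\<close> picks representatives, so two bracketings give isomorphic but
  possibly distinct objects; hence a congruence. Triadditivity reduces it to three objects.\<close>

lemma tmult_assoc:
  assumes "Poly_Mapping.keys a \<subseteq> C" "Poly_Mapping.keys b \<subseteq> C" "Poly_Mapping.keys c \<subseteq> C"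
  shows "tmult (tmult a b) c - tmult a (tmult b c) \<in> I"
  using assms(1)
proof (induction a rule: frag_induction)
  case (one U)
  show ?case using assms(2)
  proof (induction b rule: frag_induction)
    case (one V)
    show ?case using assms(3)
    proof (induction c rule: frag_induction)
      case (one W)
      note closed = \<open>U \<in> C\<close> \<open>V \<in> C\<close> \<open>W \<in> C\<close> tensor_obj_closed
      let ?A = "tensor_obj H C U V" and ?A' = "tensor_obj H C V W"
      obtain \<alpha> where \<alpha>: "tensor_map (comult H) U V ?A \<alpha>" by (rule tensor_obj_map[OF closed(1,2)])
      obtain \<beta> where \<beta>: "tensor_map (comult H) ?A W (tensor_obj H C ?A W) \<beta>"
        by (rule tensor_obj_map[OF closed(4)[OF closed(1,2)] closed(3)])
      obtain \<alpha>' where \<alpha>': "tensor_map (comult H) V W ?A' \<alpha>'" by (rule tensor_obj_map[OF closed(2,3)])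
      obtain \<beta>' where \<beta>': "tensor_map (comult H) U ?A' (tensor_obj H C U ?A') \<beta>'"
        by (rule tensor_obj_map[OF closed(1) closed(4)[OF closed(2,3)]])
      have "mod_isomorphic (tensor_obj H C ?A W) (tensor_obj H C U ?A')"
        by (rule tensor_assoc[OF _ _ _ _ _ _ _ \<alpha> \<beta> \<alpha>' \<beta>' coassoc_comult])
          (simp_all add: closed left_module_C separated_C)
      then show ?case using closed by (simp add: tmult_of iso_I)
    next
      case (diff c d)
      then show ?case using I_diff[of _ "_ - _"] by (auto simp: tmult_diff_right algebra_simps dest: I_diff)
    qed (simp add: tmult_zero I_zero)
  next
    case (diff b d)
    then show ?case using I_diff[OF diff] by (simp add: tmult_diff_left tmult_diff_right algebra_simps)
  qed (simp add: tmult_zero I_zero)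
next
  case (diff a d)
  then show ?case using I_diff[OF diff] by (simp add: tmult_diff_left tmult_diff_right algebra_simps)
qed (simp add: tmult_zero I_zero)

text \<open>On objects this is the isomorphism of V with its tensor product by the unit, taken once
  with \<open>comult H\<close> and once with its flip.\<close>

lemma tmult_unit:
  assumes "Poly_Mapping.keys a \<subseteq> C"
  shows "tmult (frag_of (unit_obj H C)) a - a \<in> I" "tmult a (frag_of (unit_obj H C)) - a \<in> I"
proof -
  have "tmult (frag_of (unit_obj H C)) a - a \<in> I \<and> tmult a (frag_of (unit_obj H C)) - a \<in> I"
    using assms
  proof (induction a rule: frag_induction)
    case (one V)
    note U = unit_obj_closed
    let ?U = "unit_obj H C"
    obtain \<phi> where \<phi>: "\<phi> \<in> mod_isos (trivial_module H) ?U" using unit_obj_iso unfolding mod_isomorphic_def by blast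
    obtain \<mu> where \<mu>: "tensor_map (comult H) ?U V (tensor_obj H C ?U V) \<mu>" by (rule tensor_obj_map[OF U one])
    obtain \<nu> where \<nu>: "tensor_map (comult H) V ?U (tensor_obj H C V ?U) \<nu>" by (rule tensor_obj_map[OF one U])
    note cl = tensor_obj_closed[OF U one] tensor_obj_closed[OF one U]
    have "mod_isomorphic V (tensor_obj H C ?U V)"
      by (rule tensor_unit[OF left_module_C[OF U] \<phi> separated_C[OF one] separated_C[OF cl(1)] \<mu>]) (rule comult_counit_left)
    then have "mod_isomorphic (tensor_obj H C ?U V) V"
      by (rule mod_isomorphic_sym[OF left_module_C[OF one] left_module_C[OF cl(1)]])
    moreover have "mod_isomorphic V (tensor_obj H C V ?U)"
      by (rule tensor_unit[OF left_module_C[OF U] \<phi> separated_C[OF one] separated_C[OF cl(2)] tensor_map_flip[OF \<nu>]])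
        (simp add: flip_def mult.commute[of "\<epsilon> _"] comult_counit_right)
    then have "mod_isomorphic (tensor_obj H C V ?U) V"
      by (rule mod_isomorphic_sym[OF left_module_C[OF one] left_module_C[OF cl(2)]])
    ultimately show ?case using cl one by (simp add: tmult_of iso_I)
  next
    case (diff a b)
    then show ?case
      using I_diff[of "tmult (frag_of (unit_obj H C)) a - a" "tmult (frag_of (unit_obj H C)) b - b"]
        I_diff[of "tmult a (frag_of (unit_obj H C)) - a" "tmult b (frag_of (unit_obj H C)) - b"]
      by (simp add: tmult_diff_left tmult_diff_right algebra_simps)
  qed (simp add: tmult_zero I_zero)
  then show "tmult (frag_of (unit_obj H C)) a - a \<in> I" "tmult a (frag_of (unit_obj H C)) - a \<in> I" by blast+
qed

section \<open>The Grothendieck ring as a set of cosets\<close>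

definition cls :: "(('h, 'v) module \<Rightarrow>\<^sub>0 int) \<Rightarrow> (('h, 'v) module \<Rightarrow>\<^sub>0 int) set" where
  "cls a = I +>\<^bsub>R\<^esub> a"

lemma mem_cls: "x \<in> cls a \<longleftrightarrow> x - a \<in> I"
proof -
  have "cls a = (\<Union>h\<in>I. {h + a})" by (simp add: cls_def a_r_coset_def' )
  moreover have "x \<in> (\<Union>h\<in>I. {h + a}) \<longleftrightarrow> x - a \<in> I" by (auto intro!: bexI[of _ "x - a"])
  ultimately show ?thesis by simp
qed

lemma cls_eq_iff: "cls a = cls b \<longleftrightarrow> a - b \<in> I"
proof
  assume "cls a = cls b"
  then show "a - b \<in> I" using mem_cls[of a a] mem_cls[of a b] I_zero by simp
next
  assume ab: "a - b \<in> I"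
  have "x - a \<in> I \<longleftrightarrow> x - b \<in> I" for x
    using I_add[OF _ ab, of "x - a"] I_diff[OF _ ab, of "x - b"] by auto
  then show "cls a = cls b" using mem_cls by blast
qed

lemma K0_carrier: "carrier (K0 H C) = cls ` {a. Poly_Mapping.keys a \<subseteq> C}"
  by (auto simp: K0_def FactRing_def A_RCOSETS_def' cls_def)

lemma K0_zero: "\<zero>\<^bsub>K0 H C\<^esub> = cls 0"
  using mem_cls[of _ 0] by (auto simp: K0_def FactRing_def)

lemma K0_one: "\<one>\<^bsub>K0 H C\<^esub> = cls (frag_of (unit_obj H C))"
  by (simp add: K0_def FactRing_def cls_def)

lemma K0_add: "cls a \<oplus>\<^bsub>K0 H C\<^esub> cls b = cls (a + b)"
proof -
  have "cls a \<oplus>\<^bsub>K0 H C\<^esub> cls b = {x + y | x y. x \<in> cls a \<and> y \<in> cls b}"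
    by (auto simp: K0_def FactRing_def set_add_def' )
  also have "\<dots> = cls (a + b)"
  proof (intro equalityI subsetI)
    fix z assume "z \<in> {x + y | x y. x \<in> cls a \<and> y \<in> cls b}"
    then obtain x y where "z = x + y" "x - a \<in> I" "y - b \<in> I" by (auto simp: mem_cls)
    then show "z \<in> cls (a + b)" using I_add[of "x - a" "y - b"] by (simp add: mem_cls algebra_simps)
  next
    fix z assume "z \<in> cls (a + b)"
    then have "z = (z - b) + b" "z - b \<in> cls a" "b \<in> cls b"
      using I_zero by (simp_all add: mem_cls algebra_simps)
    then show "z \<in> {x + y | x y. x \<in> cls a \<and> y \<in> cls b}" by blast
  qed
  finally show ?thesis .
qed

text \<open>The product in a quotient is the union of the cosets of all products of representatives;
  by congruence these cosets all coincide.\<close>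

lemma K0_mult:
  assumes "Poly_Mapping.keys a \<subseteq> C" "Poly_Mapping.keys b \<subseteq> C"
  shows "cls a \<otimes>\<^bsub>K0 H C\<^esub> cls b = cls (tmult a b)"
proof -
  have mult: "cls a \<otimes>\<^bsub>K0 H C\<^esub> cls b = (\<Union>x\<in>cls a. \<Union>y\<in>cls b. cls (tmult x y))"
    by (simp add: K0_def FactRing_def rcoset_mult_def cls_def[symmetric])
  have eq: "cls (tmult x y) = cls (tmult a b)" if "x \<in> cls a" "y \<in> cls b" for x y
  proof -
    have "Poly_Mapping.keys ((y - b) + b) \<subseteq> C"
      using that(2) assms(2) I_carrier unfolding mem_cls by (intro keys_add_C) auto
    then show ?thesis
      using that assms unfolding cls_eq_iff mem_cls by (intro tmult_cong) simp_all
  qed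
  have "(\<Union>x\<in>cls a. \<Union>y\<in>cls b. cls (tmult x y)) = (\<Union>x\<in>cls a. \<Union>y\<in>cls b. cls (tmult a b))"
    by (intro SUP_cong refl eq)
  moreover have "cls c \<noteq> {}" for c using mem_cls[of c c] I_zero by auto
  ultimately show ?thesis by (simp add: mult)
qed

text \<open>\<open>free_K0\<close> satisfies the ring axioms only modulo the relations, so they are
  checked on cosets instead of being inherited from a ring divided by an ideal.\<close>

lemma ring_K0: "ring (K0 H C)"
proof (rule ringI)
  show "abelian_group (K0 H C)"
  proof (rule abelian_groupI)
    fix x assume "x \<in> carrier (K0 H C)"
    then obtain a where a: "x = cls a" "Poly_Mapping.keys a \<subseteq> C" by (auto simp: K0_carrier)
    then show "\<exists>y\<in>carrier (K0 H C). y \<oplus>\<^bsub>K0 H C\<^esub> x = \<zero>\<^bsub>K0 H C\<^esub>"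
      by (intro bexI[of _ "cls (- a)"]) (auto simp: K0_add K0_zero K0_carrier)
  qed (auto simp: K0_carrier K0_zero K0_add add_ac keys_add_C)
  note eqs = tmult_assoc[THEN cls_eq_iff[THEN iffD2]] tmult_unit[THEN cls_eq_iff[THEN iffD2]]
  show "monoid (K0 H C)"
  proof (rule monoidI)
    show "\<one>\<^bsub>K0 H C\<^esub> \<in> carrier (K0 H C)" using unit_obj_closed by (auto simp: K0_one K0_carrier)
  qed (auto simp: K0_carrier K0_one K0_mult keys_tmult eqs unit_obj_closed)
qed (auto simp: K0_carrier K0_add K0_mult keys_add_C keys_tmult tmult_add)

end

section \<open>Simple modules and independence of characters\<close>

definition simple_module :: "('h, 'v) module \<Rightarrow> bool" where
  "simple_module V \<longleftrightarrow> carrier V \<noteq> {\<zero>\<^bsub>V\<^esub>} \<and>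
     (\<forall>N. is_submodule N V \<longrightarrow> N = {\<zero>\<^bsub>V\<^esub>} \<or> N = carrier V)"

definition left_ideal :: "'h::ring_1 set \<Rightarrow> bool" where
  "left_ideal K \<longleftrightarrow> 0 \<in> K \<and> (\<forall>a\<in>K. \<forall>b\<in>K. a - b \<in> K) \<and> (\<forall>h. \<forall>a\<in>K. h * a \<in> K)"

lemma (in left_module) diff_act: "x \<in> carrier V \<Longrightarrow> (a - b) \<odot> x = a \<odot> x \<ominus> b \<odot> x"
  using act_l_distr[of x a "- b"] act_assoc[of x "-1" b] uminus_act[of "b \<odot> x"]
  by (simp add: act_closed minus_eq)

lemma (in left_module) minus_eq_zero_iff:
  "x \<in> carrier V \<Longrightarrow> y \<in> carrier V \<Longrightarrow> x \<ominus> y = \<zero> \<longleftrightarrow> x = y"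
  by (metis a_assoc a_inv_closed l_neg l_zero minus_eq r_neg r_zero)

text \<open>In a simple module this leaves two cases for a left ideal K: it kills x, or K x is the
  whole module.\<close>

lemma (in left_module) orbit_submodule:
  assumes "left_ideal K" "x \<in> carrier V"
  shows "is_submodule ((\<lambda>a. a \<odot> x) ` K) V"
proof -
  have K: "0 \<in> K" "\<And>a b. a \<in> K \<Longrightarrow> b \<in> K \<Longrightarrow> a - b \<in> K" "\<And>h a. a \<in> K \<Longrightarrow> h * a \<in> K"
    using assms(1) by (auto simp: left_ideal_def)
  have add: "a + b \<in> K" if "a \<in> K" "b \<in> K" for a b
    using K(2)[OF that(1) K(2)[OF K(1) that(2)]] by simp
  have "subgroup ((\<lambda>a. a \<odot> x) ` K) (add_monoid V)"
  proof (rule add.subgroupI)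
    show "(\<lambda>a. a \<odot> x) ` K \<subseteq> carrier V" using assms(2) by (auto intro: act_closed)
    show "(\<lambda>a. a \<odot> x) ` K \<noteq> {}" using K(1) by auto
    show "\<ominus> y \<in> (\<lambda>a. a \<odot> x) ` K" if "y \<in> (\<lambda>a. a \<odot> x) ` K" for y
    proof -
      from that obtain a where a: "a \<in> K" "y = a \<odot> x" by auto
      then have "\<ominus> y = ((- 1) * a) \<odot> x" using assms(2) by (simp only: act_assoc uminus_act act_closed)
      then show ?thesis using K(3)[OF a(1)] by blast
    qed
    show "y \<oplus> z \<in> (\<lambda>a. a \<odot> x) ` K" if "y \<in> (\<lambda>a. a \<odot> x) ` K" "z \<in> (\<lambda>a. a \<odot> x) ` K" for y z
      using that add assms(2) by (auto simp flip: act_l_distr)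
  qed
  moreover have "h \<odot> y \<in> (\<lambda>a. a \<odot> x) ` K" if "y \<in> (\<lambda>a. a \<odot> x) ` K" for h y
    using that K(3) assms(2) by (auto simp flip: act_assoc)
  ultimately show ?thesis unfolding is_submodule_def by blast
qed

lemma left_ideal_annihilator:
  assumes "\<And>i. i \<in> I \<Longrightarrow> left_module (T i)" "\<And>i. i \<in> I \<Longrightarrow> x i \<in> carrier (T i)"
  shows "left_ideal {a. \<forall>i\<in>I. a \<odot>\<^bsub>T i\<^esub> x i = \<zero>\<^bsub>T i\<^esub>}"
proof -
  have "0 \<odot>\<^bsub>T i\<^esub> x i = \<zero>\<^bsub>T i\<^esub>" if "i \<in> I" for i
    by (rule left_module.zero_act[OF assms(1)[OF that] assms(2)[OF that]])
  moreover have "(a - b) \<odot>\<^bsub>T i\<^esub> x i = \<zero>\<^bsub>T i\<^esub>"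
    if "i \<in> I" "a \<odot>\<^bsub>T i\<^esub> x i = \<zero>\<^bsub>T i\<^esub>" "b \<odot>\<^bsub>T i\<^esub> x i = \<zero>\<^bsub>T i\<^esub>" for i a b
  proof -
    interpret left_module "T i" using that(1) by (rule assms(1))
    show ?thesis using that assms(2)[OF that(1)] by (simp add: diff_act minus_eq_zero_iff)
  qed
  moreover have "(h * a) \<odot>\<^bsub>T i\<^esub> x i = \<zero>\<^bsub>T i\<^esub>"
    if "i \<in> I" "a \<odot>\<^bsub>T i\<^esub> x i = \<zero>\<^bsub>T i\<^esub>" for i a h
    using left_module.act_assoc[OF assms(1,2)[OF that(1)], of h a] left_module.act_zero[OF assms(1)[OF that(1)], of h]
    by (simp only: that(2))
  ultimately show ?thesis by (simp add: left_ideal_def)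
qed

lemma left_ideal_Int: "left_ideal K \<Longrightarrow> left_ideal L \<Longrightarrow> left_ideal (K \<inter> L)"
  by (auto simp: left_ideal_def)

text \<open>The assumption on annihilators makes a x \<mapsto> a y well defined on K x, and
  simplicity gives K x = V and K y = W. The kernel is a proper submodule of V, hence zero.\<close>

lemma simple_iso_of_annihilators:
  fixes K :: "'h::ring_1 set" and V :: "('h, 'v) module" and W :: "('h, 'w) module"
  assumes "left_module V" "left_module W" "simple_module V" "simple_module W" "left_ideal K"
    and x: "x \<in> carrier V" and y: "y \<in> carrier W"
    and ann: "\<And>a. a \<in> K \<Longrightarrow> a \<odot>\<^bsub>V\<^esub> x = \<zero>\<^bsub>V\<^esub> \<Longrightarrow> a \<odot>\<^bsub>W\<^esub> y = \<zero>\<^bsub>W\<^esub>"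
    and "\<exists>a\<in>K. a \<odot>\<^bsub>W\<^esub> y \<noteq> \<zero>\<^bsub>W\<^esub>"
  shows "mod_isomorphic V W"
proof -
  interpret V: left_module V by fact
  interpret W: left_module W by fact
  have K: "0 \<in> K" "\<And>a b. a \<in> K \<Longrightarrow> b \<in> K \<Longrightarrow> a - b \<in> K" "\<And>h a. a \<in> K \<Longrightarrow> h * a \<in> K"
    using assms(5) by (auto simp: left_ideal_def)
  have Kadd: "a + b \<in> K" if "a \<in> K" "b \<in> K" for a b
    using K(2)[OF that(1) K(2)[OF K(1) that(2)]] by simp
  obtain a0 where a0: "a0 \<in> K" "a0 \<odot>\<^bsub>W\<^esub> y \<noteq> \<zero>\<^bsub>W\<^esub>" using assms(9) by blast
  have KW: "(\<lambda>a. a \<odot>\<^bsub>W\<^esub> y) ` K = carrier W"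
    using W.orbit_submodule[OF assms(5) y] assms(4) a0 unfolding simple_module_def by blast
  have "a0 \<odot>\<^bsub>V\<^esub> x \<noteq> \<zero>\<^bsub>V\<^esub>" using ann[OF a0(1)] a0(2) by blast
  then have KV: "(\<lambda>a. a \<odot>\<^bsub>V\<^esub> x) ` K = carrier V"
    using V.orbit_submodule[OF assms(5) x] assms(3) a0(1) unfolding simple_module_def by blast
  have ann_eq: "a \<odot>\<^bsub>W\<^esub> y = b \<odot>\<^bsub>W\<^esub> y" if "a \<in> K" "b \<in> K" "a \<odot>\<^bsub>V\<^esub> x = b \<odot>\<^bsub>V\<^esub> x" for a b
    using ann[OF K(2)[OF that(1,2)]] that(3) x y
    by (simp add: V.diff_act W.diff_act V.minus_eq_zero_iff W.minus_eq_zero_iff V.act_closed W.act_closed)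
  \<comment> \<open>\<open>L x\<close> is the kernel of the induced map \<open>a x \<mapsto> a y\<close>.\<close>
  define L where "L = K \<inter> {a. \<forall>i\<in>{()}. a \<odot>\<^bsub>W\<^esub> y = \<zero>\<^bsub>W\<^esub>}"
  have L: "left_ideal L"
    unfolding L_def
    by (rule left_ideal_Int[OF assms(5) left_ideal_annihilator]) (use y W.left_module_axioms in auto)
  have "(\<lambda>a. a \<odot>\<^bsub>V\<^esub> x) ` L \<noteq> carrier V"
  proof
    assume "(\<lambda>a. a \<odot>\<^bsub>V\<^esub> x) ` L = carrier V"
    then have "a0 \<odot>\<^bsub>V\<^esub> x \<in> (\<lambda>a. a \<odot>\<^bsub>V\<^esub> x) ` L" using x by (simp add: V.act_closed)
    then obtain b where "b \<in> L" "a0 \<odot>\<^bsub>V\<^esub> x = b \<odot>\<^bsub>V\<^esub> x" by blast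
    then show False using ann_eq[OF a0(1), of b] a0(2) by (simp add: L_def)
  qed
  then have L0: "(\<lambda>a. a \<odot>\<^bsub>V\<^esub> x) ` L = {\<zero>\<^bsub>V\<^esub>}"
    using V.orbit_submodule[OF L x] assms(3) unfolding simple_module_def by blast
  have ann_eq': "a \<odot>\<^bsub>V\<^esub> x = b \<odot>\<^bsub>V\<^esub> x" if "a \<in> K" "b \<in> K" "a \<odot>\<^bsub>W\<^esub> y = b \<odot>\<^bsub>W\<^esub> y" for a b
  proof -
    have "a - b \<in> L" using that K(2) y by (simp add: L_def W.diff_act W.minus_eq_zero_iff W.act_closed)
    then have "(a - b) \<odot>\<^bsub>V\<^esub> x = \<zero>\<^bsub>V\<^esub>" using L0 by blast
    then show ?thesis using x by (simp add: V.diff_act V.minus_eq_zero_iff V.act_closed)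
  qed
  have "\<forall>v\<in>carrier V. \<exists>a. a \<in> K \<and> v = a \<odot>\<^bsub>V\<^esub> x" using KV by blast
  then obtain c where "\<forall>v\<in>carrier V. c v \<in> K \<and> v = c v \<odot>\<^bsub>V\<^esub> x" by (rule bchoice[elim_format]) blast
  then have c: "\<And>v. v \<in> carrier V \<Longrightarrow> c v \<in> K" "\<And>v. v \<in> carrier V \<Longrightarrow> c v \<odot>\<^bsub>V\<^esub> x = v" by auto
  define g where "g v = c v \<odot>\<^bsub>W\<^esub> y" for v
  have g: "g (a \<odot>\<^bsub>V\<^esub> x) = a \<odot>\<^bsub>W\<^esub> y" if "a \<in> K" for a
    unfolding g_def using x that by (intro ann_eq) (simp_all add: c V.act_closed)
  have rep: "\<exists>a\<in>K. v = a \<odot>\<^bsub>V\<^esub> x" if "v \<in> carrier V" for v using that KV by blast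
  have "g \<in> mod_homs V W"
    unfolding mod_homs_def
  proof (intro CollectI conjI ballI allI)
    show "g \<in> carrier V \<rightarrow> carrier W" using y by (auto simp: g_def W.act_closed)
  next
    fix v w assume "v \<in> carrier V" "w \<in> carrier V"
    then obtain a b where "a \<in> K" "b \<in> K" "v = a \<odot>\<^bsub>V\<^esub> x" "w = b \<odot>\<^bsub>V\<^esub> x" using rep by metis
    then show "g (v \<oplus>\<^bsub>V\<^esub> w) = g v \<oplus>\<^bsub>W\<^esub> g w"
      using x y by (simp add: g Kadd W.act_l_distr flip: V.act_l_distr)
  next
    fix h v assume "v \<in> carrier V"
    then obtain a where "a \<in> K" "v = a \<odot>\<^bsub>V\<^esub> x" using rep by metis
    then show "g (h \<odot>\<^bsub>V\<^esub> v) = h \<odot>\<^bsub>W\<^esub> g v"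
      using x y by (simp add: g K(3) W.act_assoc flip: V.act_assoc)
  qed
  moreover have "inj_on g (carrier V)"
  proof (rule inj_onI)
    fix v w assume "v \<in> carrier V" "w \<in> carrier V" and eq: "g v = g w"
    then obtain a b where ab: "a \<in> K" "b \<in> K" "v = a \<odot>\<^bsub>V\<^esub> x" "w = b \<odot>\<^bsub>V\<^esub> x" using rep by metis
    show "v = w"
      unfolding ab(3,4) by (rule ann_eq'[OF ab(1,2)]) (use eq in \<open>simp only: ab(3,4) g[OF ab(1)] g[OF ab(2)]\<close>)
  qed
  moreover have "g ` carrier V = carrier W"
  proof -
    have "g ` (\<lambda>a. a \<odot>\<^bsub>V\<^esub> x) ` K = (\<lambda>a. a \<odot>\<^bsub>W\<^esub> y) ` K" unfolding image_image by (rule image_cong) (simp_all add: g)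
    then show ?thesis by (simp add: KV KW)
  qed
  ultimately show ?thesis by (auto simp: mod_isomorphic_def mod_isos_def bij_betw_def)
qed

text \<open>A common annihilator of vectors in simple modules can kill a nonzero y of S only if one
  of these modules is isomorphic to S.\<close>

lemma simple_annihilators:
  assumes "finite I" "left_module S" "simple_module S" "y \<in> carrier S" "y \<noteq> \<zero>\<^bsub>S\<^esub>"
    and "\<And>i. i \<in> I \<Longrightarrow> left_module (T i)" "\<And>i. i \<in> I \<Longrightarrow> simple_module (T i)"
    and "\<And>i. i \<in> I \<Longrightarrow> x i \<in> carrier (T i)"
    and ann: "\<And>a. (\<forall>i\<in>I. a \<odot>\<^bsub>T i\<^esub> x i = \<zero>\<^bsub>T i\<^esub>) \<Longrightarrow> a \<odot>\<^bsub>S\<^esub> y = \<zero>\<^bsub>S\<^esub>"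
  shows "\<exists>i\<in>I. mod_isomorphic (T i) S"
  using assms(1,6-)
proof (induction I)
  \<comment> \<open>With no conditions the element 1 is an annihilator, and it does not kill
    y.\<close>
  case empty
  interpret left_module S by fact
  have "1 \<odot>\<^bsub>S\<^esub> y = \<zero>\<^bsub>S\<^esub>" using empty(4) by blast
  then show ?case using assms(4,5) by (simp add: act_one)
next
  case (insert j I)
  \<comment> \<open>The annihilator without the condition at j. Either it kills y already and the
    induction hypothesis applies, or it moves y, and comparing x_j with y over it gives an
    isomorphism from T_j to S.\<close>
  let ?K = "{a. \<forall>i\<in>I. a \<odot>\<^bsub>T i\<^esub> x i = \<zero>\<^bsub>T i\<^esub>}"
  show ?case
  proof (cases "\<forall>a\<in>?K. a \<odot>\<^bsub>S\<^esub> y = \<zero>\<^bsub>S\<^esub>")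
    case True
    then have "\<exists>i\<in>I. mod_isomorphic (T i) S" using insert by (intro insert.IH) auto
    then show ?thesis by blast
  next
    case False
    have "mod_isomorphic (T j) S"
    proof (rule simple_iso_of_annihilators[where K = ?K])
      show "left_ideal ?K" using insert by (intro left_ideal_annihilator) auto
      show "x j \<in> carrier (T j)" "left_module (T j)" "simple_module (T j)" using insert by auto
      show "a \<odot>\<^bsub>S\<^esub> y = \<zero>\<^bsub>S\<^esub>" if "a \<in> ?K" "a \<odot>\<^bsub>T j\<^esub> x j = \<zero>\<^bsub>T j\<^esub>" for a
        using insert.prems(4)[of a] that by blast
      show "\<exists>a\<in>?K. a \<odot>\<^bsub>S\<^esub> y \<noteq> \<zero>\<^bsub>S\<^esub>" using False by blast
    qed (use assms in auto)
    then show ?thesis by blast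
  qed
qed

text \<open>A weak form of the density theorem: if \<open>b\<close> fixes the first vectors and \<open>a\<close> fixes
  \<open>(1 - b) y\<close>, then \<open>1 - (1 - a) (1 - b)\<close> fixes \<open>y\<close> as well.\<close>

lemma simple_separating_element:
  assumes "finite I" "left_module S" "simple_module S"
    and T: "\<And>i. i \<in> I \<Longrightarrow> left_module (T i)" "\<And>i. i \<in> I \<Longrightarrow> simple_module (T i)"
    "\<And>i. i \<in> I \<Longrightarrow> x i \<in> carrier (T i)" "\<And>i. i \<in> I \<Longrightarrow> \<not> mod_isomorphic (T i) S"
    and y: "\<And>j. j < n \<Longrightarrow> y j \<in> carrier S"
  shows "\<exists>b. (\<forall>i\<in>I. b \<odot>\<^bsub>T i\<^esub> x i = \<zero>\<^bsub>T i\<^esub>) \<and> (\<forall>j<n::nat. b \<odot>\<^bsub>S\<^esub> y j = y j)"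
  using y
proof (induction n)
  case 0
  have "0 \<odot>\<^bsub>T i\<^esub> x i = \<zero>\<^bsub>T i\<^esub>" if "i \<in> I" for i
    by (rule left_module.zero_act[OF T(1)[OF that] T(3)[OF that]])
  then show ?case by (intro exI[of _ 0]) simp
next
  case (Suc n)
  interpret S: left_module S by fact
  let ?K = "{a. \<forall>i\<in>I. a \<odot>\<^bsub>T i\<^esub> x i = \<zero>\<^bsub>T i\<^esub>}"
  have K: "left_ideal ?K" using T by (intro left_ideal_annihilator) auto
  obtain b where b: "b \<in> ?K" "\<forall>j<n. b \<odot>\<^bsub>S\<^esub> y j = y j" using Suc by auto
  define w where "w = (1 - b) \<odot>\<^bsub>S\<^esub> y n"
  have yn: "y n \<in> carrier S" using Suc.prems by simp
  have w: "w \<in> carrier S" using yn by (simp add: w_def S.act_closed)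
  have "\<exists>a\<in>?K. a \<odot>\<^bsub>S\<^esub> w = w"
  proof (cases "w = \<zero>\<^bsub>S\<^esub>")
    case True
    then show ?thesis using b(1) by (auto simp: S.act_zero)
  next
    case False
    \<comment> \<open>Otherwise the common annihilator kills the nonzero w, and one of the T_i would
      be isomorphic to S.\<close>
    have "\<exists>a\<in>?K. a \<odot>\<^bsub>S\<^esub> w \<noteq> \<zero>\<^bsub>S\<^esub>"
    proof (rule ccontr)
      assume "\<not> (\<exists>a\<in>?K. a \<odot>\<^bsub>S\<^esub> w \<noteq> \<zero>\<^bsub>S\<^esub>)"
      then have "a \<odot>\<^bsub>S\<^esub> w = \<zero>\<^bsub>S\<^esub>" if "\<forall>i\<in>I. a \<odot>\<^bsub>T i\<^esub> x i = \<zero>\<^bsub>T i\<^esub>" for a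
        using that by blast
      from simple_annihilators[OF assms(1-3) w False T(1-3) this] obtain i where i: "i \<in> I" "mod_isomorphic (T i) S"
        by (rule bexE)
      show False by (rule notE[OF T(4)[OF i(1)] i(2)])
    qed
    then obtain a where "a \<in> ?K" "a \<odot>\<^bsub>S\<^esub> w \<noteq> \<zero>\<^bsub>S\<^esub>" by blast
    \<comment> \<open>The orbit of w under the annihilator is nonzero, so by simplicity it is all of
      S and contains w itself.\<close>
    then have "(\<lambda>a. a \<odot>\<^bsub>S\<^esub> w) ` ?K = carrier S"
      using S.orbit_submodule[OF K w] assms(3) unfolding simple_module_def by blast
    then show ?thesis using w by (metis (no_types, lifting) imageE)
  qed
  then obtain a where a: "a \<in> ?K" "a \<odot>\<^bsub>S\<^esub> w = w" by blast
  have diff: "0 \<in> ?K" "\<And>a b. a \<in> ?K \<Longrightarrow> b \<in> ?K \<Longrightarrow> a - b \<in> ?K" and mult: "\<And>a b. b \<in> ?K \<Longrightarrow> a * b \<in> ?K"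
    using K unfolding left_ideal_def by blast+
  \<comment> \<open>This is a + b - a b written with differences only. The term a b lies in the left
    ideal because its right factor b does.\<close>
  have "a - (0 - b) - a * b \<in> ?K"
    by (intro diff(2) mult diff(1) a(1) b(1))
  then have "a + b - a * b \<in> ?K" by (simp only: diff_0 diff_minus_eq_add)
  moreover have "(a + b - a * b) \<odot>\<^bsub>S\<^esub> v = v" if v: "v \<in> carrier S" "a \<odot>\<^bsub>S\<^esub> ((1 - b) \<odot>\<^bsub>S\<^esub> v) = (1 - b) \<odot>\<^bsub>S\<^esub> v" for v
  proof -
    have "(a + b - a * b) \<odot>\<^bsub>S\<^esub> v = (a * (1 - b) + b) \<odot>\<^bsub>S\<^esub> v" by (simp add: algebra_simps)
    also have "\<dots> = (1 - b) \<odot>\<^bsub>S\<^esub> v \<oplus>\<^bsub>S\<^esub> b \<odot>\<^bsub>S\<^esub> v" using v by (simp add: S.act_l_distr S.act_assoc)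
    also have "\<dots> = v" using v(1) by (simp add: S.act_one flip: S.act_l_distr)
    finally show ?thesis .
  qed
  \<comment> \<open>On the earlier vectors 1 - b gives zero, so the condition on a holds there
    trivially and they remain fixed.\<close>
  moreover have "(1 - b) \<odot>\<^bsub>S\<^esub> y j = \<zero>\<^bsub>S\<^esub>" if "j < n" for j
    using that b(2) Suc.prems[of j] by (simp add: S.diff_act S.act_one S.minus_eq_zero_iff)
  ultimately show ?case
    using a(2) yn Suc.prems by (intro exI[of _ "a + b - a * b"]) (auto simp: less_Suc_eq S.act_zero w_def)
qed

lemma mod_isomorphic_trans: "mod_isomorphic U V \<Longrightarrow> mod_isomorphic V W \<Longrightarrow> mod_isomorphic U W"
  unfolding mod_isomorphic_def mod_isos_def
  using mod_homs_comp bij_betw_trans by (fastforce simp: comp_def)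

lemma mod_isomorphic_refl: "mod_isomorphic V V"
  by (rule mod_isomorphicI[of "\<lambda>x. x" _ _ "\<lambda>x. x"]) (auto simp: mod_homs_def)

context finite_tensor_category
begin

section \<open>Characters of virtual objects\<close>

definition char_sum :: "(('h, 'v) module \<Rightarrow>\<^sub>0 int) \<Rightarrow> 'h \<Rightarrow> 'k" where
  "char_sum a = (\<lambda>h. \<Sum>V\<in>Poly_Mapping.keys a. of_int (Poly_Mapping.lookup a V) * char_elt H V h)"

lemma char_sum_superset:
  assumes "finite S" "Poly_Mapping.keys a \<subseteq> S"
  shows "char_sum a h = (\<Sum>V\<in>S. of_int (Poly_Mapping.lookup a V) * char_elt H V h)"
  unfolding char_sum_def using assms by (intro sum.mono_neutral_left) (auto simp: in_keys_iff)

lemma char_sum_diff: "char_sum (a - b) = (\<lambda>h. char_sum a h - char_sum b h)"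
proof
  fix h
  let ?S = "Poly_Mapping.keys a \<union> Poly_Mapping.keys b"
  have "Poly_Mapping.keys (a - b) \<subseteq> ?S" by (rule keys_diff)
  then show "char_sum (a - b) h = char_sum a h - char_sum b h"
    by (simp add: char_sum_superset[of ?S] lookup_minus left_diff_distrib sum_subtractf)
qed

lemma char_sum_zero: "char_sum 0 = (\<lambda>h. 0)"
  by (simp add: char_sum_def)

lemma char_sum_minus: "char_sum (- a) = (\<lambda>h. - char_sum a h)"
  using char_sum_diff[of 0 a] by (simp add: char_sum_zero)

lemma char_sum_add: "char_sum (a + b) = (\<lambda>h. char_sum a h + char_sum b h)"
  using char_sum_diff[of a "- b"] by (simp add: char_sum_minus)

lemma char_sum_of: "char_sum (frag_of V) = char_elt H V"
  by (simp add: char_sum_def)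

lemma char_sum_cmul: "char_sum (frag_cmul c a) = (\<lambda>h. of_int c * char_sum a h)"
  using keys_cmul[of c a]
  by (simp add: char_sum_superset[of "Poly_Mapping.keys a"] sum_distrib_left mult.assoc fun_eq_iff)

lemma char_elt_C_form: "V \<in> C \<Longrightarrow> char_elt H V \<in> Hdual"
  by (rule dual_system_exists[of V]) (auto intro: char_elt_form[OF separated_C])

lemma char_sum_form: "Poly_Mapping.keys a \<subseteq> C \<Longrightarrow> char_sum a \<in> Hdual"
  unfolding char_sum_def by (intro linear_forms_sum linear_forms_cmul char_elt_C_form) auto

lemma char_sum_I: "a \<in> I \<Longrightarrow> char_sum a = (\<lambda>h. 0)"
proof (induction rule: I_induct)
  case (relator V' V V'')
  obtain n :: nat and x f where 1: "dual_system V' {..<n} x f" by (rule dual_system_exists[OF relator(1)])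
  obtain m :: nat and y g where 2: "dual_system V'' {..<m} y g" by (rule dual_system_exists[OF relator(3)])
  show ?case
    using char_elt_short_exact[OF separated_C[OF relator(1)] separated_C[OF relator(2)] separated_C[OF relator(3)]
        relator(4) 1 2]
    by (simp add: char_sum_diff char_sum_add char_sum_of)
qed (simp_all add: char_sum_zero char_sum_minus char_sum_add)

lemma dual_algebra_diff:
  assumes "\<phi> \<in> Hdual" "\<xi> \<in> Hdual" "\<psi> \<in> Hdual"
  shows "(\<lambda>h. \<phi> h - \<xi> h) \<star> \<psi> =
      (\<lambda>h. (\<phi> \<star> \<psi>) h - (\<xi> \<star> \<psi>) h)"
    and "\<psi> \<star> (\<lambda>h. \<phi> h - \<xi> h) =
      (\<lambda>h. (\<psi> \<star> \<phi>) h - (\<psi> \<star> \<xi>) h)"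
  using dual_algebra_l_distr[OF assms(1) Hdual_uminus[OF assms(2)] assms(3)]
    dual_algebra_r_distr[OF assms(1) Hdual_uminus[OF assms(2)] assms(3)]
    dual_algebra_cmul[OF assms(2,3), of "-1" 1] dual_algebra_cmul[OF assms(3,2), of 1 "-1"]
  by simp_all

lemma char_sum_tmult:
  assumes "Poly_Mapping.keys a \<subseteq> C" "Poly_Mapping.keys b \<subseteq> C"
  shows "char_sum (tmult a b) = char_sum a \<star> char_sum b"
proof -
  have zero: "(\<lambda>h. 0) \<star> \<phi> = (\<lambda>h. 0)" "\<phi> \<star> (\<lambda>h. 0) = (\<lambda>h. 0)"
    if "\<phi> \<in> Hdual" for \<phi>
    using dual_algebra_diff[OF that that that] by simp_all
  \<comment> \<open>The support condition is carried through the induction because distributivity of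
    convolution is available for linear forms, and characters of objects in \<open>C\<close> are
    such forms.\<close>
  have "Poly_Mapping.keys a \<subseteq> C \<and> char_sum (tmult a b) = char_sum a \<star> char_sum b"
    using assms(1)
  proof (induction a rule: frag_induction)
    case (one V)
    have "Poly_Mapping.keys b \<subseteq> C \<and>
        char_sum (tmult (frag_of V) b) = char_sum (frag_of V) \<star> char_sum b"
      using assms(2)
    proof (induction b rule: frag_induction)
      case (one W)
      then show ?case
        using char_elt_mult[OF \<open>V \<in> C\<close> one tensor_obj_closed[OF \<open>V \<in> C\<close> one] fin_dim[OF \<open>V \<in> C\<close>] fin_dim[OF one]
            tensor_obj_iso[OF \<open>V \<in> C\<close> one]]
        by (simp add: tmult_of char_sum_of)
    next
      case (diff b c)
      then show ?case
        using char_elt_C_form[OF one]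
        by (simp add: keys_diff_C tmult_diff_right char_sum_diff char_sum_of dual_algebra_diff char_sum_form)
    qed (use char_elt_C_form[OF one] in \<open>simp add: tmult_zero char_sum_zero char_sum_of zero\<close>)
    then show ?case using one by simp
  next
    case (diff a c)
    then show ?case
      using char_sum_form[OF assms(2)]
      by (simp add: keys_diff_C tmult_diff_left char_sum_diff dual_algebra_diff char_sum_form)
  qed (use char_sum_form[OF assms(2)] in \<open>simp add: tmult_zero char_sum_zero zero\<close>)
  then show ?thesis ..
qed

text \<open>\<open>char_lattice\<close> allows repetitions in its families; on the free group these
  are merged into one coefficient, and conversely a finite support is enumerated.\<close>

lemma char_lattice_eq: "char_lattice H C = char_sum ` {a. Poly_Mapping.keys a \<subseteq> C}"
proof (intro equalityI subsetI)
  fix \<xi> assume "\<xi> \<in> char_lattice H C"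
  then obtain n :: nat and m and V :: "nat \<Rightarrow> _" where
    \<xi>: "\<xi> = (\<lambda>h. \<Sum>i<n. of_int (m i) * char_elt H (V i) h)" "\<forall>i<n. V i \<in> C"
    unfolding char_lattice_def by blast
  have "k \<le> n \<Longrightarrow> Poly_Mapping.keys (\<Sum>i<k. frag_cmul (m i) (frag_of (V i))) \<subseteq> C \<and>
      char_sum (\<Sum>i<k. frag_cmul (m i) (frag_of (V i))) = (\<lambda>h. \<Sum>i<k. of_int (m i) * char_elt H (V i) h)" for k
  proof (induction k)
    case 0
    then show ?case by (simp add: char_sum_zero)
  next
    case (Suc k)
    moreover have "Poly_Mapping.keys (frag_cmul (m k) (frag_of (V k))) \<subseteq> C"
      using Suc.prems \<xi>(2) keys_cmul[of "m k" "frag_of (V k)"] by auto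
    ultimately show ?case by (simp add: keys_add_C char_sum_add char_sum_cmul char_sum_of)
  qed
  from this[OF order_refl] show "\<xi> \<in> char_sum ` {a. Poly_Mapping.keys a \<subseteq> C}"
    unfolding \<xi>(1) by (intro image_eqI[of _ _ "\<Sum>i<n. frag_cmul (m i) (frag_of (V i))"]) simp_all
next
  fix \<xi> assume "\<xi> \<in> char_sum ` {a. Poly_Mapping.keys a \<subseteq> C}"
  then obtain a where a: "Poly_Mapping.keys a \<subseteq> C" "\<xi> = char_sum a" by auto
  obtain e where e: "bij_betw e {..<card (Poly_Mapping.keys a)} (Poly_Mapping.keys a)"
    using ex_bij_betw_nat_finite[of "Poly_Mapping.keys a"] by (auto simp: lessThan_atLeast0)
  have "\<xi> = (\<lambda>h. \<Sum>i<card (Poly_Mapping.keys a). of_int (Poly_Mapping.lookup a (e i)) * char_elt H (e i) h)"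
    unfolding a(2) char_sum_def
    using sum.reindex_bij_betw[OF e, of "\<lambda>V. of_int (Poly_Mapping.lookup a V) * char_elt H V _"] by auto
  moreover have "\<forall>i<card (Poly_Mapping.keys a). e i \<in> C" using bij_betwE[OF e] a(1) by auto
  ultimately show "\<xi> \<in> char_lattice H C"
    unfolding char_lattice_def
    by (intro CollectI exI[of _ "card (Poly_Mapping.keys a)"] exI[of _ "\<lambda>i. Poly_Mapping.lookup a (e i)"] exI[of _ e]) simp
qed

text \<open>In finite dimension \<open>star V\<close> is the full dual, so the functionals of a dual
  system are admissible in coefficients.\<close>

lemma coeffs_char_elt: "V \<in> C \<Longrightarrow> char_elt H V \<in> coeffs H star V"
proof -
  assume V: "V \<in> C"
  obtain n :: nat and x f where xf: "dual_system V {..<n} x f" by (rule dual_system_exists[OF V])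
  have "star V = full_dual H V" using duality V fin_dim[OF V] by (simp add: finite_duality_def)
  then show ?thesis
    using char_elt_eq[OF separated_C[OF V] xf] dual_systemD[OF xf]
    unfolding coeffs_eq[OF V] by (intro CollectI exI[of _ n] exI[of _ f] exI[of _ x]) simp
qed

lemma char_sum_invariant:
  assumes "Poly_Mapping.keys a \<subseteq> C" shows "char_sum a \<in> invariant_part (all_coeffs H C star)"
proof -
  have inv: "char_elt H V \<in> invariant_part (all_coeffs H C star)" if V: "V \<in> C" for V
  proof -
    obtain n :: nat and x f where xf: "dual_system V {..<n} x f" by (rule dual_system_exists[OF V])
    have "char_elt H V \<in> all_coeffs H C star"
      unfolding all_coeffs_eq using coeffs_char_elt[OF V] V by (intro span_sums_base) blast
    then show ?thesis
      using char_elt_commute[OF separated_C[OF V] xf] by (auto simp: invariant_part_def)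
  qed
  show ?thesis using assms
  proof (induction a rule: frag_induction)
    case zero
    then show ?case by (simp add: char_sum_zero invariant_part_def all_coeffs_eq span_sums_zero)
  next
    case (one V)
    then show ?case by (simp add: char_sum_of inv)
  next
    case (diff a b)
    then have ab: "char_sum a \<in> all_coeffs H C star" "char_sum b \<in> all_coeffs H C star"
      by (simp_all add: invariant_part_def)
    from all_coeffs_add[OF ab(1) all_coeffs_cmul[OF ab(2), of "-1"]] show ?case
      using diff by (simp add: invariant_part_def char_sum_diff fun_eq_iff)
  qed
qed

lemma char_sum_unit: "char_sum (frag_of (unit_obj H C)) = \<epsilon>"
proof -
  obtain \<phi> where "\<phi> \<in> mod_isos (trivial_module H) (unit_obj H C)"
    using unit_obj_iso unfolding mod_isomorphic_def by blast
  from char_elt_trivial[OF separated_C[OF unit_obj_closed] this] show ?thesis by (simp add: char_sum_of)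
qed

lemma subring_char_lattice:
  "subring (char_lattice H C) (dual_algebra H\<lparr>carrier := invariant_part (all_coeffs H C star)\<rparr>)"
proof -
  let ?A = "dual_algebra H\<lparr>carrier := invariant_part (all_coeffs H C star)\<rparr>"
  interpret A: ring ?A
    by (rule ring.subring_is_ring[OF ring_dual_algebra subring_invariant_part])
  have inv: "\<ominus>\<^bsub>?A\<^esub> char_sum a = char_sum (- a)" if "Poly_Mapping.keys a \<subseteq> C" for a
    by (rule A.minus_equality) (use that char_sum_invariant in \<open>auto simp: char_sum_minus[symmetric]\<close>, simp add: char_sum_minus)
  show ?thesis
  proof (rule A.subringI)
    show "char_lattice H C \<subseteq> carrier ?A" unfolding char_lattice_eq using char_sum_invariant by auto
    show "\<one>\<^bsub>?A\<^esub> \<in> char_lattice H C"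
      using char_sum_unit unit_obj_closed unfolding char_lattice_eq
      by (intro image_eqI[of _ _ "frag_of (unit_obj H C)"]) auto
    show "\<ominus>\<^bsub>?A\<^esub> \<phi> \<in> char_lattice H C" if "\<phi> \<in> char_lattice H C" for \<phi>
      using that inv unfolding char_lattice_eq by auto
    show "\<phi> \<otimes>\<^bsub>?A\<^esub> \<psi> \<in> char_lattice H C" "\<phi> \<oplus>\<^bsub>?A\<^esub> \<psi> \<in> char_lattice H C"
      if "\<phi> \<in> char_lattice H C" "\<psi> \<in> char_lattice H C" for \<phi> \<psi>
    proof -
      obtain a b where ab: "Poly_Mapping.keys a \<subseteq> C" "Poly_Mapping.keys b \<subseteq> C" "\<phi> = char_sum a" "\<psi> = char_sum b"
        using \<open>\<phi> \<in> char_lattice H C\<close> \<open>\<psi> \<in> char_lattice H C\<close> unfolding char_lattice_eq by auto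
      show "\<phi> \<otimes>\<^bsub>?A\<^esub> \<psi> \<in> char_lattice H C"
        unfolding char_lattice_eq using ab
        by (intro image_eqI[of _ _ "tmult a b"]) (simp_all add: char_sum_tmult keys_tmult)
      show "\<phi> \<oplus>\<^bsub>?A\<^esub> \<psi> \<in> char_lattice H C"
        unfolding char_lattice_eq using ab
        by (intro image_eqI[of _ _ "a + b"]) (simp_all add: char_sum_add keys_add_C)
    qed
  qed
qed

text \<open>The choice of representative is immaterial since relations have character zero.\<close>

definition char_map :: "(('h, 'v) module \<Rightarrow>\<^sub>0 int) set \<Rightarrow> 'h \<Rightarrow> 'k" where
  "char_map A = char_sum (SOME a. a \<in> A)"

lemma char_map_cls: "char_map (cls a) = char_sum a"
proof -
  have "(SOME x. x \<in> cls a) \<in> cls a" by (rule someI[of _ a]) (simp add: mem_cls I_zero)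
  then have "char_sum ((SOME x. x \<in> cls a) - a) = (\<lambda>h. 0)" by (intro char_sum_I) (simp add: mem_cls)
  then show ?thesis by (simp add: char_map_def char_sum_diff fun_eq_iff)
qed

lemma char_map_hom: "char_map \<in> ring_hom (K0 H C) (dual_algebra H\<lparr>carrier := char_lattice H C\<rparr>)"
  by (rule ring_hom_memI)
    (auto simp: K0_carrier K0_mult K0_add K0_one char_map_cls char_sum_tmult char_sum_add char_sum_unit char_lattice_eq)

lemma char_map_image: "char_map ` carrier (K0 H C) = char_lattice H C"
  by (simp add: K0_carrier char_lattice_eq image_image char_map_cls)

lemma K0_class_eq: "K0_class H C V = cls (frag_of V)"
  by (simp add: K0_class_def cls_def)

section \<open>Simple constituents and injectivity\<close>

definition simple_rep :: "('h, 'v) module \<Rightarrow> ('h, 'v) module" where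
  "simple_rep S = (SOME T. T \<in> C \<and> simple_module T \<and> mod_isomorphic S T)"

abbreviation "simple_reps \<equiv> simple_rep ` {S \<in> C. simple_module S}"

lemma simple_rep:
  assumes "S \<in> C" "simple_module S"
  shows "simple_rep S \<in> C" "simple_module (simple_rep S)" "mod_isomorphic S (simple_rep S)"
proof -
  have "\<exists>T. T \<in> C \<and> simple_module T \<and> mod_isomorphic S T" using assms mod_isomorphic_refl by blast
  from someI_ex[OF this]
  show "simple_rep S \<in> C" "simple_module (simple_rep S)" "mod_isomorphic S (simple_rep S)"
    by (auto simp: simple_rep_def)
qed

lemma iso_sym: "V \<in> C \<Longrightarrow> W \<in> C \<Longrightarrow> mod_isomorphic V W \<Longrightarrow> mod_isomorphic W V"
  using mod_isomorphic_sym left_module_C by blast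

text \<open>Isomorphic simple objects impose the same condition on their representative, so the
  choice returns the same object.\<close>

lemma simple_reps_unique:
  assumes "S \<in> simple_reps" "T \<in> simple_reps" "mod_isomorphic S T"
  shows "S = T"
proof -
  obtain S' T' where ST: "S' \<in> C" "simple_module S'" "S = simple_rep S'" "T' \<in> C" "simple_module T'" "T = simple_rep T'"
    using assms(1,2) by auto
  have S'T': "mod_isomorphic S' T'"
    using simple_rep ST assms(3) iso_sym mod_isomorphic_trans by metis
  have eq: "mod_isomorphic S' U \<longleftrightarrow> mod_isomorphic T' U" for U
    using S'T' iso_sym[OF ST(1,4)] mod_isomorphic_trans by blast
  show ?thesis unfolding ST(3,6) simple_rep_def eq ..
qed

lemma char_sum_simple_reps_zero:
  assumes char0: "CHAR('k) = 0" and a: "Poly_Mapping.keys a \<subseteq> simple_reps" and zero: "char_sum a = (\<lambda>h. 0)"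
  shows "a = 0"
proof -
  have False if S: "S \<in> Poly_Mapping.keys a" for S
  proof -
    have reps: "V \<in> C" "simple_module V" if "V \<in> Poly_Mapping.keys a" for V
      using that a simple_rep by auto
    note SC = reps(1)[OF S]
    have "\<forall>V\<in>Poly_Mapping.keys a. \<exists>nxf. dual_system V {..<fst nxf :: nat} (fst (snd nxf)) (snd (snd nxf))"
      using dual_system_exists reps(1) by (metis fst_conv snd_conv)
    then obtain d where "\<forall>V\<in>Poly_Mapping.keys a. dual_system V {..<fst (d V) :: nat} (fst (snd (d V))) (snd (snd (d V)))"
      by (rule bchoice[elim_format]) blast
    moreover define n x f where "n V = fst (d V)" and "x V = fst (snd (d V))" and "f V = snd (snd (d V))" for V
    ultimately have sys: "\<And>V. V \<in> Poly_Mapping.keys a \<Longrightarrow> dual_system V {..<n V} (x V) (f V)"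
      by simp
    \<comment> \<open>All pairs of another simple module in the support and an index of a basis
      vector of it. An element killing these vectors has trace zero on every module other than
      S.\<close>
    let ?J = "Sigma (Poly_Mapping.keys a - {S}) (\<lambda>V. {..<n V})"
    have "\<exists>b. (\<forall>k\<in>?J. b \<odot>\<^bsub>fst k\<^esub> x (fst k) (snd k) = \<zero>\<^bsub>fst k\<^esub>) \<and> (\<forall>j<n S. b \<odot>\<^bsub>S\<^esub> x S j = x S j)"
    proof (rule simple_separating_element)
      show "finite ?J" by simp
      show "left_module S" "simple_module S" using left_module_C reps S by auto
      show "x S j \<in> carrier S" if "j < n S" for j using dual_system_carrier[OF sys[OF S]] that by auto
      fix k assume k: "k \<in> ?J"
      then have kV: "fst k \<in> Poly_Mapping.keys a" "fst k \<noteq> S" "snd k < n (fst k)" by auto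
      show "left_module (fst k)" "simple_module (fst k)" using left_module_C reps kV by auto
      show "x (fst k) (snd k) \<in> carrier (fst k)" using dual_system_carrier[OF sys[OF kV(1)]] kV(3) by auto
      show "\<not> mod_isomorphic (fst k) S" using simple_reps_unique[of "fst k" S] a kV S by blast
    qed
    then obtain b where b: "\<And>V i. V \<in> Poly_Mapping.keys a \<Longrightarrow> V \<noteq> S \<Longrightarrow> i < n V \<Longrightarrow> b \<odot>\<^bsub>V\<^esub> x V i = \<zero>\<^bsub>V\<^esub>"
      "\<And>j. j < n S \<Longrightarrow> b \<odot>\<^bsub>S\<^esub> x S j = x S j" by fastforce
    have other: "char_elt H V b = 0" if "V \<in> Poly_Mapping.keys a" "V \<noteq> S" for V
      using b(1)[OF that] char_elt_eq[OF separated_C[OF reps(1)[OF that(1)]] sys[OF that(1)]]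
        dual_zero[OF left_module_C[OF reps(1)[OF that(1)]] dual_system_dual[OF sys[OF that(1)]]] by simp
    have "char_elt H S b = char_elt H S 1"
      using b(2) char_elt_eq[OF separated_C[OF SC] sys[OF S]] dual_system_carrier[OF sys[OF S]]
        left_module.act_one[OF left_module_C[OF SC]] by simp
    moreover obtain m :: nat where m: "char_elt H S 1 = of_nat m" "m = 0 \<longleftrightarrow> carrier S = {\<zero>\<^bsub>S\<^esub>}"
      by (rule char_elt_one[OF separated_C[OF SC] fin_dim[OF SC]])
    moreover have "char_sum a b = of_int (Poly_Mapping.lookup a S) * char_elt H S b"
      unfolding char_sum_def using S other by (subst sum.remove[of _ S]) auto
    \<comment> \<open>Evaluation at b leaves the coefficient of S times its dimension, as an element
      of the field; characteristic zero turns this into an equation of integers.\<close>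
    ultimately have "of_int (Poly_Mapping.lookup a S * int m) = (0 :: 'k)" using zero by simp
    then have "Poly_Mapping.lookup a S * int m = 0" using char0 by (simp only: of_int_eq_0_iff_char_dvd) simp
    moreover have "m \<noteq> 0" using m(2) reps(2)[OF S] by (simp add: simple_module_def)
    ultimately show False using S by (simp add: in_keys_iff)
  qed
  then have "Poly_Mapping.keys a = {}" by blast
  then show ?thesis by simp
qed

text \<open>U is a copy of N inside \<open>C\<close>, mapped into V by the inverse isomorphism
  followed by inclusion, and Q is a cokernel supplied by the abelian structure. Properness of N on
  both sides keeps U and Q nonzero.\<close>

lemma submodule_short_exact:
  assumes V: "V \<in> C" and N: "is_submodule N V" "N \<noteq> {\<zero>\<^bsub>V\<^esub>}" "N \<noteq> carrier V"
  obtains U Q where "U \<in> C" "Q \<in> C" "short_exact U V Q" "carrier U \<noteq> {\<zero>\<^bsub>U\<^esub>}" "carrier Q \<noteq> {\<zero>\<^bsub>Q\<^esub>}"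
proof -
  interpret V: left_module V using V by (rule left_module_C)
  have NV: "N \<subseteq> carrier V" and zeroN: "\<zero>\<^bsub>V\<^esub> \<in> N"
    and addN: "\<And>x y. x \<in> N \<Longrightarrow> y \<in> N \<Longrightarrow> x \<oplus>\<^bsub>V\<^esub> y \<in> N" and actN: "\<And>h x. x \<in> N \<Longrightarrow> h \<odot>\<^bsub>V\<^esub> x \<in> N"
    using N(1) subgroup.subset[of N "add_monoid V"] subgroup.one_closed[of N "add_monoid V"]
      subgroup.m_closed[of N "add_monoid V"] unfolding is_submodule_def by auto
  obtain U where U: "U \<in> C" "mod_isomorphic (V\<lparr>carrier := N\<rparr>) U"
    using submodules V N(1) unfolding closed_under_submodules_def ess_mem_def by blast
  interpret U: left_module U using U(1) by (rule left_module_C)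
  obtain g where g: "g \<in> mod_homs (V\<lparr>carrier := N\<rparr>) U" "bij_betw g N (carrier U)"
    using U(2) by (auto simp: mod_isomorphic_def mod_isos_def)
  have gN: "g (x \<oplus>\<^bsub>V\<^esub> y) = g x \<oplus>\<^bsub>U\<^esub> g y" "g (h \<odot>\<^bsub>V\<^esub> x) = h \<odot>\<^bsub>U\<^esub> g x" if "x \<in> N" "y \<in> N" for x y h
    using g(1) that by (auto simp: mod_homs_def)
  let ?i = "inv_into N g"
  have i: "?i u \<in> N" "g (?i u) = u" if "u \<in> carrier U" for u
    using that g(2) by (auto simp: bij_betw_def inv_into_into f_inv_into_f)
  have ig: "?i (g x) = x" if "x \<in> N" for x using that g(2) by (simp add: bij_betw_def)
  have bij_i: "bij_betw ?i (carrier U) N" by (rule bij_betw_inv_into[OF g(2)])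
  have hom_i: "?i \<in> mod_homs U V"
    unfolding mod_homs_def
  proof (intro CollectI conjI ballI allI)
    show "?i \<in> carrier U \<rightarrow> carrier V" using i(1) NV by auto
    show "?i (u \<oplus>\<^bsub>U\<^esub> u') = ?i u \<oplus>\<^bsub>V\<^esub> ?i u'" if "u \<in> carrier U" "u' \<in> carrier U" for u u'
      using ig[OF addN[OF i(1)[OF that(1)] i(1)[OF that(2)]]] gN(1) i that by simp
    show "?i (h \<odot>\<^bsub>U\<^esub> u) = h \<odot>\<^bsub>V\<^esub> ?i u" if "u \<in> carrier U" for h u
      using ig[OF actN[OF i(1)[OF that], of h]] gN(2)[OF i(1)[OF that] i(1)[OF that], of h] i(2)[OF that] by simp
  qed
  obtain Q p where Q: "Q \<in> C" "p \<in> mod_homs V Q" "p ` carrier V = carrier Q" "mod_ker V Q p = ?i ` carrier U"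
    using abelian U(1) V hom_i unfolding full_abelian_subcategory_def by blast
  have img: "?i ` carrier U = N" and inj: "inj_on ?i (carrier U)" using bij_i by (auto simp: bij_betw_def)
  have "short_exact U V Q"
    unfolding short_exact_def using hom_i Q inj by (intro bexI[of _ ?i] bexI[of _ p]) auto
  moreover have "carrier U \<noteq> {\<zero>\<^bsub>U\<^esub>}"
  proof
    assume "carrier U = {\<zero>\<^bsub>U\<^esub>}"
    then have "N = {?i \<zero>\<^bsub>U\<^esub>}" using img by auto
    then show False using zeroN N(2) by (metis singletonD)
  qed
  moreover have "carrier Q \<noteq> {\<zero>\<^bsub>Q\<^esub>}"
  proof
    assume "carrier Q = {\<zero>\<^bsub>Q\<^esub>}"
    then have "mod_ker V Q p = carrier V" using Q(3) by (auto simp: mod_ker_def)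
    then show False using Q(4) img N(3) by simp
  qed
  ultimately show ?thesis using U(1) Q(1) that by blast
qed

text \<open>Strong induction on the dimension, which is accessible as the trace of 1. A proper
  nonzero submodule splits the class into two of smaller dimension.\<close>

lemma simple_decomposition:
  assumes char0: "CHAR('k) = 0" and "V \<in> C" "char_elt H V 1 = of_nat d"
  shows "\<exists>a. Poly_Mapping.keys a \<subseteq> simple_reps \<and> frag_of V - a \<in> I"
  using assms(2,3)
proof (induction d arbitrary: V rule: less_induct)
  case (less d)
  \<comment> \<open>Characteristic zero lets dimensions be compared through their images in the
    field.\<close>
  have of_nat_eq: "m = n" if "of_nat m = (of_nat n :: 'k)" for m n
  proof -
    have "of_int (int m - int n) = (0 :: 'k)" using that by simp
    then show ?thesis using char0 by (simp only: of_int_eq_0_iff_char_dvd) simp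
  qed
  consider "carrier V = {\<zero>\<^bsub>V\<^esub>}" | "simple_module V"
    | N where "is_submodule N V" "N \<noteq> {\<zero>\<^bsub>V\<^esub>}" "N \<noteq> carrier V"
    unfolding simple_module_def by blast
  then show ?case
  proof cases
    case 1
    then show ?thesis using zero_object_I[OF less.prems(1)] by (intro exI[of _ 0]) simp
  next
    case 2
    then show ?thesis
      using iso_I[OF less.prems(1) simple_rep(1,3)] less.prems(1)
      by (intro exI[of _ "frag_of (simple_rep V)"]) auto
  next
    case 3
    obtain U Q where U: "U \<in> C" and Q: "Q \<in> C" and se: "short_exact U V Q"
      and nz: "carrier U \<noteq> {\<zero>\<^bsub>U\<^esub>}" "carrier Q \<noteq> {\<zero>\<^bsub>Q\<^esub>}"
      by (rule submodule_short_exact[OF less.prems(1) 3])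
    obtain m where m: "char_elt H U 1 = of_nat m" "m = 0 \<longleftrightarrow> carrier U = {\<zero>\<^bsub>U\<^esub>}"
      by (rule char_elt_one[OF separated_C[OF U] fin_dim[OF U]])
    obtain n where n: "char_elt H Q 1 = of_nat n" "n = 0 \<longleftrightarrow> carrier Q = {\<zero>\<^bsub>Q\<^esub>}"
      by (rule char_elt_one[OF separated_C[OF Q] fin_dim[OF Q]])
    have rel: "frag_of V - (frag_of U + frag_of Q) \<in> I" by (rule I_relator[OF U less.prems(1) Q se])
    have "char_elt H V 1 = char_elt H U 1 + char_elt H Q 1"
      using char_sum_I[OF rel] by (simp add: char_sum_diff char_sum_add char_sum_of fun_eq_iff)
    then have "d = m + n" using less.prems(2) m n by (intro of_nat_eq) simp
    then have "m < d" "n < d" using m(2) n(2) nz by auto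
    from less.IH[OF this(1) U m(1)] less.IH[OF this(2) Q n(1)]
    obtain a b where ab: "Poly_Mapping.keys a \<subseteq> simple_reps" "frag_of U - a \<in> I"
      "Poly_Mapping.keys b \<subseteq> simple_reps" "frag_of Q - b \<in> I" by blast
    have "(frag_of V - (frag_of U + frag_of Q)) + ((frag_of U - a) + (frag_of Q - b)) \<in> I"
      by (intro I_add rel ab)
    then have "frag_of V - (a + b) \<in> I" by (simp add: algebra_simps)
    moreover have "Poly_Mapping.keys (a + b) \<subseteq> simple_reps" using Poly_Mapping.keys_add[of a b] ab by blast
    ultimately show ?thesis by blast
  qed
qed

text \<open>Modulo relations, which do not change the character, the element becomes a combination
  of pairwise non-isomorphic simple objects; independence of their characters forces that
  combination to vanish.\<close>

lemma char_sum_eq_zero_I: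
  assumes char0: "CHAR('k) = 0" and a: "Poly_Mapping.keys a \<subseteq> C" and zero: "char_sum a = (\<lambda>h. 0)"
  shows "a \<in> I"
proof -
  have "\<exists>b. Poly_Mapping.keys b \<subseteq> simple_reps \<and> a - b \<in> I"
    using a
  proof (induction a rule: frag_induction)
    case zero
    then show ?case using I_zero by (intro exI[of _ 0]) simp
  next
    case (one V)
    obtain d where "char_elt H V 1 = of_nat d"
      by (rule char_elt_one[OF separated_C[OF one] fin_dim[OF one]])
    then show ?case by (rule simple_decomposition[OF char0 one])
  next
    case (diff a b)
    then obtain a' b' where ab: "Poly_Mapping.keys a' \<subseteq> simple_reps" "a - a' \<in> I"
      "Poly_Mapping.keys b' \<subseteq> simple_reps" "b - b' \<in> I" by blast
    have "a - b - (a' - b') \<in> I" using I_diff[OF ab(2,4)] by (simp add: algebra_simps)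
    moreover have "Poly_Mapping.keys (a' - b') \<subseteq> simple_reps" using keys_diff[of a' b'] ab by blast
    ultimately show ?case by blast
  qed
  then obtain b where b: "Poly_Mapping.keys b \<subseteq> simple_reps" "a - b \<in> I" by blast
  have "char_sum b = (\<lambda>h. 0)" using char_sum_I[OF b(2)] zero by (simp add: char_sum_diff fun_eq_iff)
  then have "b = 0" by (rule char_sum_simple_reps_zero[OF char0 b(1)])
  then show ?thesis using b(2) by simp
qed

lemma char_map_iso:
  assumes "CHAR('k) = 0"
  shows "char_map \<in> ring_iso (K0 H C) (dual_algebra H\<lparr>carrier := char_lattice H C\<rparr>)"
proof -
  have "inj_on char_map (carrier (K0 H C))"
  proof (rule inj_onI)
    fix x y assume "x \<in> carrier (K0 H C)" "y \<in> carrier (K0 H C)" and eq: "char_map x = char_map y"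
    then obtain a b where ab: "x = cls a" "y = cls b" "Poly_Mapping.keys a \<subseteq> C" "Poly_Mapping.keys b \<subseteq> C"
      by (auto simp: K0_carrier)
    have "a - b \<in> I"
      using ab eq by (intro char_sum_eq_zero_I[OF assms]) (simp_all add: keys_diff_C char_map_cls char_sum_diff)
    then show "x = y" using ab by (simp add: cls_eq_iff)
  qed
  then show ?thesis using char_map_hom char_map_image by (simp add: ring_iso_def bij_betw_def)
qed

end

theorem theorem1p4:
  fixes H :: "('k::field, 'h::ring_1) bialg"
    and C :: "('h, 'v) module set"
    and star :: "('h, 'v) module \<Rightarrow> ('v \<Rightarrow> 'k) set"
  assumes "bialgebra H"
    and "full_abelian_subcategory C"
    and "closed_under_submodules C"
    and "tensor_subcategory H C"
    and "finite_duality H C star"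
    and "star_tensor_compatible H C star"
  shows
    "(\<forall>V\<in>C. \<forall>V'\<in>C. \<forall>T\<in>C. mod_isomorphic (tensor_module H V V') T \<longrightarrow>
        products_span H (coeffs H star V) (coeffs H star V') = coeffs H star T) \<and>
     subring (all_coeffs H C star) (dual_algebra H) \<and>
     (\<forall>c. \<forall>\<xi>\<in>all_coeffs H C star. (\<lambda>h. c * \<xi> h) \<in> all_coeffs H C star) \<and>
     (\<forall>V\<in>C. \<forall>V'\<in>C. \<forall>T\<in>C. fin_dim H V \<and> fin_dim H V' \<and> mod_isomorphic (tensor_module H V V') T \<longrightarrow>
        char_elt H V \<otimes>\<^bsub>dual_algebra H\<^esub> char_elt H V' = char_elt H T) \<and>
     ((\<forall>V\<in>C. fin_dim H V) \<longrightarrow>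
        ring (dual_algebra H\<lparr>carrier := invariant_part (all_coeffs H C star)\<rparr>) \<and>
        subring (char_lattice H C) (dual_algebra H\<lparr>carrier := invariant_part (all_coeffs H C star)\<rparr>) \<and>
        ring (K0 H C) \<and>
        (\<exists>\<Phi>\<in>ring_hom (K0 H C) (dual_algebra H\<lparr>carrier := char_lattice H C\<rparr>).
           (\<forall>V\<in>C. \<Phi> (K0_class H C V) = char_elt H V) \<and>
           \<Phi> ` carrier (K0 H C) = char_lattice H C \<and>
           (CHAR('k) = 0 \<longrightarrow>
              \<Phi> \<in> ring_iso (K0 H C) (dual_algebra H\<lparr>carrier := char_lattice H C\<rparr>))))"
proof -
  interpret tensor_category H C star by unfold_locales fact+
  have finite: "ring (dual_algebra H\<lparr>carrier := invariant_part (all_coeffs H C star)\<rparr>) \<and>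
        subring (char_lattice H C) (dual_algebra H\<lparr>carrier := invariant_part (all_coeffs H C star)\<rparr>) \<and>
        ring (K0 H C) \<and>
        (\<exists>\<Phi>\<in>ring_hom (K0 H C) (dual_algebra H\<lparr>carrier := char_lattice H C\<rparr>).
           (\<forall>V\<in>C. \<Phi> (K0_class H C V) = char_elt H V) \<and>
           \<Phi> ` carrier (K0 H C) = char_lattice H C \<and>
           (CHAR('k) = 0 \<longrightarrow>
              \<Phi> \<in> ring_iso (K0 H C) (dual_algebra H\<lparr>carrier := char_lattice H C\<rparr>)))"
    if "\<forall>V\<in>C. fin_dim H V"
  proof -
    interpret finite_tensor_category H C star by unfold_locales (use that in blast)
    show ?thesis
      using ring.subring_is_ring[OF ring_dual_algebra subring_invariant_part] subring_char_lattice ring_K0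
      by (intro conjI bexI[of _ char_map] ballI impI)
        (simp_all add: K0_class_eq char_map_cls char_sum_of char_map_image char_map_hom char_map_iso)
  qed
  have products: "\<forall>V\<in>C. \<forall>V'\<in>C. \<forall>T\<in>C. mod_isomorphic (tensor_module H V V') T \<longrightarrow>
      products_span H (coeffs H star V) (coeffs H star V') = coeffs H star T"
    by (intro ballI impI coeffs_tensor)
  have cmul: "\<forall>c. \<forall>\<xi>\<in>all_coeffs H C star. (\<lambda>h. c * \<xi> h) \<in> all_coeffs H C star"
    by (intro allI ballI all_coeffs_cmul)
  have chars: "\<forall>V\<in>C. \<forall>V'\<in>C. \<forall>T\<in>C.
      fin_dim H V \<and> fin_dim H V' \<and> mod_isomorphic (tensor_module H V V') T \<longrightarrow>
      char_elt H V \<otimes>\<^bsub>dual_algebra H\<^esub> char_elt H V' = char_elt H T"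
    by (intro ballI impI, elim conjE) (rule char_elt_mult)
  show ?thesis
    by (rule conjI[OF products conjI[OF subring_all_coeffs conjI[OF cmul conjI[OF chars impI[OF finite]]]]])
qed

end
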